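(* Let $k\ge 1$ and $0\le s\le k$ be integers, let $\gamma>0$ and $\delta\in\{1,0,-1\}$, and let $u_k^{dg}\in DG(\mathcal T_h,k)$ satisfy $$a_{dg}(u_k^{dg},v)=(f,v)_\Omega-\langle g,v\rangle_{\Gamma_N}\qquad\forall v\in DG(\mathcal T_h,k).$$ Let $\tilde{\boldsymbol\sigma}_s^{dg}=\tilde{\boldsymbol\sigma}_s(u_k^{dg})\in RT(\mathcal T_h,s)$ be the weighted averaging flux, and let $\boldsymbol\sigma_s^\Delta\in RT(\mathcal T_h,s)$ be defined by $$\int_F\boldsymbol\sigma_s^\Delta\cdot\mathbf n_F\,\phi\,ds=\begin{cases}\gamma\,\dfrac{\alpha_{F,\min}}{h_F}\displaystyle\int_F[\![u_k^{dg}]\!]\,\phi\,ds,& F\in\mathcal E\setminus\mathcal E_N,\\[2mm] 0,& F\in\mathcal E_N,\end{cases}\qquad\forall\phi\in\mathbb P_s(F),$$ and, when $s\ge1$, additionally by $$(\boldsymbol\sigma_s^\Delta,\boldsymbol\psi)_K=-\delta\sum_{F\in\mathcal E_K\setminus\mathcal E_N}\int_F\{A\boldsymbol\psi\cdot\mathbf n_F\}_w^F\,[\![u_k^{dg}]\!]\,ds\qquad\forall\boldsymbol\psi\in\mathbb P_{s-1}(K)^d,\ \forall K\in\mathcal T_h,$$ where $\boldsymbol\psi$ is extended by zero outside $K$. Then $\hat{\boldsymbol\sigma}_h^{dg}:=\tilde{\boldsymbol\sigma}_s^{dg}+\boldsymbol\sigma_s^\Delta$ belongs to $RT(\mathcal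 T_h,s)$ and is locally conservative: $\hat{\boldsymbol\sigma}_h^{dg}\in RT_f(\mathcal T_h,s)$.
   Context: Domain and mesh: $\Omega\subset\mathbb R^d$ ($d=2,3$) is a bounded polygonal/polyhedral domain with Lipschitz boundary $\partial\Omega=\overline\Gamma_D\cup\overline\Gamma_N$, $\Gamma_D\cap\Gamma_N=\emptyset$, $\mathrm{meas}_{d-1}(\Gamma_D)\ne0$. $\mathcal T_h$ is a regular conforming simplicial partition of $\Omega$. $\mathcal E=\mathcal E_I\cup\mathcal E_D\cup\mathcal E_N$ is the set of facets ($(d-1)$-dimensional faces): interior ones, those on $\Gamma_D$, those on $\Gamma_N$; $\mathcal E_K$ is the set of facets of $K$. $h_F$ is the diameter of $F$ and $\mathbf n_F$ a fixed unit normal. For $F\in\mathcal E_I$, $K_F^-,K_F^+$ are the two elements sharing $F$, with $\mathbf n_F$ the outward normal of $K_F^-$; for boundary $F$, $\mathbf n_F$ is outward to $\Omega$ and $K_F^-$ is the element containing $F$. $v_F^\pm$ are the traces of $v$ from $K_F^\pm$. Data: $A$ is symmetric positive definite and constant on each $K\in\mathcal T_h$; $f\in L^2(\Omega)$; $g|_F\in\mathbb P_{k-1}(F)$ for $F\in\mathcal E_N$. $\mathbb P_m$ denotes polynomials of degree at most $m$. Jumps and averages: $[\![v]\!]_F=v_F^--v_F^+$ on $F\in\mathcal E_I$ and $[\![v]\!]_F=v_F^-$ on boundary facets. $\alpha_F^\pm$ is the maximal eigenvalue of $A|_{K_F^\pm}$; $w_F^\pm=\alpha_F^\mp/(\alpha_F^-+\alpha_F^+)$;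 $\alpha_{F,\min}=\min(\alpha_F^+,\alpha_F^-)$ for $F\in\mathcal E_I$ and $\alpha_{F,\min}=\alpha_F^-$ for $F\in\mathcal E_D$. $\{v\}_w^F=w_F^+v_F^++w_F^-v_F^-$ on $F\in\mathcal E_I$, $\{v\}_w^F=v$ on boundary facets. Spaces: $DG(\mathcal T_h,m)=\{v\in L^2(\Omega): v|_K\in\mathbb P_m(K)\ \forall K\}$; $RT(K,m)=\mathbb P_m(K)^d+\mathbf x\,\mathbb P_m(K)$; $RT(\mathcal T_h,m)=\{\boldsymbol\tau\in H(\mathrm{div};\Omega):\boldsymbol\tau|_K\in RT(K,m)\ \forall K\}$; $RT_f(\mathcal T_h,m)=\{\boldsymbol\tau\in RT(\mathcal T_h,m):\nabla\cdot\boldsymbol\tau=f_m\text{ in }\Omega,\ \boldsymbol\tau\cdot\mathbf n_F=g_{m,F}\text{ on }F\in\mathcal E_N\}$, where $f_m$ is the $L^2$ projection of $f$ onto $DG(\mathcal T_h,m)$ and $g_{m,F}$ that of $g|_F$ onto $\mathbb P_m(F)$. DG form ($\nabla_h$ is the elementwise gradient): $$a_{dg}(u,v)=(A\nabla_hu,\nabla_hv)+\sum_{F\in\mathcal E\setminus\mathcal E_N}\int_F\gamma\frac{\alpha_{F,\min}}{h_F}[\![u]\!][\![v]\!]\,ds-\sum_{F\in\mathcal E\setminus\mathcal E_N}\int_F\{A\nabla u\cdot\mathbf n_F\}_w^F[\![v]\!]\,ds+\delta\sum_{F\in\mathcal E\setminus\mathcal E_N}\int_F\{A\nabla v\cdot\mathbf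 n_F\}_w^F[\![u]\!]\,ds.$$ Weighted averaging flux: for $u_h\in DG(\mathcal T_h,k)$ and $0\le s\le k$, $\tilde{\boldsymbol\sigma}_s(u_h)\in RT(\mathcal T_h,s)$ is determined by $\int_F\tilde{\boldsymbol\sigma}_s(u_h)\cdot\mathbf n_F\phi\,ds=-\int_F\{A\nabla u_h\cdot\mathbf n_F\}_w^F\phi\,ds$ for $F\in\mathcal E\setminus\mathcal E_N$ and $=\int_Fg\phi\,ds$ for $F\in\mathcal E_N$, for all $\phi\in\mathbb P_s(F)$, and, if $s\ge1$, $(\tilde{\boldsymbol\sigma}_s(u_h),\boldsymbol\psi)_K=-(A\nabla u_h,\boldsymbol\psi)_K$ for all $\boldsymbol\psi\in\mathbb P_{s-1}(K)^d$, $K\in\mathcal T_h$. *)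

theory Defs
  imports "HOL-Analysis.Analysis"
begin

section \<open>Function spaces\<close>

definition L2 :: "(real^'n) set \<Rightarrow> (real^'n \<Rightarrow> 'b::real_normed_vector) \<Rightarrow> bool" where
  "L2 S f \<longleftrightarrow> f \<in> borel_measurable (lebesgue_on S) \<and>
              integrable (lebesgue_on S) (\<lambda>x. (norm (f x))\<^sup>2)"

text \<open>Polynomials of total degree at most \<open>m\<close>. The spaces \<open>P\<^sub>m(K)\<close> and \<open>P\<^sub>m(F)\<close> are obtained by
  restricting these functions to an element \<open>K\<close> or a facet \<open>F\<close>.\<close>

definition Pol :: "nat \<Rightarrow> (real^'n \<Rightarrow> real) set" where
  "Pol m = {p. \<exists>c :: ('n \<Rightarrow> nat) \<Rightarrow> real.
      p = (\<lambda>x. \<Sum>\<alpha> | sum \<alpha> UNIV \<le> m. c \<alpha> * (\<Prod>i\<in>UNIV. x $ i ^ \<alpha> i))}"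

definition PolV :: "nat \<Rightarrow> (real^'n \<Rightarrow> real^'n) set" where
  "PolV m = {p. \<forall>i. (\<lambda>x. p x $ i) \<in> Pol m}"

definition RT_elem :: "nat \<Rightarrow> (real^'n \<Rightarrow> real^'n) set" where
  "RT_elem m = {\<tau>. \<exists>p\<in>PolV m. \<exists>q\<in>Pol m. \<tau> = (\<lambda>x. p x + q x *\<^sub>R x)}"

text \<open>For a function that is almost everywhere equal to a polynomial on \<open>K\<close>, this is that
  polynomial (unique if \<open>K\<close> has nonempty interior). It provides the gradient of the function on
  \<open>K\<close> and, evaluated on a facet of \<open>K\<close>, its trace from \<open>K\<close>.\<close>

definition on_elem ::
    "(real^'n \<Rightarrow> 'b::real_normed_vector) \<Rightarrow> (real^'n) set \<Rightarrow> real^'n \<Rightarrow> 'b" where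
  "on_elem v K = (THE p. polynomial_function p \<and> (AE x in lebesgue_on K. v x = p x))"

definition partial_deriv :: "'n \<Rightarrow> (real^'n \<Rightarrow> real) \<Rightarrow> real^'n \<Rightarrow> real" where
  "partial_deriv i f x = frechet_derivative f (at x) (axis i 1)"

definition grad :: "(real^'n \<Rightarrow> real) \<Rightarrow> real^'n \<Rightarrow> real^'n" where
  "grad f x = (\<chi> i. partial_deriv i f x)"

primrec C_diff :: "nat \<Rightarrow> (real^'n \<Rightarrow> real) \<Rightarrow> bool" where
  "C_diff 0 f \<longleftrightarrow> continuous_on UNIV f"
| "C_diff (Suc j) f \<longleftrightarrow> (\<forall>x. f differentiable (at x)) \<and> (\<forall>i. C_diff j (partial_deriv i f))"

definition test_functions :: "(real^'n) set \<Rightarrow> (real^'n \<Rightarrow> real) set" where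
  "test_functions \<Omega> = {\<phi>. (\<forall>j. C_diff j \<phi>) \<and>
      compact (closure {x. \<phi> x \<noteq> 0}) \<and> closure {x. \<phi> x \<noteq> 0} \<subseteq> \<Omega>}"

definition has_weak_div ::
    "(real^'n) set \<Rightarrow> (real^'n \<Rightarrow> real^'n) \<Rightarrow> (real^'n \<Rightarrow> real) \<Rightarrow> bool" where
  "has_weak_div \<Omega> \<tau> q \<longleftrightarrow> (\<forall>\<phi>\<in>test_functions \<Omega>.
      (LINT x|lebesgue_on \<Omega>. \<tau> x \<bullet> grad \<phi> x) = - (LINT x|lebesgue_on \<Omega>. q x * \<phi> x))"

definition Hdiv :: "(real^'n) set \<Rightarrow> (real^'n \<Rightarrow> real^'n) set" where
  "Hdiv \<Omega> = {\<tau>. L2 \<Omega> \<tau> \<and> (\<exists>q. L2 \<Omega> q \<and> has_weak_div \<Omega> \<tau> q)}"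

section \<open>Domain and mesh\<close>

definition lipschitz_boundary :: "(real^'n) set \<Rightarrow> bool" where
  "lipschitz_boundary \<Omega> \<longleftrightarrow> (\<forall>p\<in>frontier \<Omega>. \<exists>U e L \<zeta>.
      open U \<and> p \<in> U \<and> norm e = 1 \<and> L-lipschitz_on {y. y \<bullet> e = 0} \<zeta> \<and>
      \<Omega> \<inter> U = {x \<in> U. x \<bullet> e < \<zeta> (x - (x \<bullet> e) *\<^sub>R e)})"

definition polyhedral_domain :: "(real^'n) set \<Rightarrow> bool" where
  "polyhedral_domain \<Omega> \<longleftrightarrow> open \<Omega> \<and> connected \<Omega> \<and> \<Omega> \<noteq> {} \<and> bounded \<Omega> \<and>
      (\<exists>\<P>. finite \<P> \<and> (\<forall>P\<in>\<P>. polytope P) \<and> closure \<Omega> = \<Union>\<P>) \<and>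
      lipschitz_boundary \<Omega>"

text \<open>\<open>Kminus\<close>, \<open>Kplus\<close> and \<open>normal\<close> map a facet \<open>F\<close> to \<open>K\<^sub>F\<^sup>-\<close>, \<open>K\<^sub>F\<^sup>+\<close> and \<open>n\<^sub>F\<close>;
  \<open>Kplus\<close> is only meaningful on interior facets.\<close>

record ('n::finite) dg_mesh =
  dom :: "(real^'n) set"
  gam_D :: "(real^'n) set"
  gam_N :: "(real^'n) set"
  elems :: "(real^'n) set set"
  Kminus :: "(real^'n) set \<Rightarrow> (real^'n) set"
  Kplus :: "(real^'n) set \<Rightarrow> (real^'n) set"
  normal :: "(real^'n) set \<Rightarrow> real^'n"

definition facets :: "'n::finite dg_mesh \<Rightarrow> (real^'n) set set" where
  "facets M = {F. \<exists>K\<in>elems M. F facet_of K}"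

text \<open>Facets are closed sets, so a facet lying on \<open>\<Gamma>\<^sub>D\<close> may have points of its relative boundary
  outside \<open>\<Gamma>\<^sub>D\<close>; likewise for \<open>\<Gamma>\<^sub>N\<close> and for interior facets that touch the boundary.\<close>

definition facets_I :: "'n::finite dg_mesh \<Rightarrow> (real^'n) set set" where
  "facets_I M = {F \<in> facets M. rel_interior F \<subseteq> dom M}"

definition facets_D :: "'n::finite dg_mesh \<Rightarrow> (real^'n) set set" where
  "facets_D M = {F \<in> facets M. rel_interior F \<subseteq> gam_D M}"

definition facets_N :: "'n::finite dg_mesh \<Rightarrow> (real^'n) set set" where
  "facets_N M = {F \<in> facets M. rel_interior F \<subseteq> gam_N M}"

definition facets_of :: "(real^'n) set \<Rightarrow> (real^'n) set set" where
  "facets_of K = {F. F facet_of K}"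

definition outward_unit_normal :: "(real^'n) set \<Rightarrow> (real^'n) set \<Rightarrow> real^'n \<Rightarrow> bool" where
  "outward_unit_normal K F n \<longleftrightarrow> norm n = 1 \<and> (\<forall>x\<in>F. \<forall>y\<in>K. n \<bullet> (y - x) \<le> 0)"

text \<open>The \<open>(d-1)\<close>-dimensional Lebesgue measure on a compact set \<open>F\<close> contained in a hyperplane with
  unit normal \<open>n\<close>: by Fubini, the area of a subset \<open>B\<close> of \<open>F\<close> is the volume of the prism of height
  one over \<open>B\<close>. The closest-point map is the orthogonal projection back onto the hyperplane.\<close>

definition facet_measure :: "real^'n \<Rightarrow> (real^'n) set \<Rightarrow> (real^'n) measure" where
  "facet_measure n F = completion
     (distr (lebesgue_on {y + t *\<^sub>R n | y t. y \<in> F \<and> 0 \<le> t \<and> t \<le> 1}) borel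
            (closest_point (affine hull F)))"

definition facet_integral :: "'n::finite dg_mesh \<Rightarrow> (real^'n) set \<Rightarrow> (real^'n \<Rightarrow> real) \<Rightarrow> real" where
  "facet_integral M F q = (LINT x|facet_measure (normal M F) F. q x)"

definition boundary_measure :: "'n::finite dg_mesh \<Rightarrow> (real^'n) set \<Rightarrow> ennreal" where
  "boundary_measure M S =
     (\<Sum>F\<in>facets M - facets_I M. emeasure (facet_measure (normal M F) F) (S \<inter> F))"

definition wf_mesh :: "'n::finite dg_mesh \<Rightarrow> bool" where
  "wf_mesh M \<longleftrightarrow>
     polyhedral_domain (dom M) \<and>
     frontier (dom M) = closure (gam_D M) \<union> closure (gam_N M) \<and>
     gam_D M \<inter> gam_N M = {} \<and>
     boundary_measure M (gam_D M) \<noteq> 0 \<and>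
     triangulation (elems M) \<and>
     (\<forall>K\<in>elems M. int CARD('n) simplex K) \<and>
     \<Union>(elems M) = closure (dom M) \<and>
     facets M = facets_I M \<union> facets_D M \<union> facets_N M \<and>
     (\<forall>F\<in>facets_I M. Kminus M F \<noteq> Kplus M F \<and>
        {K \<in> elems M. F facet_of K} = {Kminus M F, Kplus M F}) \<and>
     (\<forall>F\<in>facets M - facets_I M. {K \<in> elems M. F facet_of K} = {Kminus M F}) \<and>
     (\<forall>F\<in>facets M. outward_unit_normal (Kminus M F) F (normal M F))"

section \<open>Data\<close>

definition spd :: "real^'n^'n \<Rightarrow> bool" where
  "spd B \<longleftrightarrow> transpose B = B \<and> (\<forall>x. x \<noteq> 0 \<longrightarrow> 0 < x \<bullet> (B *v x))"

definition coefficient :: "'n::finite dg_mesh \<Rightarrow> (real^'n \<Rightarrow> real^'n^'n) \<Rightarrow> bool" where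
  "coefficient M A \<longleftrightarrow> (\<forall>K\<in>elems M. \<exists>B. spd B \<and> (AE x in lebesgue_on K. A x = B))"

definition elem_const :: "(real^'n \<Rightarrow> real^'n^'n) \<Rightarrow> (real^'n) set \<Rightarrow> real^'n^'n" where
  "elem_const A K = (THE B. AE x in lebesgue_on K. A x = B)"

definition max_eigenvalue :: "real^'n^'n \<Rightarrow> real" where
  "max_eigenvalue B = Max {\<mu>. \<exists>x. x \<noteq> 0 \<and> B *v x = \<mu> *\<^sub>R x}"

definition alpha_minus :: "'n::finite dg_mesh \<Rightarrow> (real^'n \<Rightarrow> real^'n^'n) \<Rightarrow> (real^'n) set \<Rightarrow> real" where
  "alpha_minus M A F = max_eigenvalue (elem_const A (Kminus M F))"

definition alpha_plus :: "'n::finite dg_mesh \<Rightarrow> (real^'n \<Rightarrow> real^'n^'n) \<Rightarrow> (real^'n) set \<Rightarrow> real" where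
  "alpha_plus M A F = max_eigenvalue (elem_const A (Kplus M F))"

definition alpha_min :: "'n::finite dg_mesh \<Rightarrow> (real^'n \<Rightarrow> real^'n^'n) \<Rightarrow> (real^'n) set \<Rightarrow> real" where
  "alpha_min M A F =
     (if F \<in> facets_I M then min (alpha_plus M A F) (alpha_minus M A F) else alpha_minus M A F)"

definition neumann_data ::
    "'n::finite dg_mesh \<Rightarrow> nat \<Rightarrow> (real^'n \<Rightarrow> real) \<Rightarrow> bool" where
  "neumann_data M m g \<longleftrightarrow>
     (\<forall>F\<in>facets_N M. \<exists>p\<in>Pol m. AE x in facet_measure (normal M F) F. g x = p x)"

section \<open>Jumps, averages and the discontinuous Galerkin form\<close>

definition jump :: "'n::finite dg_mesh \<Rightarrow> (real^'n \<Rightarrow> real) \<Rightarrow> (real^'n) set \<Rightarrow> real^'n \<Rightarrow> real" where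
  "jump M v F x =
     (if F \<in> facets_I M then on_elem v (Kminus M F) x - on_elem v (Kplus M F) x
      else on_elem v (Kminus M F) x)"

text \<open>The argument \<open>q\<close> is an elementwise function: \<open>q K\<close> is its restriction to the element \<open>K\<close>.\<close>

definition wavg :: "'n::finite dg_mesh \<Rightarrow> (real^'n \<Rightarrow> real^'n^'n) \<Rightarrow>
    ((real^'n) set \<Rightarrow> real^'n \<Rightarrow> real) \<Rightarrow> (real^'n) set \<Rightarrow> real^'n \<Rightarrow> real" where
  "wavg M A q F x =
     (if F \<in> facets_I M then
        alpha_minus M A F / (alpha_minus M A F + alpha_plus M A F) * q (Kplus M F) x +
        alpha_plus M A F / (alpha_minus M A F + alpha_plus M A F) * q (Kminus M F) x
      else q (Kminus M F) x)"

definition flux_avg :: "'n::finite dg_mesh \<Rightarrow> (real^'n \<Rightarrow> real^'n^'n) \<Rightarrow>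
    (real^'n \<Rightarrow> real) \<Rightarrow> (real^'n) set \<Rightarrow> real^'n \<Rightarrow> real" where
  "flux_avg M A v F =
     wavg M A (\<lambda>K x. (elem_const A K *v grad (on_elem v K) x) \<bullet> normal M F) F"

definition DG :: "'n::finite dg_mesh \<Rightarrow> nat \<Rightarrow> (real^'n \<Rightarrow> real) set" where
  "DG M m = {v. L2 (dom M) v \<and>
     (\<forall>K\<in>elems M. \<exists>p\<in>Pol m. AE x in lebesgue_on K. v x = p x)}"

definition a_dg :: "'n::finite dg_mesh \<Rightarrow> (real^'n \<Rightarrow> real^'n^'n) \<Rightarrow> real \<Rightarrow> real \<Rightarrow>
    (real^'n \<Rightarrow> real) \<Rightarrow> (real^'n \<Rightarrow> real) \<Rightarrow> real" where
  "a_dg M A \<gamma> \<delta> u v =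
     (\<Sum>K\<in>elems M. LINT x|lebesgue_on K.
        (elem_const A K *v grad (on_elem u K) x) \<bullet> grad (on_elem v K) x)
   + (\<Sum>F\<in>facets M - facets_N M. facet_integral M F
        (\<lambda>x. \<gamma> * (alpha_min M A F / diameter F) * jump M u F x * jump M v F x))
   - (\<Sum>F\<in>facets M - facets_N M. facet_integral M F (\<lambda>x. flux_avg M A u F x * jump M v F x))
   + \<delta> * (\<Sum>F\<in>facets M - facets_N M. facet_integral M F (\<lambda>x. flux_avg M A v F x * jump M u F x))"

definition dg_solution :: "'n::finite dg_mesh \<Rightarrow> (real^'n \<Rightarrow> real^'n^'n) \<Rightarrow> (real^'n \<Rightarrow> real) \<Rightarrow>
    (real^'n \<Rightarrow> real) \<Rightarrow> real \<Rightarrow> real \<Rightarrow> nat \<Rightarrow> (real^'n \<Rightarrow> real) \<Rightarrow> bool" where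
  "dg_solution M A f g \<gamma> \<delta> k u \<longleftrightarrow> u \<in> DG M k \<and>
     (\<forall>v\<in>DG M k. a_dg M A \<gamma> \<delta> u v =
        (LINT x|lebesgue_on (dom M). f x * v x)
        - (\<Sum>F\<in>facets_N M. facet_integral M F (\<lambda>x. g x * on_elem v (Kminus M F) x)))"

section \<open>Raviart-Thomas spaces and fluxes\<close>

definition RT :: "'n::finite dg_mesh \<Rightarrow> nat \<Rightarrow> (real^'n \<Rightarrow> real^'n) set" where
  "RT M m = {\<tau> \<in> Hdiv (dom M).
     \<forall>K\<in>elems M. \<exists>\<rho>\<in>RT_elem m. AE x in lebesgue_on K. \<tau> x = \<rho> x}"

text \<open>The normal component of a field in \<open>RT M m\<close> is continuous across interior facets; it is
  evaluated here from \<open>Kminus\<close>.\<close>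

definition normal_trace ::
    "'n::finite dg_mesh \<Rightarrow> (real^'n \<Rightarrow> real^'n) \<Rightarrow> (real^'n) set \<Rightarrow> real^'n \<Rightarrow> real" where
  "normal_trace M \<tau> F x = on_elem \<tau> (Kminus M F) x \<bullet> normal M F"

definition L2_projection_DG ::
    "'n::finite dg_mesh \<Rightarrow> nat \<Rightarrow> (real^'n \<Rightarrow> real) \<Rightarrow> (real^'n \<Rightarrow> real) \<Rightarrow> bool" where
  "L2_projection_DG M m f fm \<longleftrightarrow> fm \<in> DG M m \<and>
     (\<forall>v\<in>DG M m. (LINT x|lebesgue_on (dom M). fm x * v x) = (LINT x|lebesgue_on (dom M). f x * v x))"

definition L2_projection_facet :: "'n::finite dg_mesh \<Rightarrow> nat \<Rightarrow> (real^'n) set \<Rightarrow>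
    (real^'n \<Rightarrow> real) \<Rightarrow> (real^'n \<Rightarrow> real) \<Rightarrow> bool" where
  "L2_projection_facet M m F g gm \<longleftrightarrow> gm \<in> Pol m \<and>
     (\<forall>\<phi>\<in>Pol m. facet_integral M F (\<lambda>x. gm x * \<phi> x) = facet_integral M F (\<lambda>x. g x * \<phi> x))"

definition RT_f :: "'n::finite dg_mesh \<Rightarrow> (real^'n \<Rightarrow> real) \<Rightarrow> (real^'n \<Rightarrow> real) \<Rightarrow> nat \<Rightarrow>
    (real^'n \<Rightarrow> real^'n) set" where
  "RT_f M f g m = {\<tau> \<in> RT M m.
     (\<exists>fm. L2_projection_DG M m f fm \<and> has_weak_div (dom M) \<tau> fm) \<and>
     (\<forall>F\<in>facets_N M. \<exists>gm. L2_projection_facet M m F g gm \<and>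
        (\<forall>x\<in>F. normal_trace M \<tau> F x = gm x))}"

definition weighted_averaging_flux :: "'n::finite dg_mesh \<Rightarrow> (real^'n \<Rightarrow> real^'n^'n) \<Rightarrow>
    (real^'n \<Rightarrow> real) \<Rightarrow> nat \<Rightarrow> (real^'n \<Rightarrow> real) \<Rightarrow> (real^'n \<Rightarrow> real^'n) \<Rightarrow> bool" where
  "weighted_averaging_flux M A g s u \<sigma> \<longleftrightarrow> \<sigma> \<in> RT M s \<and>
     (\<forall>F\<in>facets M - facets_N M. \<forall>\<phi>\<in>Pol s.
        facet_integral M F (\<lambda>x. normal_trace M \<sigma> F x * \<phi> x) =
        - facet_integral M F (\<lambda>x. flux_avg M A u F x * \<phi> x)) \<and>
     (\<forall>F\<in>facets_N M. \<forall>\<phi>\<in>Pol s.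
        facet_integral M F (\<lambda>x. normal_trace M \<sigma> F x * \<phi> x) =
        facet_integral M F (\<lambda>x. g x * \<phi> x)) \<and>
     (1 \<le> s \<longrightarrow> (\<forall>K\<in>elems M. \<forall>\<psi>\<in>PolV (s - 1).
        (LINT x|lebesgue_on K. \<sigma> x \<bullet> \<psi> x) =
        - (LINT x|lebesgue_on K. (elem_const A K *v grad (on_elem u K) x) \<bullet> \<psi> x)))"

text \<open>In the last clause, \<open>\<psi>\<close> on \<open>K\<close> extended by zero is the function
  \<open>\<lambda>y. indicator K y *\<^sub>R \<psi> y\<close>.\<close>

definition jump_flux :: "'n::finite dg_mesh \<Rightarrow> (real^'n \<Rightarrow> real^'n^'n) \<Rightarrow> real \<Rightarrow> real \<Rightarrow>
    nat \<Rightarrow> (real^'n \<Rightarrow> real) \<Rightarrow> (real^'n \<Rightarrow> real^'n) \<Rightarrow> bool" where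
  "jump_flux M A \<gamma> \<delta> s u \<sigma> \<longleftrightarrow> \<sigma> \<in> RT M s \<and>
     (\<forall>F\<in>facets M - facets_N M. \<forall>\<phi>\<in>Pol s.
        facet_integral M F (\<lambda>x. normal_trace M \<sigma> F x * \<phi> x) =
        \<gamma> * (alpha_min M A F / diameter F) * facet_integral M F (\<lambda>x. jump M u F x * \<phi> x)) \<and>
     (\<forall>F\<in>facets_N M. \<forall>\<phi>\<in>Pol s.
        facet_integral M F (\<lambda>x. normal_trace M \<sigma> F x * \<phi> x) = 0) \<and>
     (1 \<le> s \<longrightarrow> (\<forall>K\<in>elems M. \<forall>\<psi>\<in>PolV (s - 1).
        (LINT x|lebesgue_on K. \<sigma> x \<bullet> \<psi> x) =
        - \<delta> * (\<Sum>F\<in>facets_of K - facets_N M. facet_integral M F (\<lambda>x.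
            wavg M A (\<lambda>K' x. (elem_const A K' *v on_elem (\<lambda>y. indicator K y *\<^sub>R \<psi> y) K' x)
              \<bullet> normal M F) F x * jump M u F x))))"

end

(* Test the DG equation with a polynomial \<phi> on one element K, extended by zero. The jump flux is
   built so that its facet and volume moments reproduce the penalty and the symmetrisation terms,
   and the averaging flux so that it reproduces the remaining ones; hence the reconstructed flux
   \<sigma> satisfies - (\<sigma>, grad \<phi>)_K + <\<sigma> \<cdot> n, \<phi>>_{\<partial>K} = (f, \<phi>)_K, and the divergence theorem on K turns
   the left-hand side into (div \<sigma>, \<phi>)_K.

   The divergence theorem for a polytope, with the prism definition of facet integrals, is obtained
   by letting N tend to infinity in \<integral> D_e (h \<chi>_N) = 0, where \<chi>_N is the product of the ramps
   min 1 (max 0 (N (c_i - \<nu>_i \<cdot> x))) over the facets: the derivative of the i-th ramp is N times the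
   indicator of a slab of thickness 1 / N along the i-th facet.

   That \<sigma> has a single normal trace on an interior facet F is only implicit in H(div). It follows by
   testing with bump functions that concentrate on F like exp (- m (n \<cdot> x - c)^2). *)

theory Submission
  imports Defs "HOL-Computational_Algebra.Polynomial"
begin

section \<open>The divergence theorem on polytopes\<close>

text \<open>Both fluxes are prescribed through moments of the trace from \<open>Kminus\<close> only,
  whereas conservation on an element involves its own trace. The continuity of the normal trace is
  therefore no side issue: it carries the prescribed moments over to \<open>Kplus\<close>.

  The degrees fit together as follows. A test polynomial of degree s is admissible because s \<le>
  k, and its gradient has degree s - 1, as the volume moments require; for s = 0 there are no volume
  moments, but the gradient vanishes. The field has degree s + 1, yet its divergence, and its normal
  component on a flat facet, have degree s. So moments against degree s identify them as L2
  projections.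

  In the divergence theorem \<chi>_N is only Lipschitz, so \<integral> D_e (h \<chi>_N) = 0 comes
  from difference quotients and translation invariance. The slabs lie inside the polytope and
  shrink, while the prism of a facet integral has height one and lies outside. Cutting a unit slab
  beyond the facet plane into N translates of the thin one moves N times the thin integral to a
  fixed domain, where dominated convergence applies.\<close>

lemma integrable_indicator_bounded:
  fixes S :: "'a::euclidean_space set"
  assumes "bounded S" "S \<in> sets borel"
  shows "integrable lborel (\<lambda>x. C * indicator S x :: real)"
  using emeasure_bounded_finite[OF assms(1)] assms(2)
  by (intro integrable_mult_right integrable_real_indicator) auto

lemma integral_lborel_translate:
  fixes f :: "'a::euclidean_space \<Rightarrow> real"
  assumes "f \<in> borel_measurable borel"
  shows "(LINT x|lborel. f (v + x)) = (LINT x|lborel. f x)"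
proof -
  have "(LINT x|lborel. f x) = (LINT x|distr lborel borel ((+) v). f x)"
    by (simp add: lborel_distr_plus)
  also have "\<dots> = (LINT x|lborel. f (v + x))"
    by (rule integral_distr) (use assms in auto)
  finally show ?thesis by simp
qed

lemma integrable_lborel_translate:
  fixes f :: "'a::euclidean_space \<Rightarrow> real"
  assumes "integrable lborel f"
  shows "integrable lborel (\<lambda>x. f (v + x))"
proof -
  have "integrable (distr lborel borel ((+) v)) f"
    using assms by (simp add: lborel_distr_plus)
  then show ?thesis
    by (subst (asm) integrable_distr_eq) (use assms in auto)
qed

text \<open>Difference quotients have integral zero because Lebesgue measure is translation
  invariant, and a Lipschitz bound dominates them. Neither Fubini nor the fundamental theorem of
  calculus is involved, so a derivative that exists almost everywhere is enough.\<close>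

lemma integral_directional_derivative_eq_0:
  fixes G D :: "'a::euclidean_space \<Rightarrow> real"
  assumes G: "G \<in> borel_measurable borel" and D: "D \<in> borel_measurable borel"
    and supp: "\<And>x. R < norm x \<Longrightarrow> G x = 0"
    and lip: "\<And>x y. norm x \<le> R + 2 * norm e \<Longrightarrow> norm y \<le> R + 2 * norm e \<Longrightarrow>
                \<bar>G x - G y\<bar> \<le> L * norm (x - y)"
    and int: "integrable lborel G"
    and der: "AE x in lborel. ((\<lambda>t. G (x + t *\<^sub>R e)) has_real_derivative D x) (at 0)"
  shows "(LINT x|lborel. D x) = 0"
proof -
  define Q where "Q m x = (G (x + (1 / Suc m) *\<^sub>R e) - G x) / (1 / Suc m)" for m x
  \<comment> \<open>The steps 1 / (m + 1) are at most 1. Hence outside the ball of radius R + norm e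
    both points of a quotient have norm above R, and inside it both stay within R + 2 norm e, where
    the Lipschitz bound is assumed.\<close>
  define w where "w x = \<bar>L\<bar> * norm e * indicator (cball 0 (R + norm e)) x" for x :: 'a
  have small: "norm ((1 / Suc m) *\<^sub>R e) \<le> norm e" for m
    by (simp add: field_simps mult_le_cancel_left1)
  have bound: "norm (Q m x) \<le> w x" for m x
  proof (cases "norm x \<le> R + norm e")
    case True
    have y: "norm (x + (1 / Suc m) *\<^sub>R e) \<le> R + 2 * norm e"
      using norm_triangle_ineq[of x "(1 / Suc m) *\<^sub>R e"] small[of m] True by linarith
    have "norm x \<le> R + 2 * norm e"
      using True norm_ge_zero[of e] by linarith
    then have "\<bar>G (x + (1 / Suc m) *\<^sub>R e) - G x\<bar> \<le> L * norm (x + (1 / Suc m) *\<^sub>R e - x)"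
      using lip y by blast
    also have "\<dots> \<le> \<bar>L\<bar> * norm ((1 / Suc m) *\<^sub>R e)"
      by (simp add: divide_right_mono mult_right_mono)
    also have "\<dots> = (\<bar>L\<bar> * norm e) * (1 / Suc m)"
      by simp
    finally have "\<bar>Q m x\<bar> \<le> \<bar>L\<bar> * norm e"
      unfolding Q_def abs_divide by (subst pos_divide_le_eq) auto
    then show ?thesis
      using True by (simp add: w_def)
  next
    case False
    have "R < norm x"
      using False norm_ge_zero[of e] by linarith
    moreover have "R < norm (x + (1 / Suc m) *\<^sub>R e)"
      using norm_triangle_ineq4[of "x + (1 / Suc m) *\<^sub>R e" "(1 / Suc m) *\<^sub>R e"] small[of m] False
      by simp
    ultimately show ?thesis
      using False supp by (simp add: Q_def w_def)
  qed
  have "(\<lambda>m. LINT x|lborel. Q m x) \<longlonglongrightarrow> (LINT x|lborel. D x)"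
  proof (rule integral_dominated_convergence)
    show "integrable lborel w"
      unfolding w_def by (rule integrable_indicator_bounded) auto
    show "AE x in lborel. (\<lambda>m. Q m x) \<longlonglongrightarrow> D x"
      using der
    proof (rule AE_mp, intro AE_I2 impI)
      fix x assume "((\<lambda>t. G (x + t *\<^sub>R e)) has_real_derivative D x) (at 0)"
      then have "((\<lambda>t. (G (x + t *\<^sub>R e) - G x) / t) \<longlongrightarrow> D x) (at 0)"
        by (simp add: DERIV_def)
      moreover have "filterlim (\<lambda>m. 1 / real (Suc m)) (at 0) sequentially"
        unfolding filterlim_at using lim_inverse_n'[THEN LIMSEQ_Suc] by auto
      ultimately show "(\<lambda>m. Q m x) \<longlonglongrightarrow> D x"
        unfolding Q_def by (rule filterlim_compose)
    qed
    show "Q m \<in> borel_measurable lborel" for m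
      unfolding Q_def using G by measurable
  qed (use D bound in auto)
  moreover have "(LINT x|lborel. Q m x) = 0" for m
  proof -
    have "integrable lborel (\<lambda>x. G ((1 / Suc m) *\<^sub>R e + x))"
      by (rule integrable_lborel_translate[OF int])
    then show ?thesis
      using integral_lborel_translate[OF G, of "(1 / Suc m) *\<^sub>R e"] int
      by (simp add: Q_def add.commute del: of_nat_Suc)
  qed
  ultimately show ?thesis
    by (simp add: LIMSEQ_const_iff)
qed

text \<open>A slab of thickness one consists of \<open>N\<close> translates of a slab of thickness \<open>1 / N\<close>.\<close>

lemma integral_thin_slab:
  fixes H :: "'a::euclidean_space \<Rightarrow> real" and n :: 'a
  assumes "norm n = 1" and "0 < N" and "H \<in> borel_measurable borel"
    and int: "integrable lborel (\<lambda>x. of_bool (- 1 / real N \<le> n \<bullet> x - c \<and> n \<bullet> x - c < 0) * H x)"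
  shows "real N * (LINT x|lborel. of_bool (- 1 / real N \<le> n \<bullet> x - c \<and> n \<bullet> x - c < 0) * H x) =
    (LINT z|lborel. of_bool (0 \<le> n \<bullet> z - c \<and> n \<bullet> z - c < 1) *
        H (z - ((of_int \<lfloor>real N * (n \<bullet> z - c)\<rfloor> + 1) / real N) *\<^sub>R n))"
proof -
  define G where "G x = of_bool (- 1 / real N \<le> n \<bullet> x - c \<and> n \<bullet> x - c < 0) * H x" for x
  define v where "v k = - ((real k + 1) / real N) *\<^sub>R n" for k
  have [measurable]: "H \<in> borel_measurable borel" by fact
  have G: "G \<in> borel_measurable borel"
    unfolding G_def by measurable
  have nn: "n \<bullet> n = 1"
    using assms by (simp add: norm_eq_1)
  have "(\<Sum>k<N. G (v k + z)) = of_bool (0 \<le> n \<bullet> z - c \<and> n \<bullet> z - c < 1) *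
        H (z - ((of_int \<lfloor>real N * (n \<bullet> z - c)\<rfloor> + 1) / real N) *\<^sub>R n)" for z
  proof -
    define \<tau> where "\<tau> = n \<bullet> z - c"
    \<comment> \<open>Shifting by (k + 1) / N carries [k / N, (k + 1) / N) onto [- 1 / N, 0). The
      half-open intervals tile, so for each z the only index that can contribute is the floor of N
      \<tau>.\<close>
    have Gv: "G (v k + z) = of_bool (\<lfloor>real N * \<tau>\<rfloor> = int k) * H (z - ((real k + 1) / real N) *\<^sub>R n)" for k
    proof -
      have 1: "n \<bullet> (v k + z) - c = \<tau> - (real k + 1) / real N"
        by (simp add: v_def \<tau>_def inner_simps nn)
      have "(- 1 / real N \<le> \<tau> - (real k + 1) / real N \<and> \<tau> - (real k + 1) / real N < 0)
          \<longleftrightarrow> real k \<le> real N * \<tau> \<and> real N * \<tau> < real k + 1"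
        using \<open>0 < N\<close> by (auto simp: field_simps)
      also have "\<dots> \<longleftrightarrow> \<lfloor>real N * \<tau>\<rfloor> = int k"
        by (simp add: floor_eq_iff)
      finally show ?thesis
        unfolding G_def 1 by (simp add: v_def)
    qed
    show ?thesis
    proof (cases "0 \<le> \<tau> \<and> \<tau> < 1")
      case True
      define k where "k = nat \<lfloor>real N * \<tau>\<rfloor>"
      have k: "\<lfloor>real N * \<tau>\<rfloor> = int k"
        using True by (simp add: k_def)
      have "real N * \<tau> < real N"
        using True \<open>0 < N\<close> by simp
      then have "k < N"
        using True unfolding k_def by (simp add: nat_less_iff floor_less_iff)
      have "(\<Sum>k<N. G (v k + z)) = (\<Sum>j<N. if j = k then H (z - ((real k + 1) / real N) *\<^sub>R n) else 0)"
        by (rule sum.cong) (auto simp: Gv k)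
      then show ?thesis
        using True \<open>k < N\<close> k by (simp flip: \<tau>_def)
    next
      case False
      have "\<lfloor>real N * \<tau>\<rfloor> \<noteq> int k" if "k < N" for k
      proof
        assume "\<lfloor>real N * \<tau>\<rfloor> = int k"
        then have "real k \<le> real N * \<tau>" "real N * \<tau> < real k + 1"
          by (auto simp: floor_eq_iff)
        then have "0 \<le> real N * \<tau>" "real N * \<tau> < real N"
          using that by linarith+
        then show False
          using False \<open>0 < N\<close> by (simp add: zero_le_mult_iff)
      qed
      then show ?thesis
        using False by (auto simp: Gv simp flip: \<tau>_def intro!: sum.neutral)
    qed
  qed
  moreover have "(LINT z|lborel. (\<Sum>k<N. G (v k + z))) = real N * (LINT x|lborel. G x)"
    using int[folded G_def] by (subst Bochner_Integration.integral_sum)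
      (simp_all add: integral_lborel_translate[OF G] integrable_lborel_translate)
  ultimately show ?thesis
    by (simp add: G_def)
qed

section \<open>Lipschitz bounds and the ramp function\<close>

definition lip_bounded_on :: "'a::real_normed_vector set \<Rightarrow> ('a \<Rightarrow> real) \<Rightarrow> bool" where
  "lip_bounded_on S f \<longleftrightarrow>
     (\<exists>L. \<forall>x\<in>S. \<bar>f x\<bar> \<le> L \<and> (\<forall>y\<in>S. \<bar>f x - f y\<bar> \<le> L * norm (x - y)))"

text \<open>The bound on the values that \<open>lip_bounded_on\<close> includes is what makes the
  class closed under products; a Lipschitz condition alone would not be.\<close>

lemma lip_bounded_on_mult:
  assumes "lip_bounded_on S f" "lip_bounded_on S g"
  shows "lip_bounded_on S (\<lambda>x. f x * g x)"
proof -
  from assms(1) obtain L where "\<forall>x\<in>S. \<bar>f x\<bar> \<le> L \<and> (\<forall>y\<in>S. \<bar>f x - f y\<bar> \<le> L * norm (x - y))"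
    unfolding lip_bounded_on_def by blast
  then have L: "\<bar>f x\<bar> \<le> L" "y \<in> S \<Longrightarrow> \<bar>f x - f y\<bar> \<le> L * norm (x - y)" if "x \<in> S" for x y
    using that by blast+
  from assms(2) obtain M where "\<forall>x\<in>S. \<bar>g x\<bar> \<le> M \<and> (\<forall>y\<in>S. \<bar>g x - g y\<bar> \<le> M * norm (x - y))"
    unfolding lip_bounded_on_def by blast
  then have M: "\<bar>g x\<bar> \<le> M" "y \<in> S \<Longrightarrow> \<bar>g x - g y\<bar> \<le> M * norm (x - y)" if "x \<in> S" for x y
    using that by blast+
  show ?thesis
    unfolding lip_bounded_on_def
  proof (intro exI ballI conjI)
    fix x assume x: "x \<in> S"
    have "0 \<le> L" "0 \<le> M" using L(1)[OF x] M(1)[OF x] by linarith+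
    have "\<bar>f x * g x\<bar> \<le> L * M"
      using L(1)[OF x] M(1)[OF x] by (simp add: abs_mult mult_mono)
    then show "\<bar>f x * g x\<bar> \<le> 2 * L * M" using mult_nonneg_nonneg[OF \<open>0 \<le> L\<close> \<open>0 \<le> M\<close>] by linarith
    fix y assume y: "y \<in> S"
    have "f x * g x - f y * g y = f x * (g x - g y) + (f x - f y) * g y"
      by (simp add: algebra_simps)
    also have "\<bar>\<dots>\<bar> \<le> \<bar>f x\<bar> * \<bar>g x - g y\<bar> + \<bar>f x - f y\<bar> * \<bar>g y\<bar>"
      by (metis abs_mult abs_triangle_ineq)
    also have "\<dots> \<le> L * (M * norm (x - y)) + (L * norm (x - y)) * M"
      using L M x y \<open>0 \<le> L\<close> \<open>0 \<le> M\<close> by (intro add_mono mult_mono) auto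
    finally show "\<bar>f x * g x - f y * g y\<bar> \<le> 2 * L * M * norm (x - y)"
      by (simp add: algebra_simps)
  qed
qed

lemma lip_bounded_on_prod:
  "finite I \<Longrightarrow> (\<And>i. i \<in> I \<Longrightarrow> lip_bounded_on S (f i)) \<Longrightarrow> lip_bounded_on S (\<lambda>x. \<Prod>i\<in>I. f i x)"
proof (induction rule: finite_induct)
  case empty
  show ?case by (auto simp: lip_bounded_on_def intro!: exI[of _ 1])
qed (auto intro!: lip_bounded_on_mult)

text \<open>The gradient is bounded on the compact ball, and convexity of the ball lets the mean
  value inequality turn this bound into a Lipschitz constant.\<close>

lemma lip_bounded_on_C1:
  fixes h :: "'a::euclidean_space \<Rightarrow> real"
  assumes der: "\<And>x. (h has_derivative (\<lambda>v. g x \<bullet> v)) (at x)" and "continuous_on UNIV g"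
  shows "lip_bounded_on (cball 0 B) h"
proof -
  have "continuous_on (cball 0 B) h"
    using der by (meson continuous_at_imp_continuous_on has_derivative_continuous)
  then have "bounded (h ` cball 0 B)"
    by (intro compact_imp_bounded compact_continuous_image) auto
  then obtain C2 where C2: "\<forall>x\<in>cball 0 B. norm (h x) \<le> C2"
    unfolding bounded_iff by (metis imageI)
  have "bounded (g ` cball 0 B)"
    using continuous_on_subset[OF assms(2)]
    by (intro compact_imp_bounded compact_continuous_image) auto
  then obtain C1 where C1: "\<forall>x\<in>cball 0 B. norm (g x) \<le> C1"
    unfolding bounded_iff by (metis imageI)
  have "norm (h x - h y) \<le> C1 * norm (x - y)" if "x \<in> cball 0 B" "y \<in> cball 0 B" for x y
  proof (rule differentiable_bound[where S = "cball 0 B" and f' = "\<lambda>x v. g x \<bullet> v"])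
    fix x :: 'a assume x: "x \<in> cball 0 B"
    show "onorm (\<lambda>v. g x \<bullet> v) \<le> C1"
    proof (rule onorm_le)
      fix v :: 'a
      have "norm (g x) * norm v \<le> C1 * norm v"
        by (rule mult_right_mono) (use C1 x in auto)
      then show "norm (g x \<bullet> v) \<le> C1 * norm v"
        using Cauchy_Schwarz_ineq2[of "g x" v] by simp
    qed
    show "(h has_derivative (\<lambda>v. g x \<bullet> v)) (at x within cball 0 B)"
      using der by (rule has_derivative_at_withinI)
  qed (use that in auto)
  moreover have "C1 * norm (x - y) \<le> max C1 C2 * norm (x - y)" for x y :: 'a
    by (rule mult_right_mono) auto
  ultimately show ?thesis
    unfolding lip_bounded_on_def real_norm_def
  proof (intro exI[of _ "max C1 C2"] ballI conjI)
    show "\<bar>h x\<bar> \<le> max C1 C2" if "x \<in> cball 0 B" for x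
      using C2 that by (force simp: le_max_iff_disj)
  qed (metis order.trans real_norm_def)
qed

definition ramp :: "real \<Rightarrow> real" where
  "ramp t = max 0 (min 1 t)"

lemma ramp_bounds [simp]: "0 \<le> ramp t" "ramp t \<le> 1"
  by (auto simp: ramp_def)

lemma lip_bounded_on_ramp: "lip_bounded_on S (\<lambda>x. ramp (l * (b - n \<bullet> x)))"
  unfolding lip_bounded_on_def
proof (intro exI ballI conjI)
  fix x y :: 'a
  show "\<bar>ramp (l * (b - n \<bullet> x))\<bar> \<le> 1 + \<bar>l\<bar> * norm n"
  proof -
    have "0 \<le> \<bar>l\<bar> * norm n" by simp
    then show ?thesis
      using ramp_bounds[of "l * (b - n \<bullet> x)"] by linarith
  qed
  have "\<bar>ramp (l * (b - n \<bullet> x)) - ramp (l * (b - n \<bullet> y))\<bar> \<le> \<bar>l * (b - n \<bullet> x) - l * (b - n \<bullet> y)\<bar>"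
    by (auto simp: ramp_def max_def min_def)
  also have "\<dots> = \<bar>l\<bar> * \<bar>n \<bullet> (x - y)\<bar>"
    unfolding abs_mult[symmetric] by (subst abs_minus_cancel[symmetric]) (simp add: algebra_simps)
  also have "\<dots> \<le> \<bar>l\<bar> * (norm n * norm (x - y))"
    by (intro mult_left_mono Cauchy_Schwarz_ineq2) auto
  also have "\<dots> \<le> (1 + \<bar>l\<bar> * norm n) * norm (x - y)"
    by (simp add: algebra_simps)
  finally show "\<bar>ramp (l * (b - n \<bullet> x)) - ramp (l * (b - n \<bullet> y))\<bar> \<le> (1 + \<bar>l\<bar> * norm n) * norm (x - y)" .
qed

text \<open>The half-open form of the indicator is chosen for what follows: at t = N (c - \<nu>
  \<bullet> x) it becomes \<open>in_slab\<close>, whose translates tile a unit slab without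
  overlap.\<close>

lemma has_real_derivative_ramp:
  assumes "t \<noteq> 0" "t \<noteq> 1"
  shows "(ramp has_real_derivative of_bool (0 < t \<and> t \<le> 1)) (at t)"
proof -
  consider "t < 0" | "0 < t \<and> t < 1" | "1 < t" using assms by linarith
  then show ?thesis
  proof cases
    case 1
    have "((\<lambda>_. 0) has_real_derivative 0) (at t)" by simp
    then have "(ramp has_real_derivative 0) (at t)"
      by (rule has_field_derivative_transform_within_open[where S = "{..<0}"]) (use 1 in \<open>auto simp: ramp_def\<close>)
    then show ?thesis using 1 by simp
  next
    case 2
    have "((\<lambda>t. t) has_real_derivative 1) (at t)" by simp
    then have "(ramp has_real_derivative 1) (at t)"
      by (rule has_field_derivative_transform_within_open[where S = "{0<..<1}"]) (use 2 in \<open>auto simp: ramp_def\<close>)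
    then show ?thesis using 2 by simp
  next
    case 3
    have "((\<lambda>_. 1) has_real_derivative 0) (at t)" by simp
    then have "(ramp has_real_derivative 0) (at t)"
      by (rule has_field_derivative_transform_within_open[where S = "{1<..}"]) (use 3 in \<open>auto simp: ramp_def\<close>)
    then show ?thesis using 3 by simp
  qed
qed

text \<open>The case n = 0 with b \<noteq> 0, an empty hyperplane, is included because it arises
  from two distinct parallel facet planes.\<close>

lemma AE_lborel_not_hyperplane:
  fixes n :: "'a::euclidean_space"
  assumes "n \<noteq> 0 \<or> b \<noteq> 0"
  shows "AE x in lborel. n \<bullet> x \<noteq> b"
proof -
  have "{x. n \<bullet> x = b} \<in> null_sets lborel"
    using negligible_hyperplane[OF assms] closed_hyperplane[of n b]
    by (simp add: negligible_iff_null_sets null_sets_completion_iff borel_closed)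
  then show ?thesis
    by (rule AE_I') auto
qed

section \<open>Cut-offs of a polytope given by halfspaces, and their limits\<close>

locale polytope_halfspaces =
  fixes I :: "'i set" and \<nu> :: "'i \<Rightarrow> 'a::euclidean_space" and c :: "'i \<Rightarrow> real" and K :: "'a set"
  assumes finite_I: "finite I"
    and norm_nu: "i \<in> I \<Longrightarrow> norm (\<nu> i) = 1"
    and distinct_halfspaces: "i \<in> I \<Longrightarrow> j \<in> I \<Longrightarrow> \<nu> i = \<nu> j \<Longrightarrow> c i = c j \<Longrightarrow> i = j"
    and K_eq: "K = {x. \<forall>i\<in>I. \<nu> i \<bullet> x \<le> c i}"
    and bounded_K: "bounded K"
    and interior_point: "\<exists>x. \<forall>i\<in>I. \<nu> i \<bullet> x < c i"
begin

definition proj :: "'i \<Rightarrow> 'a \<Rightarrow> 'a" where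
  "proj i z = z - (\<nu> i \<bullet> z - c i) *\<^sub>R \<nu> i"

abbreviation in_slab :: "nat \<Rightarrow> 'i \<Rightarrow> 'a \<Rightarrow> real" where
  "in_slab N i x \<equiv> of_bool (- 1 / real N \<le> \<nu> i \<bullet> x - c i \<and> \<nu> i \<bullet> x - c i < 0)"

text \<open>The height interval is half-open because this is what the tiling by thin slabs yields.
  The closed prism behind \<open>facet_measure\<close> differs from it by a null set.\<close>

abbreviation in_prism :: "'i \<Rightarrow> 'a \<Rightarrow> real" where
  "in_prism i z \<equiv> of_bool (0 \<le> \<nu> i \<bullet> z - c i \<and> \<nu> i \<bullet> z - c i < 1 \<and> proj i z \<in> K)"

text \<open>This is \<chi>_N for J = I. Smaller index sets occur because the product rule leaves out
  the differentiated factor.\<close>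

definition cut :: "nat \<Rightarrow> 'i set \<Rightarrow> 'a \<Rightarrow> real" where
  "cut N J x = (\<Prod>i\<in>J. ramp (real N * (c i - \<nu> i \<bullet> x)))"

lemma nu_nu: "i \<in> I \<Longrightarrow> \<nu> i \<bullet> \<nu> i = 1"
  using norm_nu by (simp flip: norm_eq_1)

lemma closed_K: "closed K"
proof -
  have "K = (\<Inter>i\<in>I. {x. \<nu> i \<bullet> x \<le> c i})"
    by (auto simp: K_eq)
  then show ?thesis
    using closed_halfspace_le by (auto intro!: closed_INT)
qed

lemma sets_K [measurable]: "K \<in> sets borel"
  using closed_K by simp

lemma bounded_on_K:
  fixes f :: "'a \<Rightarrow> real"
  assumes "continuous_on UNIV f"
  obtains C where "\<And>x. x \<in> K \<Longrightarrow> \<bar>f x\<bar> \<le> C"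
proof -
  have "compact K" using closed_K bounded_K by (simp add: compact_eq_bounded_closed)
  then have "bounded (f ` K)"
    using continuous_on_subset[OF assms] by (intro compact_imp_bounded compact_continuous_image) auto
  then show thesis using that unfolding bounded_iff by auto
qed

lemma cut_bounds: "0 \<le> cut N J x" "cut N J x \<le> 1"
  unfolding cut_def by (auto intro: prod_nonneg prod_le_1)

lemma cut_measurable [measurable]: "cut N J \<in> borel_measurable borel"
  unfolding cut_def ramp_def by measurable

lemma cut_nonzero:
  assumes "cut N J x \<noteq> 0" "finite J" "j \<in> J"
  shows "\<nu> j \<bullet> x < c j"
proof -
  have "0 < real N * (c j - \<nu> j \<bullet> x)"
    using assms by (auto simp: cut_def ramp_def max_def split: if_splits)
  then show ?thesis
    by (simp add: zero_less_mult_iff)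
qed

text \<open>Off the plane of constraint j the argument of its ramp either tends to infinity or is
  eventually negative, so the ramp is eventually constant. The evaluation point may move with N
  because the slab argument evaluates at points that drift towards the facet.\<close>

lemma cut_tendsto:
  fixes X :: "nat \<Rightarrow> 'a"
  assumes X: "X \<longlonglongrightarrow> x" and "finite J" "\<And>j. j \<in> J \<Longrightarrow> \<nu> j \<bullet> x \<noteq> c j"
  shows "(\<lambda>N. cut N J (X N)) \<longlonglongrightarrow> of_bool (\<forall>j\<in>J. \<nu> j \<bullet> x \<le> c j)"
proof -
  have "(\<lambda>N. ramp (real N * (c j - \<nu> j \<bullet> X N))) \<longlonglongrightarrow> of_bool (\<nu> j \<bullet> x \<le> c j)" if "j \<in> J" for j
  proof -
    have lim: "(\<lambda>N. c j - \<nu> j \<bullet> X N) \<longlonglongrightarrow> c j - \<nu> j \<bullet> x"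
      by (intro tendsto_intros X)
    consider "\<nu> j \<bullet> x < c j" | "c j < \<nu> j \<bullet> x" using assms(3)[OF \<open>j \<in> J\<close>] by linarith
    then show ?thesis
    proof cases
      case 1
      have "filterlim (\<lambda>N. (c j - \<nu> j \<bullet> X N) * real N) at_top sequentially"
        by (rule filterlim_tendsto_pos_mult_at_top[OF lim])
          (use 1 in \<open>auto intro: filterlim_real_sequentially\<close>)
      then have "\<forall>\<^sub>F N in sequentially. 1 \<le> (c j - \<nu> j \<bullet> X N) * real N"
        by (simp add: filterlim_at_top)
      then have "\<forall>\<^sub>F N in sequentially. ramp (real N * (c j - \<nu> j \<bullet> X N)) = 1"
        by eventually_elim (simp add: ramp_def mult.commute)
      then show ?thesis
        using 1 by (simp add: tendsto_eventually)
    next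
      case 2
      then have "\<forall>\<^sub>F N in sequentially. c j - \<nu> j \<bullet> X N < 0"
        using order_tendstoD(2)[OF lim, of 0] by simp
      then have "\<forall>\<^sub>F N in sequentially. ramp (real N * (c j - \<nu> j \<bullet> X N)) = 0"
      proof eventually_elim
        case (elim N)
        then have "real N * (c j - \<nu> j \<bullet> X N) \<le> 0"
          by (simp add: mult_nonneg_nonpos)
        then show ?case by (simp add: ramp_def)
      qed
      then show ?thesis
        using 2 by (simp add: tendsto_eventually)
    qed
  qed
  then have "(\<lambda>N. cut N J (X N)) \<longlonglongrightarrow> (\<Prod>j\<in>J. of_bool (\<nu> j \<bullet> x \<le> c j))"
    unfolding cut_def by (intro tendsto_prod)
  also have "(\<Prod>j\<in>J. of_bool (\<nu> j \<bullet> x \<le> c j)) = (of_bool (\<forall>j\<in>J. \<nu> j \<bullet> x \<le> c j) :: real)"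
    using \<open>finite J\<close> by (induction rule: finite_induct) auto
  finally show ?thesis .
qed

lemma AE_not_facet_planes: "AE x in lborel. \<forall>i\<in>I. \<nu> i \<bullet> x \<noteq> b i"
proof (rule AE_finite_allI[OF finite_I])
  fix i assume "i \<in> I"
  then have "\<nu> i \<noteq> 0" using norm_nu by fastforce
  then show "AE x in lborel. \<nu> i \<bullet> x \<noteq> b i"
    by (intro AE_lborel_not_hyperplane) simp
qed

lemma integral_cut_tendsto:
  assumes f: "continuous_on UNIV f"
  shows "(\<lambda>N. LINT x|lborel. cut N I x * f x) \<longlonglongrightarrow> (LINT x|lborel. indicator K x * f x)"
proof -
  obtain C where C: "\<And>x. x \<in> K \<Longrightarrow> \<bar>f x\<bar> \<le> C"
    by (rule bounded_on_K[OF f]) (rule that)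
  have [measurable]: "f \<in> borel_measurable borel"
    using f by (rule borel_measurable_continuous_onI)
  show ?thesis
  proof (rule integral_dominated_convergence[where w = "\<lambda>x. C * indicator K x"])
    show "integrable lborel (\<lambda>x. C * indicator K x)"
      by (rule integrable_indicator_bounded[OF bounded_K sets_K])
    show "AE x in lborel. (\<lambda>N. cut N I x * f x) \<longlonglongrightarrow> indicator K x * f x"
      using AE_not_facet_planes[of c]
    proof eventually_elim
      case (elim x)
      then have "(\<lambda>N. cut N I x) \<longlonglongrightarrow> of_bool (\<forall>j\<in>I. \<nu> j \<bullet> x \<le> c j)"
        by (intro cut_tendsto finite_I) auto
      moreover have "of_bool (\<forall>j\<in>I. \<nu> j \<bullet> x \<le> c j) = (indicator K x :: real)"
        by (simp add: K_eq indicator_def)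
      ultimately show ?case
        by (intro tendsto_mult) auto
    qed
    show "AE x in lborel. norm (cut N I x * f x) \<le> C * indicator K x" for N
    proof (rule AE_I2)
      fix x
      show "norm (cut N I x * f x) \<le> C * indicator K x"
      proof (cases "cut N I x = 0")
        case True
        have "0 \<le> C * indicator K x"
          using C[of x] by (auto simp: indicator_def)
        then show ?thesis using True by simp
      next
        case False
        then have "x \<in> K"
          using cut_nonzero[OF False finite_I] by (auto simp: K_eq less_imp_le)
        then show ?thesis
          using mult_mono[OF cut_bounds(2)[of N I x] C[of x]] cut_bounds(1)[of N I x] by (simp add: abs_mult)
      qed
    qed
  qed measurable
qed

text \<open>After the passage to a unit slab the integrand is evaluated at \<open>T N z\<close>,
  which is z moved along the normal to a depth of at most 1 / N below the facet plane. As
  \<open>T N z\<close> tends to \<open>proj i z\<close>, the remaining ramps become the condition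
  that the projection lies in K.\<close>

lemma integral_cut_slab_tendsto:
  assumes f: "continuous_on UNIV f" and i: "i \<in> I"
  shows "(\<lambda>N. real N * (LINT x|lborel. in_slab N i x *
            (cut N (I - {i}) x * f x)))
     \<longlonglongrightarrow> (LINT z|lborel. in_prism i z * f (proj i z))"
proof -
  obtain C where C: "\<And>x. x \<in> K \<Longrightarrow> \<bar>f x\<bar> \<le> C"
    by (rule bounded_on_K[OF f]) (rule that)
  obtain R where R: "\<And>x. x \<in> K \<Longrightarrow> norm x \<le> R"
    using bounded_K unfolding bounded_iff by auto
  have [measurable]: "f \<in> borel_measurable borel"
    using f by (rule borel_measurable_continuous_onI)
  define T where "T N z = z - ((of_int \<lfloor>real N * (\<nu> i \<bullet> z - c i)\<rfloor> + 1) / real N) *\<^sub>R \<nu> i" for N z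
  have [measurable]: "T N \<in> borel_measurable borel" for N
    unfolding T_def by measurable
  have inK: "x \<in> K" if "cut N (I - {i}) x \<noteq> 0" "\<nu> i \<bullet> x \<le> c i" for x N
    using cut_nonzero[OF that(1)] finite_I that(2) by (force simp: K_eq)
  have bnd: "\<bar>cut N (I - {i}) x * f x\<bar> \<le> \<bar>C\<bar>" if "\<nu> i \<bullet> x \<le> c i" for N x
  proof (cases "cut N (I - {i}) x = 0")
    case False
    then have "\<bar>f x\<bar> \<le> \<bar>C\<bar>" using C inK that by force
    then have "\<bar>cut N (I - {i}) x\<bar> * \<bar>f x\<bar> \<le> 1 * \<bar>C\<bar>"
      using cut_bounds[of N "I - {i}" x] by (intro mult_mono) auto
    then show ?thesis by (simp add: abs_mult)
  qed simp
  have T: "\<bar>(of_int \<lfloor>real N * \<tau>\<rfloor> + 1) / real N - \<tau>\<bar> \<le> 1 / real N"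
    "\<tau> \<le> (of_int \<lfloor>real N * \<tau>\<rfloor> + 1) / real N" if "0 < N" for N \<tau>
  proof -
    have "real N * \<tau> < of_int \<lfloor>real N * \<tau>\<rfloor> + 1" "of_int \<lfloor>real N * \<tau>\<rfloor> \<le> real N * \<tau>"
      by linarith+
    then show "\<bar>(of_int \<lfloor>real N * \<tau>\<rfloor> + 1) / real N - \<tau>\<bar> \<le> 1 / real N"
      "\<tau> \<le> (of_int \<lfloor>real N * \<tau>\<rfloor> + 1) / real N"
      using that by (auto simp: field_simps abs_if)
  qed
  define \<Phi> where "\<Phi> N z = of_bool (0 \<le> \<nu> i \<bullet> z - c i \<and> \<nu> i \<bullet> z - c i < 1) *
        (cut N (I - {i}) (T N z) * f (T N z))" for N z
  have "real N * (LINT x|lborel. in_slab N i x *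
            (cut N (I - {i}) x * f x)) = (LINT z|lborel. \<Phi> N z)" if "N > 0" for N
    unfolding \<Phi>_def T_def
  proof (rule integral_thin_slab[OF norm_nu[OF i] that, where H = "\<lambda>x. cut N (I - {i}) x * f x"])
    show "integrable lborel (\<lambda>x. in_slab N i x *
            (cut N (I - {i}) x * f x))"
    proof (rule Bochner_Integration.integrable_bound[where f = "\<lambda>x. \<bar>C\<bar> * indicator K x"])
      show "integrable lborel (\<lambda>x. \<bar>C\<bar> * indicator K x :: real)"
        by (rule integrable_indicator_bounded[OF bounded_K sets_K])
      show "AE x in lborel. norm (in_slab N i x *
            (cut N (I - {i}) x * f x)) \<le> norm (\<bar>C\<bar> * indicator K x)"
      proof (rule AE_I2)
        fix x
        show "norm (in_slab N i x *
            (cut N (I - {i}) x * f x)) \<le> norm (\<bar>C\<bar> * indicator K x)"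
        proof (cases "\<nu> i \<bullet> x \<le> c i \<and> cut N (I - {i}) x \<noteq> 0")
          case True
          then have "x \<in> K" using inK by blast
          then show ?thesis using bnd[of x N] True by simp
        qed auto
      qed
    qed measurable
  qed measurable
  then have eq: "\<forall>\<^sub>F N in sequentially. (LINT z|lborel. \<Phi> N z) =
     real N * (LINT x|lborel. in_slab N i x *
            (cut N (I - {i}) x * f x))"
    by (intro eventually_sequentiallyI[of 1]) auto
  have Tle: "\<nu> i \<bullet> T N z \<le> c i" if "0 < N" for N z
    using T(2)[OF that, of "\<nu> i \<bullet> z - c i"] nu_nu[OF i] by (simp add: T_def inner_simps)
  have dist_T: "norm (z - T N z) \<le> 2" if "0 < N" "0 \<le> \<nu> i \<bullet> z - c i" "\<nu> i \<bullet> z - c i < 1" for N z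
  proof -
    have "1 / real N \<le> 1" using that(1) by simp
    then have "\<bar>(of_int \<lfloor>real N * (\<nu> i \<bullet> z - c i)\<rfloor> + 1) / real N\<bar> \<le> 2"
      using T(1)[OF that(1), of "\<nu> i \<bullet> z - c i"] that(2,3) by linarith
    then show ?thesis
      by (simp add: T_def norm_nu[OF i])
  qed
  have T_lim: "(\<lambda>N. T N z) \<longlonglongrightarrow> proj i z" for z
  proof -
    have "(\<lambda>N. (of_int \<lfloor>real N * (\<nu> i \<bullet> z - c i)\<rfloor> + 1) / real N - (\<nu> i \<bullet> z - c i)) \<longlonglongrightarrow> 0"
    proof (rule Lim_null_comparison)
      show "\<forall>\<^sub>F N in sequentially. norm ((of_int \<lfloor>real N * (\<nu> i \<bullet> z - c i)\<rfloor> + 1) / real N - (\<nu> i \<bullet> z - c i)) \<le> 1 / real N"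
        using T(1) by (intro eventually_sequentiallyI[of 1]) auto
    qed (rule lim_1_over_n)
    then have "(\<lambda>N. (of_int \<lfloor>real N * (\<nu> i \<bullet> z - c i)\<rfloor> + 1) / real N) \<longlonglongrightarrow> \<nu> i \<bullet> z - c i"
      by (simp add: LIM_zero_iff)
    then show ?thesis
      unfolding T_def proj_def by (intro tendsto_intros)
  qed
  \<comment> \<open>On the plane of facet i, constraint j reads
    \<open>a \<bullet> z \<noteq> b\<close>, with \<open>a\<close> the tangential part of
    \<open>\<nu> j\<close>. It degenerates only if both constraints bound at the same plane: equal
    normals are excluded by distinctness of the halfspaces, opposite normals by the interior
    point.\<close>
  have off_planes: "AE z in lborel. \<forall>j\<in>I - {i}. \<nu> j \<bullet> proj i z \<noteq> c j"
  proof (rule AE_finite_allI)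
    fix j assume j: "j \<in> I - {i}"
    define a where "a = \<nu> j - (\<nu> j \<bullet> \<nu> i) *\<^sub>R \<nu> i"
    define b where "b = c j - (\<nu> j \<bullet> \<nu> i) * c i"
    have ab: "\<nu> j \<bullet> proj i z \<noteq> c j \<longleftrightarrow> a \<bullet> z \<noteq> b" for z
      by (auto simp: a_def b_def proj_def algebra_simps inner_commute)
    have "a \<noteq> 0 \<or> b \<noteq> 0"
    proof (rule ccontr)
      assume "\<not> (a \<noteq> 0 \<or> b \<noteq> 0)"
      then have a: "\<nu> j = (\<nu> j \<bullet> \<nu> i) *\<^sub>R \<nu> i" and b: "c j = (\<nu> j \<bullet> \<nu> i) * c i"
        by (auto simp: a_def b_def)
      define r where "r = \<nu> j \<bullet> \<nu> i"
      have "\<bar>r\<bar> = 1"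
        using arg_cong[OF a, of norm] norm_nu i j by (simp add: r_def)
      then consider "r = 1" | "r = - 1" by linarith
      then show False
      proof cases
        case 1
        then show False
          using a b distinct_halfspaces[of j i] i j by (simp add: r_def)
      next
        case 2
        obtain x where "\<forall>i\<in>I. \<nu> i \<bullet> x < c i" using interior_point by blast
        then have "\<nu> i \<bullet> x < c i" "\<nu> j \<bullet> x < c j" using i j by auto
        moreover have "\<nu> j = - \<nu> i" "c j = - c i"
          using a b 2 nu_nu[OF i] by (simp_all flip: r_def)
        ultimately show False by simp
      qed
    qed
    then show "AE z in lborel. \<nu> j \<bullet> proj i z \<noteq> c j"
      unfolding ab by (rule AE_lborel_not_hyperplane)
  qed (use finite_I in auto)
  \<comment> \<open>The index is shifted because the estimates on \<open>T N\<close> need N > 0.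
    Where the integrand is nonzero, \<open>T N z\<close> lies in K and z is within distance 1 + 1 /
    N \<le> 2 of it, whence the radius R + 2.\<close>
  have "(\<lambda>N. LINT z|lborel. \<Phi> (Suc N) z)
     \<longlonglongrightarrow> (LINT z|lborel. in_prism i z * f (proj i z))"
  proof (rule integral_dominated_convergence[where w = "\<lambda>z. \<bar>C\<bar> * indicator (cball 0 (R + 2)) z"])
    show "integrable lborel (\<lambda>x. \<bar>C\<bar> * indicator (cball 0 (R + 2)) x :: real)"
      by (rule integrable_indicator_bounded) auto
    show "AE z in lborel. (\<lambda>N. \<Phi> (Suc N) z) \<longlonglongrightarrow>
        in_prism i z * f (proj i z)"
      using off_planes
    proof eventually_elim
      case (elim z)
      have "(\<forall>j\<in>I - {i}. \<nu> j \<bullet> proj i z \<le> c j) \<longleftrightarrow> proj i z \<in> K"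
        using i nu_nu[OF i] by (auto simp: K_eq proj_def inner_simps)
      then have "(\<lambda>N. cut N (I - {i}) (T N z)) \<longlonglongrightarrow> of_bool (proj i z \<in> K)"
        using cut_tendsto[OF T_lim, of "I - {i}" z] elim finite_I by simp
      moreover have "(\<lambda>N. f (T N z)) \<longlonglongrightarrow> f (proj i z)"
        by (rule continuous_on_tendsto_compose[OF f T_lim]) auto
      ultimately have "(\<lambda>N. \<Phi> N z) \<longlonglongrightarrow> of_bool (0 \<le> \<nu> i \<bullet> z - c i \<and> \<nu> i \<bullet> z - c i < 1) *
          (of_bool (proj i z \<in> K) * f (proj i z))"
        unfolding \<Phi>_def by (intro tendsto_mult tendsto_const)
      also have "of_bool (0 \<le> \<nu> i \<bullet> z - c i \<and> \<nu> i \<bullet> z - c i < 1) * (of_bool (proj i z \<in> K) * f (proj i z)) =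
          in_prism i z * f (proj i z)"
        by simp
      finally show ?case
        by (rule LIMSEQ_Suc)
    qed
    show "AE z in lborel. norm (\<Phi> (Suc N) z) \<le> \<bar>C\<bar> * indicator (cball 0 (R + 2)) z" for N
    proof (rule AE_I2)
      fix z
      show "norm (\<Phi> (Suc N) z) \<le> \<bar>C\<bar> * indicator (cball 0 (R + 2)) z"
      proof (cases "\<Phi> (Suc N) z = 0")
        case False
        then have 1: "0 \<le> \<nu> i \<bullet> z - c i" "\<nu> i \<bullet> z - c i < 1" and 2: "cut (Suc N) (I - {i}) (T (Suc N) z) \<noteq> 0"
          by (auto simp: \<Phi>_def)
        have "T (Suc N) z \<in> K"
          using inK[OF 2] Tle by simp
        then have "norm (T (Suc N) z) \<le> R" by (rule R)
        then have "norm z \<le> R + 2"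
          using dist_T[of "Suc N" z] 1 norm_triangle_sub[of z "T (Suc N) z"] by simp
        then show ?thesis
          using 1 bnd[OF Tle[of "Suc N" z]] by (simp add: \<Phi>_def)
      qed simp
    qed
    show "(\<lambda>z. \<Phi> (Suc N) z) \<in> borel_measurable lborel" for N
      unfolding \<Phi>_def by measurable
    show "(\<lambda>z. in_prism i z * f (proj i z)) \<in> borel_measurable lborel"
      unfolding proj_def by measurable
  qed
  then have "(\<lambda>N. LINT z|lborel. \<Phi> N z)
     \<longlonglongrightarrow> (LINT z|lborel. in_prism i z * f (proj i z))"
    by (rule LIMSEQ_imp_Suc)
  then show ?thesis
    by (rule Lim_transform_eventually[OF _ eq])
qed

section \<open>Differentiating the cut-off and passing to the limit\<close>

definition cut_deriv :: "nat \<Rightarrow> 'a \<Rightarrow> 'a \<Rightarrow> real" where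
  "cut_deriv N e x = (\<Sum>i\<in>I. - (real N * (\<nu> i \<bullet> e)) *
     (in_slab N i x * cut N (I - {i}) x))"

text \<open>The kinks of the ramp of constraint i lie on the planes at c i and at c i - 1 / N. Off
  these finitely many planes the product rule applies.\<close>

lemma AE_cut_has_derivative:
  assumes "0 < N"
  shows "AE x in lborel. ((\<lambda>t. cut N I (x + t *\<^sub>R e)) has_real_derivative cut_deriv N e x) (at 0)"
  using AE_not_facet_planes[of c] AE_not_facet_planes[of "\<lambda>i. c i - 1 / real N"]
proof eventually_elim
  case (elim x)
  have "((\<lambda>t. ramp (real N * (c i - \<nu> i \<bullet> (x + t *\<^sub>R e)))) has_real_derivative
     in_slab N i x * - (real N * (\<nu> i \<bullet> e))) (at 0)"
    if i: "i \<in> I" for i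
  proof -
    define p where "p = real N * (c i - \<nu> i \<bullet> x)"
    have "p \<noteq> 0" "p \<noteq> 1"
      using elim i assms by (auto simp: p_def field_simps)
    moreover have "(0 < p \<and> p \<le> 1) = (- 1 / real N \<le> \<nu> i \<bullet> x - c i \<and> \<nu> i \<bullet> x - c i < 0)"
      using assms by (auto simp: p_def field_simps zero_less_mult_iff)
    ultimately have "(ramp has_real_derivative
        in_slab N i x) (at p)"
      using has_real_derivative_ramp[of p] by simp
    then have *: "(ramp has_real_derivative in_slab N i x)
        (at (real N * (c i - \<nu> i \<bullet> (x + 0 *\<^sub>R e))))"
      by (simp add: p_def)
    have "((\<lambda>t. real N * (c i - \<nu> i \<bullet> (x + t *\<^sub>R e))) has_real_derivative - (real N * (\<nu> i \<bullet> e))) (at 0)"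
      by (auto intro!: derivative_eq_intros simp: inner_simps)
    from DERIV_chain2[where g = "\<lambda>t. real N * (c i - \<nu> i \<bullet> (x + t *\<^sub>R e))", OF * this]
    show ?thesis .
  qed
  from has_field_derivative_prod[OF this]
  have "((\<lambda>t. cut N I (x + t *\<^sub>R e)) has_real_derivative
     (\<Sum>i\<in>I. in_slab N i x * - (real N * (\<nu> i \<bullet> e)) *
       cut N (I - {i}) (x + 0 *\<^sub>R e))) (at 0)"
    unfolding cut_def .
  then show ?case
    by (simp add: cut_deriv_def mult_ac)
qed

lemma divergence_cut:
  assumes der: "\<And>x. (h has_derivative (\<lambda>v. g x \<bullet> v)) (at x)" and g: "continuous_on UNIV g" and "0 < N"
  shows "(LINT x|lborel. cut N I x * (g x \<bullet> e)) =
    (\<Sum>i\<in>I. (\<nu> i \<bullet> e) * (real N * (LINT x|lborel.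
       in_slab N i x * (cut N (I - {i}) x * h x))))"
proof -
  have h: "continuous_on UNIV h"
    using der by (meson continuous_at_imp_continuous_on has_derivative_continuous)
  have [measurable]: "h \<in> borel_measurable borel" "g \<in> borel_measurable borel"
    using h g by (auto intro: borel_measurable_continuous_onI)
  have int: "integrable lborel (\<lambda>x. p x * f x)"
    if p: "\<And>x. \<bar>p x\<bar> \<le> indicator K x" "p \<in> borel_measurable borel" and f: "continuous_on UNIV f"
    for p f :: "'a \<Rightarrow> real"
  proof -
    have [measurable]: "f \<in> borel_measurable borel" "p \<in> borel_measurable borel"
      using f p by (auto intro: borel_measurable_continuous_onI)
    obtain C where C: "\<And>x. x \<in> K \<Longrightarrow> \<bar>f x\<bar> \<le> C"
      by (rule bounded_on_K[OF f]) (rule that)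
    have "\<bar>p x * f x\<bar> \<le> \<bar>C * indicator K x\<bar>" for x
    proof (cases "x \<in> K")
      case True
      then have "\<bar>p x\<bar> * \<bar>f x\<bar> \<le> 1 * \<bar>C\<bar>"
        using p(1)[of x] C by (intro mult_mono) force+
      then show ?thesis using True by (simp add: abs_mult)
    next
      case False
      then show ?thesis using p(1)[of x] by simp
    qed
    then show ?thesis
      by (intro Bochner_Integration.integrable_bound[OF integrable_indicator_bounded[OF bounded_K sets_K]])
        auto
  qed
  have cutK: "\<bar>cut N I x\<bar> \<le> indicator K x" for x
    using cut_bounds[of N I x] cut_nonzero[of N I x] finite_I
    by (cases "cut N I x = 0") (auto simp: K_eq less_imp_le)
  have slabK: "\<bar>in_slab N i x * cut N (I - {i}) x\<bar> \<le> indicator K x"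
    if "i \<in> I" for i x
  proof (cases "\<nu> i \<bullet> x - c i < 0 \<and> cut N (I - {i}) x \<noteq> 0")
    case True
    then have "\<nu> j \<bullet> x \<le> c j" if "j \<in> I" for j
      using cut_nonzero[of N "I - {i}" x j] finite_I that by (cases "j = i") auto
    then show ?thesis
      using cut_bounds[of N "I - {i}" x] by (auto simp: K_eq abs_mult)
  qed auto
  obtain R where R: "\<forall>x\<in>K. norm x \<le> R"
    using bounded_K unfolding bounded_iff by auto
  define G where "G x = cut N I x * h x" for x
  define D where "D x = cut N I x * (g x \<bullet> e) + cut_deriv N e x * h x" for x
  \<comment> \<open>The function h is merely C1, so Lipschitz bounds are taken on a ball; since R
    bounds K, this ball contains the support of G and every shift by at most e of its
    points.\<close>
  have "lip_bounded_on (cball 0 (R + 2 * norm e)) G"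
    unfolding G_def cut_def
    by (intro lip_bounded_on_mult lip_bounded_on_prod lip_bounded_on_ramp lip_bounded_on_C1[OF der g] finite_I)
  then obtain L where L: "\<forall>x\<in>cball 0 (R + 2 * norm e). \<forall>y\<in>cball 0 (R + 2 * norm e). \<bar>G x - G y\<bar> \<le> L * norm (x - y)"
    unfolding lip_bounded_on_def by blast
  have "(LINT x|lborel. D x) = 0"
  proof (rule integral_directional_derivative_eq_0[where G = G and R = R and L = L and e = e])
    show "G x = 0" if "R < norm x" for x
    proof -
      have "x \<notin> K" using R that by force
      then show ?thesis using cutK[of x] by (simp add: G_def)
    qed
    show "\<bar>G x - G y\<bar> \<le> L * norm (x - y)" if "norm x \<le> R + 2 * norm e" "norm y \<le> R + 2 * norm e" for x y
      using L that by simp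
    show "integrable lborel G"
      unfolding G_def by (rule int[OF cutK _ h]) measurable
    show "G \<in> borel_measurable borel" unfolding G_def by measurable
    show "D \<in> borel_measurable borel" unfolding D_def cut_deriv_def by measurable
    show "AE x in lborel. ((\<lambda>t. G (x + t *\<^sub>R e)) has_real_derivative D x) (at 0)"
      using AE_cut_has_derivative[OF \<open>0 < N\<close>, of e]
    proof eventually_elim
      case (elim x)
      have *: "(h has_derivative (\<lambda>v. g x \<bullet> v)) (at (x + 0 *\<^sub>R e))"
        using der by simp
      have "((\<lambda>t. x + t *\<^sub>R e) has_derivative (\<lambda>t. t *\<^sub>R e)) (at 0)"
        by (auto intro!: derivative_eq_intros)
      from has_derivative_compose[OF this *]
      have "((\<lambda>t. h (x + t *\<^sub>R e)) has_real_derivative g x \<bullet> e) (at 0)"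
        by (simp add: has_field_derivative_def mult.commute[of _ "g x \<bullet> e"])
      from DERIV_mult[OF elim this] show ?case
        unfolding G_def D_def by (simp add: add.commute mult.commute)
    qed
  qed
  moreover have "(LINT x|lborel. D x) = (LINT x|lborel. cut N I x * (g x \<bullet> e)) +
    (\<Sum>i\<in>I. - (real N * (\<nu> i \<bullet> e)) * (LINT x|lborel.
       in_slab N i x * (cut N (I - {i}) x * h x)))"
  proof -
    have i1: "integrable lborel (\<lambda>x. cut N I x * (g x \<bullet> e))"
      by (rule int[OF cutK]) (auto intro!: continuous_intros g)
    have i2: "integrable lborel (\<lambda>x. - (real N * (\<nu> i \<bullet> e)) *
       (in_slab N i x * (cut N (I - {i}) x * h x)))" if "i \<in> I" for i
      unfolding mult.assoc[symmetric, of "of_bool _"]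
      by (intro integrable_mult_right int[OF slabK[OF that] _ h]) measurable
    have "(LINT x|lborel. D x) = (LINT x|lborel. cut N I x * (g x \<bullet> e) + (\<Sum>i\<in>I. - (real N * (\<nu> i \<bullet> e)) *
       (in_slab N i x * (cut N (I - {i}) x * h x))))"
      unfolding D_def cut_deriv_def sum_distrib_right by (simp only: mult.assoc)
    also have "\<dots> = (LINT x|lborel. cut N I x * (g x \<bullet> e)) + (\<Sum>i\<in>I. LINT x|lborel. - (real N * (\<nu> i \<bullet> e)) *
       (in_slab N i x * (cut N (I - {i}) x * h x)))"
      by (subst Bochner_Integration.integral_add[OF i1 Bochner_Integration.integrable_sum[OF i2]])
        (simp_all only: Bochner_Integration.integral_sum[OF i2])
    finally show ?thesis by (simp only: integral_mult_right_zero)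
  qed
  ultimately show ?thesis
    by (simp add: sum_negf mult_ac)
qed

theorem divergence_theorem:
  assumes der: "\<And>x. (h has_derivative (\<lambda>v. g x \<bullet> v)) (at x)" and g: "continuous_on UNIV g"
  shows "(LINT x|lborel. indicator K x * (g x \<bullet> e)) =
    (\<Sum>i\<in>I. (\<nu> i \<bullet> e) * (LINT z|lborel.
       in_prism i z * h (proj i z)))"
proof (rule LIMSEQ_unique)
  have h: "continuous_on UNIV h"
    using der by (meson continuous_at_imp_continuous_on has_derivative_continuous)
  show "(\<lambda>N. LINT x|lborel. cut N I x * (g x \<bullet> e)) \<longlonglongrightarrow> (LINT x|lborel. indicator K x * (g x \<bullet> e))"
    by (intro integral_cut_tendsto continuous_intros g)
  have "(\<lambda>N. \<Sum>i\<in>I. (\<nu> i \<bullet> e) * (real N * (LINT x|lborel.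
       in_slab N i x * (cut N (I - {i}) x * h x))))
    \<longlonglongrightarrow> (\<Sum>i\<in>I. (\<nu> i \<bullet> e) * (LINT z|lborel.
       in_prism i z * h (proj i z)))"
    by (intro tendsto_sum tendsto_mult tendsto_const integral_cut_slab_tendsto h)
  moreover have "\<forall>\<^sub>F N in sequentially. (\<Sum>i\<in>I. (\<nu> i \<bullet> e) * (real N * (LINT x|lborel.
       in_slab N i x * (cut N (I - {i}) x * h x)))) =
      (LINT x|lborel. cut N I x * (g x \<bullet> e))"
    by (intro eventually_sequentiallyI[of 1]) (simp add: divergence_cut[OF der g])
  ultimately show "(\<lambda>N. LINT x|lborel. cut N I x * (g x \<bullet> e)) \<longlonglongrightarrow> (\<Sum>i\<in>I. (\<nu> i \<bullet> e) * (LINT z|lborel.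
       in_prism i z * h (proj i z)))"
    by (rule Lim_transform_eventually)
qed

end

section \<open>Facet integrals\<close>

lemma integral_lebesgue_on_borel:
  fixes f :: "'a::euclidean_space \<Rightarrow> real"
  assumes "S \<in> sets borel" "f \<in> borel_measurable borel"
  shows "(LINT x|lebesgue_on S. f x) = (LINT x|lborel. indicator S x * f x)"
proof -
  have [measurable]: "S \<in> sets borel" "f \<in> borel_measurable borel" by fact+
  have "(LINT x|lebesgue_on S. f x) = (LINT x|lebesgue. indicator S x *\<^sub>R f x)"
    by (rule integral_restrict_space) (use assms in auto)
  also have "\<dots> = (LINT x|lborel. indicator S x *\<^sub>R f x)"
    by (rule integral_completion) measurable
  finally show ?thesis by simp
qed

lemma integrable_lebesgue_on_borel:
  fixes f :: "'a::euclidean_space \<Rightarrow> real"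
  assumes "S \<in> sets borel" "f \<in> borel_measurable borel"
  shows "integrable (lebesgue_on S) f \<longleftrightarrow> integrable lborel (\<lambda>x. indicator S x * f x)"
proof -
  have [measurable]: "S \<in> sets borel" "f \<in> borel_measurable borel" by fact+
  have "integrable (lebesgue_on S) f \<longleftrightarrow> integrable lebesgue (\<lambda>x. indicator S x *\<^sub>R f x)"
    by (rule integrable_restrict_space) (use assms in auto)
  also have "\<dots> \<longleftrightarrow> integrable lborel (\<lambda>x. indicator S x *\<^sub>R f x)"
    by (rule integrable_completion) measurable
  finally show ?thesis by simp
qed

locale flat_set =
  fixes F :: "(real^'n) set" and n :: "real^'n" and c :: real
  assumes norm_n: "norm n = 1" and hull_F: "affine hull F = {x. n \<bullet> x = c}"
    and compact_F: "compact F" and convex_F: "convex F"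
begin

definition pr :: "real^'n \<Rightarrow> real^'n" where
  "pr z = z - (n \<bullet> z - c) *\<^sub>R n"

lemma nn: "n \<bullet> n = 1"
  using norm_n by (simp flip: norm_eq_1)

lemma pr_plane: "n \<bullet> pr z = c"
  by (simp add: pr_def inner_simps nn)

lemma pr_fix: "n \<bullet> x = c \<Longrightarrow> pr x = x"
  by (simp add: pr_def)

lemma F_plane: "x \<in> F \<Longrightarrow> n \<bullet> x = c"
  using hull_subset[of F affine] hull_F by auto

lemma continuous_pr: "continuous_on S pr"
  unfolding pr_def by (intro continuous_intros)

lemma pr_measurable [measurable]: "pr \<in> borel_measurable borel"
  by (rule borel_measurable_continuous_onI[OF continuous_pr])

lemma F_sets [measurable]: "F \<in> sets borel"
  by (rule borel_closed[OF compact_imp_closed[OF compact_F]])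

lemma closest_point_hull: "closest_point (affine hull F) = pr"
proof
  fix z
  have "\<forall>y\<in>{x. n \<bullet> x = c}. dist z (pr z) \<le> dist z y"
  proof
    fix y assume "y \<in> {x. n \<bullet> x = c}"
    then have "n \<bullet> z - c = n \<bullet> (z - y)" by (simp add: inner_simps)
    then have "\<bar>n \<bullet> z - c\<bar> \<le> norm (z - y)"
      using Cauchy_Schwarz_ineq2[of n "z - y"] norm_n by simp
    then show "dist z (pr z) \<le> dist z y"
      by (simp add: dist_norm pr_def norm_n)
  qed
  then show "closest_point (affine hull F) z = pr z"
    unfolding hull_F
    by (intro closest_point_unique[symmetric]) (auto simp: pr_plane convex_hyperplane closed_hyperplane)
qed

definition prism :: "(real^'n) set" where
  "prism = {z. 0 \<le> n \<bullet> z - c \<and> n \<bullet> z - c \<le> 1 \<and> pr z \<in> F}"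

lemma prism_eq: "{y + t *\<^sub>R n | y t. y \<in> F \<and> 0 \<le> t \<and> t \<le> 1} = prism"
proof (intro set_eqI iffI)
  fix z assume "z \<in> {y + t *\<^sub>R n | y t. y \<in> F \<and> 0 \<le> t \<and> t \<le> 1}"
  then obtain y t where "z = y + t *\<^sub>R n" "y \<in> F" "0 \<le> t" "t \<le> 1" by auto
  then show "z \<in> prism"
    using F_plane[of y] by (simp add: prism_def pr_def inner_simps nn)
next
  fix z assume "z \<in> prism"
  then show "z \<in> {y + t *\<^sub>R n | y t. y \<in> F \<and> 0 \<le> t \<and> t \<le> 1}"
    by (auto simp: prism_def intro!: exI[of _ "pr z"] exI[of _ "n \<bullet> z - c"]) (simp add: pr_def)
qed

lemma prism_sets [measurable]: "prism \<in> sets borel"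
  unfolding prism_def by measurable

lemma bounded_prism: "bounded prism"
proof -
  obtain B where B: "\<forall>x\<in>F. norm x \<le> B"
    using compact_imp_bounded[OF compact_F] unfolding bounded_iff by auto
  have "norm z \<le> B + 1" if "z \<in> prism" for z
  proof -
    have "norm (pr z) \<le> B" "norm ((n \<bullet> z - c) *\<^sub>R n) \<le> 1"
      using that B by (auto simp: prism_def norm_n)
    then show ?thesis
      using norm_triangle_ineq[of "pr z" "(n \<bullet> z - c) *\<^sub>R n"] by (simp add: pr_def)
  qed
  then show ?thesis unfolding bounded_iff by blast
qed

lemma pr_measurable_prism: "pr \<in> measurable (lebesgue_on prism) borel"
  by (rule measurable_restrict_space1) (simp add: measurable_completion)

lemma facet_measure_eq: "facet_measure n F = completion (distr (lebesgue_on prism) borel pr)"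
  by (simp add: facet_measure_def prism_eq closest_point_hull)

lemma borel_measurable_facet_measure:
  "f \<in> borel_measurable borel \<Longrightarrow> f \<in> borel_measurable (facet_measure n F)"
  unfolding facet_measure_eq by (intro measurable_completion) simp

lemma integral_facet_measure_prism:
  fixes f :: "real^'n \<Rightarrow> real"
  assumes [measurable]: "f \<in> borel_measurable borel"
  shows "(LINT x|facet_measure n F. f x) = (LINT z|lborel. indicator prism z * f (pr z))"
proof -
  have "(LINT x|facet_measure n F. f x) = (LINT z|lebesgue_on prism. f (pr z))"
    unfolding facet_measure_eq
    by (subst integral_completion) (auto intro!: integral_distr pr_measurable_prism)
  also have "\<dots> = (LINT z|lborel. indicator prism z * f (pr z))"
    by (rule integral_lebesgue_on_borel) measurable
  finally show ?thesis .
qed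

text \<open>The closed prism exceeds the half-open one of the divergence theorem only by its top
  face in the plane at c + 1, which is a null set.\<close>

lemma integral_facet_measure:
  fixes f :: "real^'n \<Rightarrow> real"
  assumes [measurable]: "f \<in> borel_measurable borel"
  shows "(LINT x|facet_measure n F. f x) =
    (LINT z|lborel. of_bool (0 \<le> n \<bullet> z - c \<and> n \<bullet> z - c < 1 \<and> pr z \<in> F) * f (pr z))"
  unfolding integral_facet_measure_prism[OF assms]
proof (rule integral_cong_AE)
  have "n \<noteq> 0" using norm_n by auto
  then have "AE z in lborel. n \<bullet> z \<noteq> c + 1"
    by (intro AE_lborel_not_hyperplane) simp
  then show "AE z in lborel. indicator prism z * f (pr z) =
    of_bool (0 \<le> n \<bullet> z - c \<and> n \<bullet> z - c < 1 \<and> pr z \<in> F) * f (pr z)"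
    by eventually_elim (auto simp: prism_def indicator_def)
qed measurable

lemma integrable_prism:
  fixes f :: "real^'n \<Rightarrow> real"
  assumes f: "continuous_on UNIV f"
  shows "integrable lborel (\<lambda>z. indicator prism z * f (pr z))"
proof -
  have [measurable]: "f \<in> borel_measurable borel"
    using f by (rule borel_measurable_continuous_onI)
  have "bounded (f ` F)"
    using f by (intro compact_imp_bounded compact_continuous_image compact_F) (auto intro: continuous_on_subset)
  then obtain C where C: "\<forall>x\<in>F. \<bar>f x\<bar> \<le> C"
    unfolding bounded_iff by auto
  show ?thesis
  proof (rule Bochner_Integration.integrable_bound[OF integrable_indicator_bounded[OF bounded_prism prism_sets, of C]])
    show "AE z in lborel. norm (indicator prism z * f (pr z)) \<le> norm (C * indicator prism z)"
      using C by (intro AE_I2) (fastforce simp: prism_def indicator_def)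
  qed measurable
qed

lemma integrable_facet_measure:
  fixes f :: "real^'n \<Rightarrow> real"
  assumes f: "continuous_on UNIV f"
  shows "integrable (facet_measure n F) f"
proof -
  have [measurable]: "f \<in> borel_measurable borel"
    using f by (rule borel_measurable_continuous_onI)
  have "integrable (lebesgue_on prism) (\<lambda>z. f (pr z))"
    using integrable_prism[OF f] by (subst integrable_lebesgue_on_borel) measurable
  then have "integrable (distr (lebesgue_on prism) borel pr) f"
    by (subst integrable_distr_eq) (auto intro: pr_measurable_prism)
  then show ?thesis
    unfolding facet_measure_eq by (subst integrable_completion) auto
qed

lemma AE_facet_measureI:
  assumes ae: "AE z in lborel. z \<in> prism \<longrightarrow> P (pr z)" and "{x. P x} \<in> sets borel"
  shows "AE x in facet_measure n F. P x"
  unfolding facet_measure_eq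
proof (rule AE_completion)
  have "AE z in lebesgue_on prism. P (pr z)"
    using AE_completion[OF ae] by (subst AE_restrict_space_iff) auto
  then show "AE x in distr (lebesgue_on prism) borel pr. P x"
    by (subst AE_distr_iff) (use assms pr_measurable_prism in auto)
qed

lemma rel_interior_sets: "rel_interior F \<in> sets borel"
proof -
  have "openin (top_of_set (affine hull F)) (rel_interior F)"
    by (rule openin_rel_interior)
  then obtain U where "open U" "rel_interior F = affine hull F \<inter> U"
    by (auto simp: openin_open)
  moreover have "closed (affine hull F)" by simp
  ultimately show ?thesis by simp
qed

text \<open>The prism is the Minkowski sum of F and a segment, hence convex, and its frontier is a
  null set; interior points of the prism project into the relative interior of F. This matches the
  classification of facets, which speaks of relative interiors only.\<close>

lemma AE_rel_interior: "AE x in facet_measure n F. x \<in> rel_interior F"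
proof (rule AE_facet_measureI)
  have "convex prism"
  proof -
    have "prism = (\<Union>y\<in>F. \<Union>z\<in>(\<lambda>t. t *\<^sub>R n) ` {0..1}. {y + z})"
      unfolding prism_eq[symmetric] by force
    moreover have "convex ((\<lambda>t. t *\<^sub>R n) ` {0..1})"
      by (intro convex_linear_image linear_scaleR_left convex_box) auto
    ultimately show ?thesis
      by (simp only: convex_sums[OF convex_F])
  qed
  then have "negligible (frontier prism)"
    by (rule negligible_convex_frontier)
  then have "AE z in lborel. z \<notin> frontier prism"
    using AE_not_in[of "frontier prism" lborel] frontier_closed[of prism]
    by (simp add: negligible_iff_null_sets null_sets_completion_iff borel_closed)
  then show "AE z in lborel. z \<in> prism \<longrightarrow> pr z \<in> rel_interior F"
  proof eventually_elim
    case (elim z)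
    show ?case
    proof
      assume "z \<in> prism"
      then have "z \<in> interior prism"
        using elim by (simp add: frontier_def closure_def)
      then obtain e where e: "e > 0" "ball z e \<subseteq> prism"
        by (auto simp: mem_interior)
      have "ball (pr z) e \<inter> affine hull F \<subseteq> F"
      proof
        fix y assume y: "y \<in> ball (pr z) e \<inter> affine hull F"
        define y' where "y' = y + (n \<bullet> z - c) *\<^sub>R n"
        have "y' - z = y - pr z" by (simp add: y'_def pr_def)
        then have "y' \<in> prism"
          using y e(2) by (auto simp: dist_norm norm_minus_commute)
        moreover have "pr y' = y"
          using y by (simp add: hull_F y'_def pr_def inner_simps nn)
        ultimately show "y \<in> F" by (simp add: prism_def)
      qed
      then show "pr z \<in> rel_interior F"
        using \<open>z \<in> prism\<close> e(1) unfolding mem_rel_interior_ball by (auto simp: prism_def)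
    qed
  qed
  show "{x. x \<in> rel_interior F} \<in> sets borel"
    using rel_interior_sets by simp
qed

end

lemma flat_set_uminus: "flat_set F n c \<Longrightarrow> flat_set F (- n) (- c)"
  by (auto simp: flat_set_def)

text \<open>The prism built with - n is the translate by - n of the one built with n and projects to
  the same facet. It is needed because the element on the plus side has - n as outward
  normal.\<close>

lemma integral_facet_measure_uminus:
  fixes f :: "real^'n \<Rightarrow> real"
  assumes F: "flat_set F n c" and [measurable]: "f \<in> borel_measurable borel"
  shows "(LINT x|facet_measure (- n) F. f x) = (LINT x|facet_measure n F. f x)"
proof -
  interpret flat_set F n c by fact
  interpret m: flat_set F "- n" "- c" by (rule flat_set_uminus[OF F])
  have pr: "m.pr z = pr z" for z
    by (simp add: m.pr_def pr_def algebra_simps)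
  have shift: "indicator m.prism (- n + z) = (indicator prism z :: real)" "pr (- n + z) = pr z" for z
  proof -
    show *: "pr (- n + z) = pr z"
      by (simp add: pr_def inner_simps nn algebra_simps)
    show "indicator m.prism (- n + z) = (indicator prism z :: real)"
      using * by (auto simp: m.prism_def prism_def pr inner_simps nn indicator_def)
  qed
  have "(LINT x|facet_measure (- n) F. f x) = (LINT z|lborel. indicator m.prism z * f (pr z))"
    by (simp add: m.integral_facet_measure_prism pr)
  also have "\<dots> = (LINT z|lborel. indicator m.prism (- n + z) * f (pr (- n + z)))"
    by (rule integral_lborel_translate[symmetric]) measurable
  finally show ?thesis
    unfolding shift by (simp add: integral_facet_measure_prism)
qed

text \<open>Orthogonality of n to F is not part of \<open>outward_unit_normal\<close>: it follows
  from the inequality applied both ways to pairs of points of F. A dimension count then makes the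
  affine hull of F the whole plane.\<close>

lemma outward_unit_normal_facet:
  fixes K F :: "(real^'n) set"
  assumes n: "outward_unit_normal K F n" and "F facet_of K" and "polytope K" and dim: "aff_dim K = int CARD('n)"
  obtains c where "flat_set F n c" "K \<subseteq> {x. n \<bullet> x \<le> c}" "F = K \<inter> {x. n \<bullet> x = c}"
    "interior K \<subseteq> {x. n \<bullet> x < c}"
proof -
  have face: "F face_of K" "F \<noteq> {}" "aff_dim F = aff_dim K - 1"
    using \<open>F facet_of K\<close> by (auto simp: facet_of_def)
  then obtain x0 where x0: "x0 \<in> F" by auto
  have "F \<subseteq> K" using face face_of_imp_subset by blast
  define c where "c = n \<bullet> x0"
  have "n \<noteq> 0" using n by (auto simp: outward_unit_normal_def)
  have K: "K \<subseteq> {x. n \<bullet> x \<le> c}"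
    using n x0 by (auto simp: outward_unit_normal_def c_def inner_simps)
  have "F \<subseteq> {x. n \<bullet> x = c}"
  proof
    fix x assume "x \<in> F"
    then have "n \<bullet> (x0 - x) \<le> 0" "n \<bullet> (x - x0) \<le> 0"
      using n x0 \<open>F \<subseteq> K\<close> by (auto simp: outward_unit_normal_def)
    then show "x \<in> {x. n \<bullet> x = c}" by (simp add: c_def inner_simps)
  qed
  then have sub: "affine hull F \<subseteq> {x. n \<bullet> x = c}"
    by (intro hull_minimal affine_hyperplane)
  have hull: "affine hull F = {x. n \<bullet> x = c}"
  proof (rule ccontr)
    assume "affine hull F \<noteq> {x. n \<bullet> x = c}"
    then have "affine hull F \<subset> affine hull {x. n \<bullet> x = c}"
      using sub by (subst (2) hull_same) (auto simp: affine_hyperplane)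
    then have "aff_dim F < aff_dim {x. n \<bullet> x = c}"
      by (rule aff_dim_psubset)
    then show False
      using \<open>n \<noteq> 0\<close> face dim by (simp add: aff_dim_hyperplane)
  qed
  have F: "F = K \<inter> {x. n \<bullet> x = c}"
    using face_of_imp_eq_affine_Int[OF polytope_imp_convex[OF \<open>polytope K\<close>] face(1)] hull by auto
  have "flat_set F n c"
  proof
    show "norm n = 1" using n by (simp add: outward_unit_normal_def)
    have "polytope F" using face \<open>polytope K\<close> face_of_polytope_polytope by blast
    then show "compact F" "convex F"
      by (auto simp: polytope_imp_compact polytope_imp_convex)
  qed (rule hull)
  moreover have "F \<noteq> K" using face by auto
  then have "F \<inter> interior K = {}"
    using face face_of_disjoint_interior by blast
  then have "interior K \<subseteq> {x. n \<bullet> x < c}"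
    using K F interior_subset[of K] by force
  ultimately show thesis using that K F by blast
qed

section \<open>Polytopes as intersections of their facet halfspaces\<close>

lemma full_dim_interior_nonempty:
  fixes K :: "(real^'n) set"
  assumes "convex K" "aff_dim K = int CARD('n)"
  shows "interior K \<noteq> {}"
  using assms interior_rel_interior[of K] rel_interior_eq_empty[of K] by fastforce

text \<open>A point x outside K is joined to an interior point y. The segment meets the frontier,
  and thus some facet F, at a point w \<noteq> x. The constraint of F is tight at w but strict at y,
  so it must be violated at x.\<close>

lemma polytope_eq_halfspaces:
  fixes K :: "(real^'n) set"
  assumes "polytope K" and dim: "aff_dim K = int CARD('n)"
    and n: "\<And>F. F facet_of K \<Longrightarrow> K \<subseteq> {x. \<nu> F \<bullet> x \<le> c F} \<and> F = K \<inter> {x. \<nu> F \<bullet> x = c F} \<and> interior K \<subseteq> {x. \<nu> F \<bullet> x < c F}"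
  shows "K = {x. \<forall>F\<in>facets_of K. \<nu> F \<bullet> x \<le> c F}"
proof
  show "K \<subseteq> {x. \<forall>F\<in>facets_of K. \<nu> F \<bullet> x \<le> c F}"
    using n by (fastforce simp: facets_of_def)
  show "{x. \<forall>F\<in>facets_of K. \<nu> F \<bullet> x \<le> c F} \<subseteq> K"
  proof (rule ccontr)
    assume "\<not> {x. \<forall>F\<in>facets_of K. \<nu> F \<bullet> x \<le> c F} \<subseteq> K"
    then obtain x where x: "\<And>F. F facet_of K \<Longrightarrow> \<nu> F \<bullet> x \<le> c F" "x \<notin> K"
      by (auto simp: facets_of_def)
    have "convex K" "closed K" "polyhedron K"
      using \<open>polytope K\<close> polytope_imp_convex polytope_imp_closed polytope_imp_polyhedron by auto
    obtain y where y: "y \<in> interior K"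
      using full_dim_interior_nonempty[OF \<open>convex K\<close> dim] by auto
    have "closed_segment y x \<inter> K \<noteq> {}" "closed_segment y x - K \<noteq> {}"
      using x y interior_subset by auto
    then have "closed_segment y x \<inter> frontier K \<noteq> {}"
      using connected_Int_frontier[OF connected_segment(1)] by blast
    then obtain w where w: "w \<in> closed_segment y x" "w \<in> frontier K" by auto
    have "frontier K = K - rel_interior K"
      using \<open>closed K\<close> y interior_rel_interior_gen[of K] dim by (simp add: frontier_def)
    then obtain F where F: "F facet_of K" "w \<in> F"
      using w rel_boundary_of_polyhedron[OF \<open>polyhedron K\<close>] by auto
    obtain t where t: "w = (1 - t) *\<^sub>R y + t *\<^sub>R x" "0 \<le> t" "t \<le> 1"
      using w(1) by (auto simp: closed_segment_def)
    have "w \<in> K" "w \<noteq> x"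
      using F facet_of_imp_subset x by auto
    then have "t < 1" using t by (cases "t = 1") auto
    have "\<nu> F \<bullet> w = c F" "\<nu> F \<bullet> y < c F"
      using n[OF F(1)] F(2) y by auto
    moreover have "\<nu> F \<bullet> w = (1 - t) * (\<nu> F \<bullet> y) + t * (\<nu> F \<bullet> x)"
      by (simp add: t(1) inner_simps)
    moreover have "(1 - t) * (\<nu> F \<bullet> y) < (1 - t) * c F"
      using \<open>t < 1\<close> \<open>\<nu> F \<bullet> y < c F\<close> by simp
    moreover have "t * (\<nu> F \<bullet> x) \<le> t * c F"
      using x(1)[OF F(1)] t(2) by (simp add: mult_left_mono)
    ultimately show False by (simp add: algebra_simps)
  qed
qed

lemma finite_facets_of: "polytope K \<Longrightarrow> finite (facets_of K)"
  unfolding facets_of_def by (rule finite_polytope_facets)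

theorem polytope_divergence_theorem:
  fixes K :: "(real^'n) set"
  assumes K: "polytope K" and dim: "aff_dim K = int CARD('n)"
    and n: "\<And>F. F facet_of K \<Longrightarrow> outward_unit_normal K F (\<nu> F)"
    and der: "\<And>x. (h has_derivative (\<lambda>v. g x \<bullet> v)) (at x)" and g: "continuous_on UNIV g"
  shows "(LINT x|lebesgue_on K. g x \<bullet> e) =
    (\<Sum>F\<in>facets_of K. (\<nu> F \<bullet> e) * (LINT x|facet_measure (\<nu> F) F. h x))"
proof -
  define P where "P F c \<longleftrightarrow> flat_set F (\<nu> F) c \<and> K \<subseteq> {x. \<nu> F \<bullet> x \<le> c} \<and>
    F = K \<inter> {x. \<nu> F \<bullet> x = c} \<and> interior K \<subseteq> {x. \<nu> F \<bullet> x < c}" for F c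
  \<comment> \<open>The locale takes the offsets as a function of the facet, so one value is chosen
    for each facet; the index set of the locale is the set of facets itself.\<close>
  define c where "c F = (SOME c. P F c)" for F
  have P: "P F (c F)" if F: "F facet_of K" for F
  proof -
    obtain d where "P F d"
      using outward_unit_normal_facet[OF n[OF F] F K dim] unfolding P_def by metis
    then show ?thesis
      unfolding c_def by (rule someI)
  qed
  then have c: "\<And>F. F facet_of K \<Longrightarrow> flat_set F (\<nu> F) (c F)"
    "\<And>F. F facet_of K \<Longrightarrow> K \<subseteq> {x. \<nu> F \<bullet> x \<le> c F} \<and> F = K \<inter> {x. \<nu> F \<bullet> x = c F} \<and> interior K \<subseteq> {x. \<nu> F \<bullet> x < c F}"
    unfolding P_def by simp_all
  interpret polytope_halfspaces "facets_of K" \<nu> c K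
  proof
    show "finite (facets_of K)" by (rule finite_facets_of[OF K])
    show "norm (\<nu> F) = 1" if "F \<in> facets_of K" for F
      using n that by (auto simp: facets_of_def outward_unit_normal_def)
    show "F = F'" if "F \<in> facets_of K" "F' \<in> facets_of K" "\<nu> F = \<nu> F'" "c F = c F'" for F F'
      using c(2)[of F] c(2)[of F'] that by (auto simp: facets_of_def)
    show "K = {x. \<forall>F\<in>facets_of K. \<nu> F \<bullet> x \<le> c F}"
      by (rule polytope_eq_halfspaces[OF K dim c(2)])
    show "bounded K" using K polytope_imp_bounded by blast
    obtain y where "y \<in> interior K"
      using full_dim_interior_nonempty[OF polytope_imp_convex[OF K] dim] by auto
    then show "\<exists>x. \<forall>F\<in>facets_of K. \<nu> F \<bullet> x < c F"
      using c(2) by (auto simp: facets_of_def intro!: exI[of _ y])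
  qed
  have h: "h \<in> borel_measurable borel"
    using der by (intro borel_measurable_continuous_onI)
      (meson continuous_at_imp_continuous_on has_derivative_continuous)
  have "(LINT x|lebesgue_on K. g x \<bullet> e) = (LINT x|lborel. indicator K x * (g x \<bullet> e))"
    by (intro integral_lebesgue_on_borel sets_K borel_measurable_continuous_onI continuous_intros g)
  also have "\<dots> = (\<Sum>F\<in>facets_of K. (\<nu> F \<bullet> e) * (LINT z|lborel.
       of_bool (0 \<le> \<nu> F \<bullet> z - c F \<and> \<nu> F \<bullet> z - c F < 1 \<and> proj F z \<in> K) * h (proj F z)))"
    by (rule divergence_theorem[OF der g])
  also have "\<dots> = (\<Sum>F\<in>facets_of K. (\<nu> F \<bullet> e) * (LINT x|facet_measure (\<nu> F) F. h x))"
  proof (rule sum.cong[OF refl])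
    fix F assume "F \<in> facets_of K"
    then have F: "F facet_of K" by (simp add: facets_of_def)
    interpret f: flat_set F "\<nu> F" "c F" by (rule c(1)[OF F])
    have p: "proj F z = f.pr z" for z by (simp add: proj_def f.pr_def)
    have "proj F z \<in> K \<longleftrightarrow> f.pr z \<in> F" for z
      using c(2)[OF F] f.pr_plane[of z] p by auto
    then show "(\<nu> F \<bullet> e) * (LINT z|lborel.
       of_bool (0 \<le> \<nu> F \<bullet> z - c F \<and> \<nu> F \<bullet> z - c F < 1 \<and> proj F z \<in> K) * h (proj F z)) =
       (\<nu> F \<bullet> e) * (LINT x|facet_measure (\<nu> F) F. h x)"
      by (simp add: f.integral_facet_measure[OF h] p)
  qed
  finally show ?thesis .
qed

section \<open>Polynomial spaces\<close>

definition cart_monom :: "('n::finite \<Rightarrow> nat) \<Rightarrow> real^'n \<Rightarrow> real" where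
  "cart_monom \<alpha> x = (\<Prod>i\<in>UNIV. x $ i ^ \<alpha> i)"

lemma finite_multi_indices: "finite {\<alpha> :: 'n::finite \<Rightarrow> nat. sum \<alpha> UNIV \<le> m}"
proof (rule finite_subset)
  show "{\<alpha> :: 'n \<Rightarrow> nat. sum \<alpha> UNIV \<le> m} \<subseteq> PiE UNIV (\<lambda>_. {..m})"
  proof
    fix \<alpha> :: "'n \<Rightarrow> nat" assume "\<alpha> \<in> {\<alpha>. sum \<alpha> UNIV \<le> m}"
    then have "\<alpha> i \<le> m" for i
      using member_le_sum[of i UNIV \<alpha>] by simp
    then show "\<alpha> \<in> PiE UNIV (\<lambda>_. {..m})" by auto
  qed
qed (auto intro: finite_PiE)

lemma Pol_eq: "Pol m = {p. \<exists>c. p = (\<lambda>x. \<Sum>\<alpha> | sum \<alpha> UNIV \<le> m. c \<alpha> * cart_monom \<alpha> x)}"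
  by (simp add: Pol_def cart_monom_def)

lemma Pol_zero: "(\<lambda>x. 0) \<in> Pol m"
  by (auto simp: Pol_eq intro!: exI[of _ "\<lambda>_. 0"])

lemma Pol_add:
  assumes "p \<in> Pol m" "q \<in> Pol m"
  shows "(\<lambda>x. p x + q x) \<in> Pol m"
proof -
  obtain c d where "p = (\<lambda>x. \<Sum>\<alpha> | sum \<alpha> UNIV \<le> m. c \<alpha> * cart_monom \<alpha> x)"
    "q = (\<lambda>x. \<Sum>\<alpha> | sum \<alpha> UNIV \<le> m. d \<alpha> * cart_monom \<alpha> x)"
    using assms by (auto simp: Pol_eq)
  then show ?thesis
    unfolding Pol_eq by (auto simp: sum.distrib distrib_right intro!: exI[of _ "\<lambda>\<alpha>. c \<alpha> + d \<alpha>"])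
qed

lemma Pol_cmult:
  assumes "p \<in> Pol m"
  shows "(\<lambda>x. r * p x) \<in> Pol m"
proof -
  obtain c where "p = (\<lambda>x. \<Sum>\<alpha> | sum \<alpha> UNIV \<le> m. c \<alpha> * cart_monom \<alpha> x)"
    using assms by (auto simp: Pol_eq)
  then show ?thesis
    unfolding Pol_eq by (auto simp: sum_distrib_left mult.assoc intro!: exI[of _ "\<lambda>\<alpha>. r * c \<alpha>"])
qed

lemma Pol_sum: "(\<And>i. i \<in> I \<Longrightarrow> p i \<in> Pol m) \<Longrightarrow> (\<lambda>x. \<Sum>i\<in>I. p i x) \<in> Pol m"
  by (induction I rule: infinite_finite_induct) (auto intro: Pol_zero Pol_add)

lemma cart_monom_in_Pol:
  assumes "sum \<alpha> UNIV \<le> m"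
  shows "cart_monom \<alpha> \<in> Pol m"
proof -
  have "(\<Sum>\<beta> | sum \<beta> UNIV \<le> m. of_bool (\<beta> = \<alpha>) * cart_monom \<beta> x) =
      (\<Sum>\<beta> | sum \<beta> UNIV \<le> m. if \<beta> = \<alpha> then cart_monom \<alpha> x else 0)" for x
    by (rule sum.cong) auto
  then have "cart_monom \<alpha> = (\<lambda>x. \<Sum>\<beta> | sum \<beta> UNIV \<le> m. of_bool (\<beta> = \<alpha>) * cart_monom \<beta> x)"
    using assms sum.delta[OF finite_multi_indices[of m], of \<alpha> "\<lambda>_. cart_monom \<alpha> _"]
    by (intro ext) (simp only: mem_Collect_eq if_True)
  then show ?thesis
    unfolding Pol_eq by (intro CollectI exI)
qed

lemma Pol_induct [consumes 1, case_names zero monom add]: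
  assumes "p \<in> Pol m"
    and "Q (\<lambda>x. 0)"
    and "\<And>c \<alpha>. sum \<alpha> UNIV \<le> m \<Longrightarrow> Q (\<lambda>x. c * cart_monom \<alpha> x)"
    and "\<And>p q. Q p \<Longrightarrow> Q q \<Longrightarrow> Q (\<lambda>x. p x + q x)"
  shows "Q p"
proof -
  obtain c where p: "p = (\<lambda>x. \<Sum>\<alpha> | sum \<alpha> UNIV \<le> m. c \<alpha> * cart_monom \<alpha> x)"
    using assms(1) by (auto simp: Pol_eq)
  have "Q (\<lambda>x. \<Sum>\<alpha>\<in>I. c \<alpha> * cart_monom \<alpha> x)" if "finite I" "I \<subseteq> {\<alpha>. sum \<alpha> UNIV \<le> m}" for I
    using that by (induction rule: finite_induct) (auto intro: assms)
  then show ?thesis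
    unfolding p using finite_multi_indices by blast
qed

lemma Pol_mono:
  assumes "p \<in> Pol l" "l \<le> m" shows "p \<in> Pol m"
  using assms(1)
proof (induction rule: Pol_induct)
  case (monom c \<alpha>)
  then show ?case using assms(2) by (intro Pol_cmult cart_monom_in_Pol) simp
qed (auto intro: Pol_zero Pol_add)

lemma cart_monom_mult: "cart_monom \<alpha> x * cart_monom \<beta> x = cart_monom (\<lambda>i. \<alpha> i + \<beta> i) x"
  by (simp add: cart_monom_def power_add prod.distrib)

lemma Pol_mult:
  assumes "p \<in> Pol l" "q \<in> Pol m"
  shows "(\<lambda>x. p x * q x) \<in> Pol (l + m)"
  using assms(1)
proof (induction rule: Pol_induct)
  case (monom c \<alpha>)
  from assms(2) show ?case
  proof (induction rule: Pol_induct)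
    case (monom d \<beta>)
    have "c * cart_monom \<alpha> x * (d * cart_monom \<beta> x) = (c * d) * cart_monom (\<lambda>i. \<alpha> i + \<beta> i) x" for x
      by (simp flip: cart_monom_mult)
    moreover have "sum (\<lambda>i. \<alpha> i + \<beta> i) UNIV \<le> l + m"
      using monom \<open>sum \<alpha> UNIV \<le> l\<close> by (simp add: sum.distrib)
    ultimately show ?case
      by (simp only:) (intro Pol_cmult cart_monom_in_Pol)
  qed (auto simp: distrib_left intro: Pol_zero Pol_add)
qed (auto simp: distrib_right intro: Pol_zero Pol_add)

lemma Pol_const: "(\<lambda>x. r) \<in> Pol m"
  using Pol_cmult[OF cart_monom_in_Pol[of "\<lambda>_. 0" m], of r] by (simp add: cart_monom_def)

lemma Pol_component: "1 \<le> m \<Longrightarrow> (\<lambda>x. x $ i) \<in> Pol m"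
proof -
  assume "1 \<le> m"
  have "cart_monom (\<lambda>j. if j = i then 1 else 0) x = x $ i" for x :: "real^'a"
    unfolding cart_monom_def by (simp add: if_distrib[of "\<lambda>k. _ ^ k"] cong: if_cong)
  then have "(\<lambda>x. x $ i) = cart_monom (\<lambda>j. if j = i then 1 else 0)"
    by auto
  then show ?thesis
    using \<open>1 \<le> m\<close> by (simp add: cart_monom_in_Pol)
qed

section \<open>Gradients of polynomials\<close>

lemma has_derivative_vec_nth: "((\<lambda>x. x $ i) has_derivative (\<lambda>v. v $ i)) F"
  by (rule bounded_linear_imp_has_derivative[OF bounded_linear_vec_nth])

lemma grad_eq: "(f has_derivative (\<lambda>v. g \<bullet> v)) (at x) \<Longrightarrow> grad f x = g"
  unfolding grad_def partial_deriv_def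
  by (simp add: vec_eq_iff inner_axis flip: frechet_derivative_at)

text \<open>The last claim holds monomial by monomial: multiplying the i-th derivative by x_i
  restores the exponent. It does not follow from the degree of the gradient when m = 0, where m - 1
  truncates to 0. It is what keeps the divergence of q x within the degree of q.\<close>

lemma Pol_has_gradient:
  assumes "p \<in> Pol m"
  shows "\<exists>g. (\<forall>x. (p has_derivative (\<lambda>v. g x \<bullet> v)) (at x)) \<and>
     (\<forall>i. (\<lambda>x. g x $ i) \<in> Pol (m - 1) \<and> (\<lambda>x. x $ i * g x $ i) \<in> Pol m)"
  using assms
proof (induction rule: Pol_induct)
  case zero
  show ?case by (intro exI[of _ "\<lambda>_. 0"]) (auto intro: Pol_zero)
next
  case (monom c \<alpha>)
  \<comment> \<open>If \<open>\<alpha> i = 0\<close> the subtraction truncates, but then the factor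
    \<open>real (\<alpha> i)\<close> in \<open>g\<close> is zero.\<close>
  define \<beta> where "\<beta> i = \<alpha>(i := \<alpha> i - 1)" for i
  define g where "g x = (\<chi> i. c * (real (\<alpha> i) * cart_monom (\<beta> i) x))" for x
  have split: "cart_monom (\<beta> i) x = x $ i ^ (\<alpha> i - 1) * (\<Prod>j\<in>UNIV - {i}. x $ j ^ \<alpha> j)" for i x
  proof -
    have "(\<Prod>j\<in>UNIV - {i}. x $ j ^ \<beta> i j) = (\<Prod>j\<in>UNIV - {i}. x $ j ^ \<alpha> j)"
      by (rule prod.cong) (auto simp: \<beta>_def)
    then show ?thesis
      unfolding cart_monom_def by (subst prod.remove[of _ i]) (auto simp: \<beta>_def)
  qed
  have der: "((\<lambda>x. c * cart_monom \<alpha> x) has_derivative (\<lambda>v. g x \<bullet> v)) (at x)" for x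
  proof -
    have "((\<lambda>x. x $ i ^ \<alpha> i) has_derivative (\<lambda>v. real (\<alpha> i) * x $ i ^ (\<alpha> i - 1) * v $ i)) (at x)" for i
      by (auto intro!: derivative_eq_intros has_derivative_vec_nth simp: mult_ac)
    from has_derivative_mult_right[OF has_derivative_prod[OF this, where I = UNIV], of c]
    have "((\<lambda>x. c * cart_monom \<alpha> x) has_derivative
      (\<lambda>v. c * (\<Sum>i\<in>UNIV. real (\<alpha> i) * x $ i ^ (\<alpha> i - 1) * v $ i * (\<Prod>j\<in>UNIV - {i}. x $ j ^ \<alpha> j)))) (at x)"
      unfolding cart_monom_def .
    moreover have "c * (\<Sum>i\<in>UNIV. real (\<alpha> i) * x $ i ^ (\<alpha> i - 1) * v $ i * (\<Prod>j\<in>UNIV - {i}. x $ j ^ \<alpha> j)) = g x \<bullet> v" for v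
      unfolding inner_vec_def g_def sum_distrib_left
      by (rule sum.cong) (auto simp: split)
    ultimately show ?thesis by simp
  qed
  have sum: "sum \<alpha> UNIV = \<alpha> i + sum \<alpha> (UNIV - {i})" for i
    by (simp add: sum.remove)
  have "(\<lambda>x. g x $ i) \<in> Pol (m - 1) \<and> (\<lambda>x. x $ i * g x $ i) \<in> Pol m" for i
  proof (cases "\<alpha> i = 0")
    case True
    then show ?thesis by (simp add: g_def Pol_zero)
  next
    case False
    have "sum (\<beta> i) (UNIV - {i}) = sum \<alpha> (UNIV - {i})"
      by (rule sum.cong) (auto simp: \<beta>_def)
    then have "sum (\<beta> i) UNIV = \<alpha> i - 1 + sum \<alpha> (UNIV - {i})"
      by (subst sum.remove[of _ i]) (auto simp: \<beta>_def)
    then have "sum (\<beta> i) UNIV \<le> m - 1"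
      using monom sum[of i] False by linarith
    then have 1: "(\<lambda>x. g x $ i) \<in> Pol (m - 1)"
      unfolding g_def by (simp add: Pol_cmult cart_monom_in_Pol)
    have "x $ i * x $ i ^ (\<alpha> i - 1) = x $ i ^ \<alpha> i" for x :: "real^'a"
      using False by (simp flip: power_Suc)
    then have "x $ i * cart_monom (\<beta> i) x = cart_monom \<alpha> x" for x
      unfolding split mult.assoc[symmetric] by (simp add: cart_monom_def prod.remove[of UNIV i])
    then have "(\<lambda>x. x $ i * g x $ i) = (\<lambda>x. c * (real (\<alpha> i) * cart_monom \<alpha> x))"
      by (auto simp: g_def mult.left_commute)
    then have "(\<lambda>x. x $ i * g x $ i) \<in> Pol m"
      using monom by (simp add: Pol_cmult cart_monom_in_Pol)
    with 1 show ?thesis by blast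
  qed
  with der show ?case by blast
next
  case (add p q)
  then obtain g h where gh:
    "(\<forall>x. (p has_derivative (\<lambda>v. g x \<bullet> v)) (at x)) \<and>
     (\<forall>i. (\<lambda>x. g x $ i) \<in> Pol (m - 1) \<and> (\<lambda>x. x $ i * g x $ i) \<in> Pol m)"
    "(\<forall>x. (q has_derivative (\<lambda>v. h x \<bullet> v)) (at x)) \<and>
     (\<forall>i. (\<lambda>x. h x $ i) \<in> Pol (m - 1) \<and> (\<lambda>x. x $ i * h x $ i) \<in> Pol m)"
    by (elim exE)
  show ?case
  proof (intro exI[of _ "\<lambda>x. g x + h x"] conjI allI)
    show "((\<lambda>x. p x + q x) has_derivative (\<lambda>v. (g x + h x) \<bullet> v)) (at x)" for x
      using gh has_derivative_add[of p "\<lambda>v. g x \<bullet> v" "at x" q "\<lambda>v. h x \<bullet> v"]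
      by (simp add: inner_add_left)
    show "(\<lambda>x. (g x + h x) $ i) \<in> Pol (m - 1)" for i
      using gh by (simp add: Pol_add)
    show "(\<lambda>x. x $ i * (g x + h x) $ i) \<in> Pol m" for i
      using gh by (simp add: Pol_add distrib_left)
  qed
qed

lemma Pol_grad:
  assumes "p \<in> Pol m"
  shows "(p has_derivative (\<lambda>v. grad p x \<bullet> v)) (at x)" and "grad p \<in> PolV (m - 1)"
    and "(\<lambda>x. x $ i * grad p x $ i) \<in> Pol m"
proof -
  obtain g where g: "\<And>x. (p has_derivative (\<lambda>v. g x \<bullet> v)) (at x)"
    "\<And>i. (\<lambda>x. g x $ i) \<in> Pol (m - 1)" "\<And>i. (\<lambda>x. x $ i * g x $ i) \<in> Pol m"
    using Pol_has_gradient[OF assms] by blast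
  have "grad p = g"
    using grad_eq[OF g(1)] by auto
  then show "(p has_derivative (\<lambda>v. grad p x \<bullet> v)) (at x)" "grad p \<in> PolV (m - 1)"
    "(\<lambda>x. x $ i * grad p x $ i) \<in> Pol m"
    using g by (auto simp: PolV_def)
qed

lemma real_polynomial_function_Pol: "p \<in> Pol m \<Longrightarrow> real_polynomial_function p"
proof (induction rule: Pol_induct)
  case (monom c \<alpha>)
  have "real_polynomial_function (\<lambda>x::real^'a. x $ i)" for i
    by (intro real_polynomial_function.intros(1) bounded_linear_vec_nth)
  then have "real_polynomial_function (\<lambda>x::real^'a. x $ i ^ \<alpha> i)" for i
    by (rule real_polynomial_function_power)
  then have "real_polynomial_function (cart_monom \<alpha>)"
    unfolding cart_monom_def by (intro real_polynomial_function_prod) auto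
  then show ?case
    by (intro real_polynomial_function.intros(2,4))
qed (auto intro: real_polynomial_function.intros)

lemma continuous_on_Pol: "p \<in> Pol m \<Longrightarrow> continuous_on S p"
  by (intro continuous_on_polymonial_function)
    (simp add: real_polynomial_function_Pol flip: real_polynomial_function_eq)

lemma borel_measurable_Pol: "p \<in> Pol m \<Longrightarrow> p \<in> borel_measurable borel"
  by (rule borel_measurable_continuous_onI[OF continuous_on_Pol])

lemma continuous_on_componentwise:
  fixes f :: "real^'m \<Rightarrow> real^'n"
  assumes "\<And>i. continuous_on S (\<lambda>x. f x $ i)"
  shows "continuous_on S f"
  using continuous_on_vec_lambda[of S "\<lambda>i x. f x $ i"] assms by simp

lemma continuous_on_PolV: "p \<in> PolV m \<Longrightarrow> continuous_on S p"
  by (rule continuous_on_componentwise) (auto simp: PolV_def intro: continuous_on_Pol)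

lemma polynomial_function_componentwise:
  fixes f :: "real^'m \<Rightarrow> real^'n"
  assumes "\<And>i. real_polynomial_function (\<lambda>x. f x $ i)"
  shows "polynomial_function f"
  unfolding polynomial_function_iff_Basis_inner
  using assms by (auto simp: Basis_vec_def inner_axis)

lemma polynomial_function_PolV: "p \<in> PolV m \<Longrightarrow> polynomial_function p"
  by (rule polynomial_function_componentwise) (auto simp: PolV_def intro: real_polynomial_function_Pol)

lemma PolV_add: "p \<in> PolV m \<Longrightarrow> q \<in> PolV m \<Longrightarrow> (\<lambda>x. p x + q x) \<in> PolV m"
  by (auto simp: PolV_def intro: Pol_add)

section \<open>Raviart-Thomas fields on one element\<close>

lemma RT_elem_component:
  assumes "\<rho> \<in> RT_elem m"
  shows "(\<lambda>x. \<rho> x $ i) \<in> Pol (m + 1)"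
proof -
  obtain p q where \<rho>: "\<rho> = (\<lambda>x. p x + q x *\<^sub>R x)" and p: "p \<in> PolV m" and q: "q \<in> Pol m"
    using assms by (auto simp: RT_elem_def)
  have "(\<lambda>x. p x $ i) \<in> Pol (m + 1)"
    using p by (auto simp: PolV_def intro: Pol_mono)
  moreover have "(\<lambda>x. q x * x $ i) \<in> Pol (m + 1)"
    by (intro Pol_mult q Pol_component) auto
  ultimately show ?thesis
    unfolding \<rho> by (simp add: Pol_add)
qed

lemma RT_elem_PolV: "\<rho> \<in> RT_elem m \<Longrightarrow> \<rho> \<in> PolV (m + 1)"
  using RT_elem_component by (auto simp: PolV_def)

lemma RT_elem_add:
  assumes "\<rho> \<in> RT_elem m" "\<tau> \<in> RT_elem m"
  shows "(\<lambda>x. \<rho> x + \<tau> x) \<in> RT_elem m"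
proof -
  obtain p q p' q' where "\<rho> = (\<lambda>x. p x + q x *\<^sub>R x)" "\<tau> = (\<lambda>x. p' x + q' x *\<^sub>R x)"
    "p \<in> PolV m" "q \<in> Pol m" "p' \<in> PolV m" "q' \<in> Pol m"
    using assms by (auto simp: RT_elem_def)
  then show ?thesis
    unfolding RT_elem_def
    by (auto intro!: bexI[of _ "\<lambda>x. p x + p' x"] bexI[of _ "\<lambda>x. q x + q' x"] PolV_add Pol_add simp: algebra_simps)
qed

definition divergence :: "(real^'n \<Rightarrow> real^'n) \<Rightarrow> real^'n \<Rightarrow> real" where
  "divergence \<rho> x = (\<Sum>i\<in>UNIV. grad (\<lambda>x. \<rho> x $ i) x $ i)"

text \<open>The i-th derivative of q x_i is x_i times the i-th derivative of q, plus q, and neither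
  summand exceeds the degree of q.\<close>

lemma divergence_RT_elem:
  assumes "\<rho> \<in> RT_elem m"
  shows "divergence \<rho> \<in> Pol m"
proof -
  obtain p q where \<rho>: "\<rho> = (\<lambda>x. p x + q x *\<^sub>R x)" and p: "p \<in> PolV m" and q: "q \<in> Pol m"
    using assms by (auto simp: RT_elem_def)
  have pi: "(\<lambda>x. p x $ i) \<in> Pol m" for i using p by (simp add: PolV_def)
  have g: "grad (\<lambda>x. \<rho> x $ i) x $ i = grad (\<lambda>x. p x $ i) x $ i + (x $ i * grad q x $ i + q x)" for i x
  proof -
    have "((\<lambda>x. \<rho> x $ i) has_derivative (\<lambda>v. (grad (\<lambda>x. p x $ i) x + (x $ i *\<^sub>R grad q x + q x *\<^sub>R axis i 1)) \<bullet> v)) (at x)"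
      unfolding \<rho>
      by (auto intro!: derivative_eq_intros has_derivative_vec_nth Pol_grad(1)[OF pi] Pol_grad(1)[OF q] simp: inner_simps inner_axis')
    from grad_eq[OF this] show ?thesis by (simp add: axis_def)
  qed
  have "(\<lambda>x. grad (\<lambda>x. \<rho> x $ i) x $ i) \<in> Pol m" for i
    unfolding g using Pol_grad(2)[OF pi[of i]] Pol_mono[of _ "m - 1" m]
    by (intro Pol_add Pol_grad(3) q) (auto simp: PolV_def)
  then show ?thesis
    unfolding divergence_def[abs_def] by (rule Pol_sum)
qed

lemma divergence_times_has_derivative:
  assumes "\<rho> \<in> RT_elem m" "\<And>x. (\<phi> has_derivative (\<lambda>v. g x \<bullet> v)) (at x)"
  shows "((\<lambda>x. \<rho> x $ i * \<phi> x) has_derivative (\<lambda>v. (\<phi> x *\<^sub>R grad (\<lambda>x. \<rho> x $ i) x + \<rho> x $ i *\<^sub>R g x) \<bullet> v)) (at x)"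
  by (auto intro!: derivative_eq_intros Pol_grad(1)[OF RT_elem_component[OF assms(1)]] assms(2) simp: inner_simps)

text \<open>On the plane the factor \<open>n \<bullet> x\<close> of the radial part is the constant
  c, so multiplication by x does not raise the degree of the normal component.\<close>

lemma RT_elem_normal_component:
  assumes "\<rho> \<in> RT_elem m"
  shows "\<exists>r\<in>Pol m. \<forall>x. n \<bullet> x = c \<longrightarrow> \<rho> x \<bullet> n = r x"
proof -
  obtain p q where \<rho>: "\<rho> = (\<lambda>x. p x + q x *\<^sub>R x)" and p: "p \<in> PolV m" and q: "q \<in> Pol m"
    using assms by (auto simp: RT_elem_def)
  have "(\<lambda>x. (\<Sum>i\<in>UNIV. n $ i * p x $ i) + c * q x) \<in> Pol m"
    using p q by (intro Pol_add Pol_sum Pol_cmult) (auto simp: PolV_def)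
  then show ?thesis
    by (rule bexI[rotated]) (auto simp: \<rho> inner_vec_def[of n "p _"] inner_simps inner_commute[of _ n] mult_ac simp del: inner_vec_def)
qed

text \<open>Along the line from a point of U to x the function is a univariate polynomial that
  vanishes on an open set of parameters. It thus has infinitely many roots, and its value at
  parameter 1 is \<open>r x\<close>.\<close>

lemma real_polynomial_function_eq_0:
  fixes r :: "'a::real_normed_vector \<Rightarrow> real"
  assumes r: "real_polynomial_function r" and "open U" "U \<noteq> {}" and 0: "\<And>x. x \<in> U \<Longrightarrow> r x = 0"
  shows "r x = 0"
proof -
  obtain y where y: "y \<in> U" using assms by auto
  define line where "line t = y + t *\<^sub>R (x - y)" for t :: real
  have "real_polynomial_function (r \<circ> line)"
  proof (rule real_polynomial_function_compose[OF _ r])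
    show "polynomial_function line"
      unfolding line_def by (intro polynomial_function_add polynomial_function_const polynomial_function_bounded_linear bounded_linear_scaleR_left)
  qed
  then obtain a k where ak: "r \<circ> line = (\<lambda>t. \<Sum>i\<le>k. a i * t ^ i)"
    by (auto simp: real_polynomial_function_iff_sum)
  have "open (line -` U)"
    unfolding line_def by (intro open_vimage \<open>open U\<close> continuous_intros)
  moreover have "0 \<in> line -` U" using y by (simp add: line_def)
  ultimately have "infinite (line -` U)"
    using finite_imp_not_open by auto
  moreover have "line -` U \<subseteq> {t. (\<Sum>i\<le>k. a i * t ^ i) = 0}"
    using 0 by (auto simp: fun_cong[OF ak, simplified, symmetric])
  ultimately have "infinite {t. (\<Sum>i\<le>k. a i * t ^ i) = 0}"
    using finite_subset by blast
  then have "\<forall>i\<le>k. a i = 0"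
    using polyfun_finite_roots[of a k] by auto
  then show ?thesis
    using fun_cong[OF ak, of 1] by (simp add: line_def)
qed

text \<open>The points of the interior of K where p and q differ form a set that is both open and
  negligible, hence empty. This is what makes the description in \<open>on_elem\<close>
  unique.\<close>

lemma polynomial_function_eq_if_AE:
  fixes p q :: "'a::euclidean_space \<Rightarrow> 'b::euclidean_space"
  assumes p: "polynomial_function p" and q: "polynomial_function q" and K: "interior K \<noteq> {}" "K \<in> sets lebesgue"
    and ae: "AE x in lebesgue_on K. p x = q x"
  shows "p = q"
proof -
  have cont: "continuous_on UNIV (\<lambda>x. p x - q x)"
    using p q by (intro continuous_on_diff continuous_on_polymonial_function)
  define U where "U = {x \<in> interior K. p x - q x \<noteq> 0}"
  have "U = interior K \<inter> (\<lambda>x. p x - q x) -` (- {0})"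
    by (auto simp: U_def)
  moreover have "open ((\<lambda>x. p x - q x) -` (- {0}))"
    by (rule open_vimage[OF _ cont]) (rule open_Compl[OF closed_singleton])
  ultimately have "open U"
    using open_Int[OF open_interior] by metis
  moreover have "negligible U"
  proof -
    have "AE x in lebesgue. x \<in> K \<longrightarrow> p x = q x"
      using ae K(2) by (subst (asm) AE_restrict_space_iff) auto
    then obtain N where "N \<in> null_sets lebesgue" "{x. \<not> (x \<in> K \<longrightarrow> p x = q x)} \<subseteq> N"
      by (auto simp: eventually_ae_filter)
    moreover have "U \<subseteq> {x. \<not> (x \<in> K \<longrightarrow> p x = q x)}"
      using interior_subset[of K] by (auto simp: U_def)
    ultimately show ?thesis
      by (meson negligible_iff_null_sets negligible_subset order.trans)
  qed
  ultimately have "U = {}"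
    by (meson open_not_negligible)
  then have eq: "p x = q x" if "x \<in> interior K" for x
    using that by (auto simp: U_def)
  have "(p x - q x) \<bullet> b = 0" if "b \<in> Basis" for x b
  proof (rule real_polynomial_function_eq_0[of "\<lambda>x. (p x - q x) \<bullet> b" "interior K"])
    show "real_polynomial_function (\<lambda>x. (p x - q x) \<bullet> b)"
      using polynomial_function_diff[OF p q] that unfolding polynomial_function_iff_Basis_inner by blast
  qed (use K eq in auto)
  then have "p x = q x" for x
    using euclidean_eq_iff[of "p x - q x" 0] by simp
  then show ?thesis by auto
qed

lemma on_elem_eq:
  fixes p v :: "real^'n \<Rightarrow> 'b::euclidean_space"
  assumes "polynomial_function p" "AE x in lebesgue_on K. v x = p x" and K: "interior K \<noteq> {}" "K \<in> sets lebesgue"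
  shows "on_elem v K = p"
  unfolding on_elem_def
proof (rule the_equality)
  fix q assume q: "polynomial_function q \<and> (AE x in lebesgue_on K. v x = q x)"
  have "AE x in lebesgue_on K. q x = p x"
    using assms(2) q by (auto elim!: eventually_elim2)
  then show "q = p"
    using q assms by (intro polynomial_function_eq_if_AE[OF _ _ K]) auto
qed (use assms in auto)

section \<open>Smooth test functions\<close>

lemma differentiable_has_grad:
  fixes f :: "real^'n \<Rightarrow> real"
  assumes "f differentiable (at x)"
  shows "(f has_derivative (\<lambda>v. grad f x \<bullet> v)) (at x)"
proof -
  let ?D = "frechet_derivative f (at x)"
  have D: "(f has_derivative ?D) (at x)"
    using assms by (simp add: frechet_derivative_works)
  have "?D v = grad f x \<bullet> v" for v
  proof -
    have "?D v = ?D (\<Sum>i\<in>UNIV. v $ i *\<^sub>R axis i 1)"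
      using basis_expansion[of v] by (simp add: scalar_mult_eq_scaleR)
    also have "\<dots> = (\<Sum>i\<in>UNIV. v $ i *\<^sub>R ?D (axis i 1))"
      using has_derivative_linear[OF D] by (simp add: linear_sum linear_cmul)
    also have "\<dots> = grad f x \<bullet> v"
      by (simp add: grad_def partial_deriv_def inner_vec_def mult.commute)
    finally show ?thesis .
  qed
  then show ?thesis using D by presburger
qed

lemma partial_deriv_eq:
  "(f has_derivative f') (at x) \<Longrightarrow> partial_deriv i f x = f' (axis i 1)"
  unfolding partial_deriv_def by (simp flip: frechet_derivative_at)

lemma partial_deriv_grad:
  fixes f :: "real^'n \<Rightarrow> real"
  assumes "(f has_derivative (\<lambda>v. g \<bullet> v)) (at x)"
  shows "partial_deriv i f x = g $ i"
  using partial_deriv_eq[OF assms, of i] by (simp add: inner_axis)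

lemma C_diff_SucD: "C_diff (Suc j) f \<Longrightarrow> C_diff j f"
proof (induction j arbitrary: f)
  case 0
  then show ?case
    by (auto simp: continuous_on_eq_continuous_at differentiable_imp_continuous_within)
qed auto

lemma C_diff_const: "C_diff j (\<lambda>x. c)"
proof (induction j arbitrary: c)
  case (Suc j)
  have "partial_deriv i (\<lambda>x::real^'a. c) = (\<lambda>x. 0)" for i
    by (rule ext, subst partial_deriv_eq[where f' = "\<lambda>_. 0"]) auto
  then show ?case using Suc by simp
qed simp

lemma C_diff_add: "C_diff j f \<Longrightarrow> C_diff j g \<Longrightarrow> C_diff j (\<lambda>x. f x + g x)"
proof (induction j arbitrary: f g)
  case (Suc j)
  have "partial_deriv i (\<lambda>x. f x + g x) = (\<lambda>x. partial_deriv i f x + partial_deriv i g x)" for i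
  proof
    fix x
    have "(f has_derivative (\<lambda>v. grad f x \<bullet> v)) (at x)" "(g has_derivative (\<lambda>v. grad g x \<bullet> v)) (at x)"
      using Suc by (auto intro: differentiable_has_grad)
    from has_derivative_add[OF this] partial_deriv_grad[OF this(1), of i] partial_deriv_grad[OF this(2), of i]
    show "partial_deriv i (\<lambda>x. f x + g x) x = partial_deriv i f x + partial_deriv i g x"
      using partial_deriv_eq[of "\<lambda>x. f x + g x" _ x i] by (simp add: inner_axis)
  qed
  then show ?case using Suc by auto
qed (auto intro: continuous_on_add)

lemma C_diff_mult: "C_diff j f \<Longrightarrow> C_diff j g \<Longrightarrow> C_diff j (\<lambda>x. f x * g x)"
proof (induction j arbitrary: f g)
  case (Suc j)
  have "partial_deriv i (\<lambda>x. f x * g x) = (\<lambda>x. f x * partial_deriv i g x + partial_deriv i f x * g x)" for i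
  proof
    fix x
    have "(f has_derivative (\<lambda>v. grad f x \<bullet> v)) (at x)" "(g has_derivative (\<lambda>v. grad g x \<bullet> v)) (at x)"
      using Suc by (auto intro: differentiable_has_grad)
    from has_derivative_mult[OF this] partial_deriv_grad[OF this(1), of i] partial_deriv_grad[OF this(2), of i]
    show "partial_deriv i (\<lambda>x. f x * g x) x = f x * partial_deriv i g x + partial_deriv i f x * g x"
      using partial_deriv_eq[of "\<lambda>x. f x * g x" _ x i] by (simp add: inner_axis)
  qed
  moreover have "C_diff j f" "C_diff j g"
    using Suc C_diff_SucD by blast+
  ultimately show ?case using Suc by (auto intro!: C_diff_add)
qed (auto intro: continuous_on_mult)

lemma C_diff_prod: "(\<And>i. i \<in> I \<Longrightarrow> C_diff j (f i)) \<Longrightarrow> C_diff j (\<lambda>x. \<Prod>i\<in>I. f i x)"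
  by (induction I rule: infinite_finite_induct) (auto intro: C_diff_mult C_diff_const)

lemma C_diff_Pol: "p \<in> Pol m \<Longrightarrow> C_diff j p"
proof (induction j arbitrary: p m)
  case 0
  then show ?case by (simp add: continuous_on_Pol)
next
  case (Suc j)
  have "partial_deriv i p = (\<lambda>x. grad p x $ i)" for i
    by (auto intro: partial_deriv_grad[OF Pol_grad(1)[OF Suc.prems]])
  moreover have "(\<lambda>x. grad p x $ i) \<in> Pol (m - 1)" for i
    using Pol_grad(2)[OF Suc.prems] by (simp add: PolV_def)
  ultimately show ?case
    using Suc by (auto intro: differentiableI[OF Pol_grad(1)[OF Suc.prems]])
qed

lemma C_diff_exp_Pol:
  assumes p: "p \<in> Pol m"
  shows "C_diff j (\<lambda>x. exp (p x))"
proof (induction j)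
  case 0
  then show ?case using continuous_on_Pol[OF p] by (auto intro: continuous_on_exp)
next
  case (Suc j)
  have der: "((\<lambda>x. exp (p x)) has_derivative (\<lambda>v. (exp (p x) *\<^sub>R grad p x) \<bullet> v)) (at x)" for x
    using has_derivative_exp[OF Pol_grad(1)[OF p]] by (simp add: mult.commute)
  have "partial_deriv i (\<lambda>x. exp (p x)) = (\<lambda>x. exp (p x) * grad p x $ i)" for i
    using partial_deriv_grad[OF der] by auto
  moreover have "(\<lambda>x. grad p x $ i) \<in> Pol (m - 1)" for i
    using Pol_grad(2)[OF p] by (simp add: PolV_def)
  then have "C_diff j (\<lambda>x. grad p x $ i)" for i
    by (rule C_diff_Pol)
  ultimately show ?case
    using Suc by (auto intro!: C_diff_mult intro: differentiableI[OF der])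
qed

text \<open>The functions \<open>flat_exp p\<close>, flat at the origin, are closed under differentiation.\<close>

definition flat_exp :: "real poly \<Rightarrow> real \<Rightarrow> real" where
  "flat_exp p t = (if 0 < t then poly p (1 / t) * exp (- (1 / t)) else 0)"

lemma poly_exp_tendsto_0: "((\<lambda>y. poly p y * exp (- y)) \<longlongrightarrow> (0::real)) at_top"
proof -
  have "((\<lambda>y. \<Sum>i\<le>degree p. coeff p i * (y ^ i / exp y)) \<longlongrightarrow> (\<Sum>i\<le>degree p. coeff p i * 0)) at_top"
    by (intro tendsto_sum tendsto_mult tendsto_const tendsto_power_div_exp_0)
  then show ?thesis
    by (simp add: poly_altdef sum_distrib_right exp_minus divide_inverse mult.assoc)
qed

lemma flat_exp_tendsto_0: "(flat_exp p \<longlongrightarrow> 0) (at 0)"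
proof (rule filterlim_split_at)
  have "((\<lambda>t. poly p (inverse t) * exp (- inverse t)) \<longlongrightarrow> 0) (at_right 0)"
    by (rule filterlim_compose[OF poly_exp_tendsto_0 filterlim_inverse_at_top_right])
  then show "(flat_exp p \<longlongrightarrow> 0) (at_right 0)"
    by (rule Lim_transform_eventually)
      (auto simp: flat_exp_def eventually_at_right_less inverse_eq_divide intro!: eventually_at_rightI[of 0 1])
  have "\<forall>\<^sub>F t in at_left 0. flat_exp p t = 0"
    by (auto simp: flat_exp_def intro!: eventually_at_leftI[of "- 1"])
  then show "(flat_exp p \<longlongrightarrow> 0) (at_left 0)"
    by (rule tendsto_eventually)
qed

text \<open>With y = 1 / t the derivative is y^2 (p(y) - p'(y)) exp (- y); the two
  \<open>pCons 0\<close> are the factor y^2. At t = 0 the difference quotient is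
  \<open>flat_exp (pCons 0 p)\<close>, which tends to 0.\<close>

lemma flat_exp_has_derivative:
  "(flat_exp p has_real_derivative flat_exp (pCons 0 (pCons 0 (p - pderiv p))) t) (at t)"
proof -
  consider "t < 0" | "t = 0" | "0 < t" by linarith
  then show ?thesis
  proof cases
    case 1
    have "((\<lambda>_. 0) has_real_derivative 0) (at t)" by simp
    then have "(flat_exp p has_real_derivative 0) (at t)"
      by (rule has_field_derivative_transform_within_open[where S = "{..<0}"]) (use 1 in \<open>auto simp: flat_exp_def\<close>)
    then show ?thesis using 1 by (simp add: flat_exp_def)
  next
    case 2
    have "flat_exp (pCons 0 p) h = (flat_exp p h - flat_exp p 0) / h" for h
      by (simp add: flat_exp_def)
    then have "((\<lambda>h. (flat_exp p h - flat_exp p 0) / h) \<longlongrightarrow> 0) (at 0)"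
      using flat_exp_tendsto_0[of "pCons 0 p"] by presburger
    then show ?thesis
      using 2 by (simp add: DERIV_def flat_exp_def)
  next
    case 3
    have "((\<lambda>t. poly p (1 / t) * exp (- (1 / t))) has_real_derivative
        flat_exp (pCons 0 (pCons 0 (p - pderiv p))) t) (at t)"
    proof -
      have 1: "((\<lambda>t. 1 / t) has_real_derivative - (1 / t\<^sup>2)) (at t)"
        using 3 by (auto intro!: derivative_eq_intros simp: power2_eq_square field_simps)
      have 2: "((\<lambda>t. poly p (1 / t)) has_real_derivative poly (pderiv p) (1 / t) * - (1 / t\<^sup>2)) (at t)"
        by (rule DERIV_chain2[OF poly_DERIV 1])
      have 3: "((\<lambda>t. exp (- (1 / t))) has_real_derivative exp (- (1 / t)) * (1 / t\<^sup>2)) (at t)"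
        using DERIV_chain2[OF DERIV_exp DERIV_minus[OF 1]] by simp
      show ?thesis
        using DERIV_mult[OF 2 3] \<open>0 < t\<close>
        by (simp add: flat_exp_def power2_eq_square algebra_simps)
    qed
    then show ?thesis
      by (rule has_field_derivative_transform_within_open[where S = "{0<..}"]) (use 3 in \<open>auto simp: flat_exp_def\<close>)
  qed
qed

lemma C_diff_flat_exp: "C_diff j (\<lambda>x. flat_exp p (s * x $ i + b))"
proof (induction j arbitrary: p)
  case 0
  have "continuous_on UNIV (flat_exp p)"
    using DERIV_isCont[OF flat_exp_has_derivative] by (simp add: continuous_on_eq_continuous_at)
  then show ?case
    by (auto intro!: continuous_on_compose2[of UNIV "flat_exp p"] continuous_intros)
next
  case (Suc j)
  define q where "q = pCons 0 (pCons 0 (p - pderiv p))"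
  have der: "((\<lambda>x. flat_exp p (s * x $ i + b)) has_derivative
      (\<lambda>v. ((flat_exp q (s * x $ i + b) * s) *\<^sub>R axis i 1) \<bullet> v)) (at x)" for x :: "real^'a"
  proof -
    have "((\<lambda>x::real^'a. s * x $ i + b) has_derivative (\<lambda>v. s * v $ i)) (at x)"
      by (auto intro!: derivative_eq_intros has_derivative_vec_nth)
    from has_derivative_compose[OF this flat_exp_has_derivative[unfolded has_field_derivative_def], of p]
    show ?thesis by (simp add: q_def inner_axis' mult_ac)
  qed
  have "partial_deriv k (\<lambda>x::real^'a. flat_exp p (s * x $ i + b)) =
     (\<lambda>x. flat_exp q (s * x $ i + b) * (s * axis i 1 $ k))" for k
    using partial_deriv_grad[OF der] by auto
  then show ?case
    using Suc by (auto intro!: C_diff_mult C_diff_const intro: differentiableI[OF der])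
qed

section \<open>Bump functions on boxes as test functions\<close>

definition bump :: "real^'n \<Rightarrow> real^'n \<Rightarrow> real^'n \<Rightarrow> real" where
  "bump a b x = (\<Prod>i\<in>UNIV. flat_exp 1 (x $ i - a $ i) * flat_exp 1 (b $ i - x $ i))"

lemma flat_exp_1: "0 \<le> flat_exp 1 t" "flat_exp 1 t = 0 \<longleftrightarrow> t \<le> 0"
  by (auto simp: flat_exp_def)

lemma bump_nonneg: "0 \<le> bump a b x"
  unfolding bump_def by (intro prod_nonneg mult_nonneg_nonneg flat_exp_1)

lemma bump_eq_0_iff: "bump a b x = 0 \<longleftrightarrow> x \<notin> box a b"
  unfolding bump_def by (auto simp: flat_exp_1 mem_box_cart not_less)

lemma C_diff_bump: "C_diff j (bump a b)"
proof -
  have "C_diff j (\<lambda>x. \<Prod>i\<in>UNIV. flat_exp 1 (1 * x $ i + (- a $ i)) * flat_exp 1 ((-1) * x $ i + b $ i))"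
    by (intro C_diff_prod C_diff_mult C_diff_flat_exp)
  then show ?thesis
    unfolding bump_def[abs_def] by simp
qed

lemma bump_times_test_function:
  assumes "\<And>j. C_diff j \<phi>" "cbox a b \<subseteq> S"
  shows "(\<lambda>x. bump a b x * \<phi> x) \<in> test_functions S"
proof -
  have "{x. bump a b x * \<phi> x \<noteq> 0} \<subseteq> cbox a b"
    using box_subset_cbox[of a b] by (auto simp: bump_eq_0_iff)
  then have "closure {x. bump a b x * \<phi> x \<noteq> 0} \<subseteq> cbox a b"
    by (rule closure_minimal) (rule closed_cbox)
  moreover have "compact (closure {x. bump a b x * \<phi> x \<noteq> 0})"
    using bounded_subset[OF bounded_cbox calculation] by (simp add: compact_eq_bounded_closed)
  ultimately show ?thesis
    using assms by (auto simp: test_functions_def intro!: C_diff_mult C_diff_bump)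
qed

lemma test_function_has_grad:
  assumes "\<phi> \<in> test_functions S"
  shows "(\<phi> has_derivative (\<lambda>v. grad \<phi> x \<bullet> v)) (at x)" and "continuous_on UNIV (grad \<phi>)"
    and "continuous_on UNIV \<phi>" and "\<phi> x \<noteq> 0 \<Longrightarrow> x \<in> S"
proof -
  have C: "C_diff j \<phi>" for j using assms by (simp add: test_functions_def)
  show "(\<phi> has_derivative (\<lambda>v. grad \<phi> x \<bullet> v)) (at x)"
    using C[of 1] by (intro differentiable_has_grad) simp
  show "continuous_on UNIV (grad \<phi>)"
    using C[of 1] by (intro continuous_on_componentwise) (simp add: grad_def)
  show "continuous_on UNIV \<phi>" using C[of 0] by simp
  show "x \<in> S" if "\<phi> x \<noteq> 0"
    using that assms closure_subset[of "{x. \<phi> x \<noteq> 0}"] by (auto simp: test_functions_def)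
qed

section \<open>Square-integrable functions and meshes\<close>

lemma L2_bound:
  assumes "L2 S g" "f \<in> borel_measurable (lebesgue_on S)" "\<And>x. norm (f x) \<le> norm (g x)"
  shows "L2 S f"
  unfolding L2_def
proof
  show "integrable (lebesgue_on S) (\<lambda>x. (norm (f x))\<^sup>2)"
  proof (rule Bochner_Integration.integrable_bound)
    show "integrable (lebesgue_on S) (\<lambda>x. (norm (g x))\<^sup>2)"
      using assms by (simp add: L2_def)
    show "(\<lambda>x. (norm (f x))\<^sup>2) \<in> borel_measurable (lebesgue_on S)"
      using assms(2) by measurable
    show "AE x in lebesgue_on S. norm ((norm (f x))\<^sup>2) \<le> norm ((norm (g x))\<^sup>2)"
      using assms(3) by (intro AE_I2) (simp add: power_mono)
  qed
qed (fact assms(2))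

lemma L2_add:
  fixes f g :: "real^'n \<Rightarrow> 'b::euclidean_space"
  assumes "L2 S f" "L2 S g"
  shows "L2 S (\<lambda>x. f x + g x)"
  unfolding L2_def
proof
  have [measurable]: "f \<in> borel_measurable (lebesgue_on S)" "g \<in> borel_measurable (lebesgue_on S)"
    using assms by (auto simp: L2_def)
  show "(\<lambda>x. f x + g x) \<in> borel_measurable (lebesgue_on S)" by measurable
  show "integrable (lebesgue_on S) (\<lambda>x. (norm (f x + g x))\<^sup>2)"
  proof (rule Bochner_Integration.integrable_bound)
    show "integrable (lebesgue_on S) (\<lambda>x. 2 * (norm (f x))\<^sup>2 + 2 * (norm (g x))\<^sup>2)"
      using assms by (auto simp: L2_def)
    have "(norm (f x + g x))\<^sup>2 \<le> 2 * (norm (f x))\<^sup>2 + 2 * (norm (g x))\<^sup>2" for x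
    proof -
      have "(norm (f x + g x))\<^sup>2 \<le> (norm (f x) + norm (g x))\<^sup>2"
        by (intro power_mono norm_triangle_ineq norm_ge_zero)
      also have "\<dots> \<le> 2 * (norm (f x))\<^sup>2 + 2 * (norm (g x))\<^sup>2"
        using zero_le_power2[of "norm (f x) - norm (g x)"] by (simp add: power2_eq_square algebra_simps)
      finally show ?thesis .
    qed
    then show "AE x in lebesgue_on S. norm ((norm (f x + g x))\<^sup>2) \<le> norm (2 * (norm (f x))\<^sup>2 + 2 * (norm (g x))\<^sup>2)"
      by (intro AE_I2) simp
  qed measurable
qed

lemma L2_inner_integrable:
  fixes f g :: "real^'n \<Rightarrow> 'b::euclidean_space"
  assumes "L2 S f" "L2 S g"
  shows "integrable (lebesgue_on S) (\<lambda>x. f x \<bullet> g x)"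
proof (rule Bochner_Integration.integrable_bound)
  have [measurable]: "f \<in> borel_measurable (lebesgue_on S)" "g \<in> borel_measurable (lebesgue_on S)"
    using assms by (auto simp: L2_def)
  show "integrable (lebesgue_on S) (\<lambda>x. (norm (f x))\<^sup>2 + (norm (g x))\<^sup>2)"
    using assms by (auto simp: L2_def)
  show "(\<lambda>x. f x \<bullet> g x) \<in> borel_measurable (lebesgue_on S)"
    by measurable
  have "\<bar>f x \<bullet> g x\<bar> \<le> (norm (f x))\<^sup>2 + (norm (g x))\<^sup>2" for x
  proof -
    have "\<bar>f x \<bullet> g x\<bar> \<le> norm (f x) * norm (g x)" by (rule Cauchy_Schwarz_ineq2)
    also have "\<dots> \<le> (norm (f x))\<^sup>2 + (norm (g x))\<^sup>2"
    proof -
      have "0 \<le> norm (f x) * norm (g x)" by simp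
      then show ?thesis using sum_squares_bound[of "norm (f x)" "norm (g x)"] by linarith
    qed
    finally show ?thesis .
  qed
  then show "AE x in lebesgue_on S. norm (f x \<bullet> g x) \<le> norm ((norm (f x))\<^sup>2 + (norm (g x))\<^sup>2)"
    by (intro AE_I2) simp
qed

lemma borel_measurable_lebesgue_on:
  "f \<in> borel_measurable borel \<Longrightarrow> f \<in> borel_measurable (lebesgue_on S)"
  by (intro measurable_restrict_space1 measurable_completion) simp

lemma integrable_lebesgue_on_continuous:
  fixes f :: "real^'n \<Rightarrow> real"
  assumes "continuous_on UNIV f" "bounded S" "S \<in> sets borel"
  shows "integrable (lebesgue_on S) f"
proof -
  have "compact (f ` closure S)"
    using assms by (intro compact_continuous_image) (auto intro: continuous_on_subset simp: compact_closure)
  then have "bounded (f ` closure S)" by (rule compact_imp_bounded)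
  then obtain B where B: "\<forall>y\<in>f ` closure S. norm y \<le> B"
    unfolding bounded_iff ..
  show ?thesis
  proof (rule finite_measure.integrable_const_bound)
    show "finite_measure (lebesgue_on S)"
      using emeasure_bounded_finite[OF \<open>bounded S\<close>] assms(3)
      by (intro finite_measureI) (simp add: emeasure_restrict_space)
    show "AE x in lebesgue_on S. norm (f x) \<le> B"
      using closure_subset[of S] B by (intro AE_I2) (auto simp: space_restrict_space)
    show "f \<in> borel_measurable (lebesgue_on S)"
      using assms(1) by (intro borel_measurable_lebesgue_on borel_measurable_continuous_onI)
  qed
qed

lemma L2_continuous:
  fixes f :: "real^'n \<Rightarrow> 'b::euclidean_space"
  assumes "continuous_on UNIV f" "bounded S" "S \<in> sets borel"
  shows "L2 S f"
  unfolding L2_def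
  using assms by (auto intro!: integrable_lebesgue_on_continuous borel_measurable_lebesgue_on
      borel_measurable_continuous_onI continuous_intros)

lemma L2_integrable:
  fixes f :: "real^'n \<Rightarrow> real"
  assumes "L2 S f" "bounded S" "S \<in> sets borel"
  shows "integrable (lebesgue_on S) f"
  using L2_inner_integrable[OF assms(1) L2_continuous[OF continuous_on_const[of _ 1] assms(2,3)]] by simp

section \<open>Polynomials on a plane, and geometry near facets and the boundary\<close>

context flat_set
begin

text \<open>The integrand is nonnegative, so \<open>p \<circ> pr\<close> vanishes almost everywhere
  on an open part of the prism. Being a polynomial, it vanishes on the whole space, and on the plane
  \<open>pr\<close> is the identity.\<close>

lemma polynomial_eq_0_on_plane:
  assumes p: "p \<in> Pol m" and b: "continuous_on UNIV b" "\<And>x. 0 \<le> b x" "\<And>x. x \<in> U \<Longrightarrow> b x \<noteq> 0"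
    and U: "open U" "x0 \<in> U" "x0 \<in> rel_interior F"
    and 0: "(LINT x|facet_measure n F. (p x)\<^sup>2 * b x) = 0" and x: "n \<bullet> x = c"
  shows "p x = 0"
proof -
  have [measurable]: "p \<in> borel_measurable borel" "b \<in> borel_measurable borel"
    using borel_measurable_Pol[OF p] b(1) by (auto intro: borel_measurable_continuous_onI)
  obtain W where W: "open W" "rel_interior F = affine hull F \<inter> W"
    using openin_rel_interior[of F] by (auto simp: openin_open)
  \<comment> \<open>V is the open part of the prism that projects into U and into the relative
    interior of F. The point at half height above x0 shows that it is nonempty.\<close>
  define V where "V = {z. 0 < n \<bullet> z - c} \<inter> {z. n \<bullet> z - c < 1} \<inter> pr -` (U \<inter> W)"
  have "open V"
    unfolding V_def using U W
    by (intro open_Int open_Collect_less continuous_intros open_vimage continuous_pr)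
  have "x0 \<in> affine hull F" using U W by auto
  then have nx0: "n \<bullet> x0 = c" by (simp add: hull_F)
  have "pr (x0 + (1/2) *\<^sub>R n) = x0"
    using nx0 by (simp add: pr_def inner_simps nn)
  then have "x0 + (1/2) *\<^sub>R n \<in> V"
    using U W nx0 by (simp add: V_def inner_simps nn)
  have Vp: "z \<in> prism" if "z \<in> V" for z
  proof -
    have "pr z \<in> affine hull F" by (simp add: hull_F pr_plane)
    then have "pr z \<in> rel_interior F" using that W by (auto simp: V_def)
    then show ?thesis
      using that rel_interior_subset by (auto simp: prism_def V_def)
  qed
  have cont: "continuous_on UNIV (\<lambda>x. (p x)\<^sup>2 * b x)"
    by (intro continuous_intros continuous_on_Pol[OF p] b)
  have "integrable lborel (\<lambda>z. indicator prism z * ((p (pr z))\<^sup>2 * b (pr z)))"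
    by (rule integrable_prism[OF cont])
  then have "AE z in lborel. indicator prism z * ((p (pr z))\<^sup>2 * b (pr z)) = 0"
    using integral_nonneg_eq_0_iff_AE[of lborel "\<lambda>z. indicator prism z * ((p (pr z))\<^sup>2 * b (pr z))"] 0 b(2)
    by (simp add: integral_facet_measure_prism)
  then have "AE z in lebesgue. indicator prism z * ((p (pr z))\<^sup>2 * b (pr z)) = 0"
    by (rule AE_completion)
  then have ae: "AE z in lebesgue_on V. p (pr z) = 0"
  proof (subst AE_restrict_space_iff)
    assume "AE z in lebesgue. indicator prism z * ((p (pr z))\<^sup>2 * b (pr z)) = 0"
    then show "AE z in lebesgue. z \<in> V \<longrightarrow> p (pr z) = 0"
    proof eventually_elim
      case (elim z)
      have "b (pr z) \<noteq> 0" if "z \<in> V" using that by (auto simp: V_def b(3))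
      then show ?case using elim Vp[of z] by auto
    qed
  qed (use \<open>open V\<close> in auto)
  have "polynomial_function pr"
    unfolding pr_def
    by (intro polynomial_function_diff polynomial_function_mult polynomial_function_bounded_linear
        bounded_linear_inner_right polynomial_function_id polynomial_function_const)
  then have "polynomial_function (p \<circ> pr)"
    using real_polynomial_function_Pol[OF p]
    by (intro polynomial_function_compose) (simp_all flip: real_polynomial_function_eq)
  then have "p \<circ> pr = (\<lambda>_. 0)"
    using \<open>open V\<close> \<open>x0 + (1/2) *\<^sub>R n \<in> V\<close> ae
    by (intro polynomial_function_eq_if_AE[where K = V] polynomial_function_const) (auto simp: interior_open)
  then show ?thesis
    using pr_fix[OF x] by (metis comp_apply)
qed

end

text \<open>A convex set that contains a relative neighbourhood of x0 in the plane and a point y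
  below it also contains the points just below x0. It serves to show that two elements on the same
  side of a facet would overlap.\<close>

lemma inward_points_in_convex:
  fixes K :: "'a::euclidean_space set"
  assumes "convex K" "norm n = 1" "n \<bullet> x0 = c" "0 < e" and ball: "ball x0 e \<inter> {x. n \<bullet> x = c} \<subseteq> K"
    and y: "y \<in> K" "n \<bullet> y < c"
  shows "\<forall>\<^sub>F t in at_right 0. x0 - t *\<^sub>R n \<in> K"
proof -
  define d where "d = c - n \<bullet> y"
  have "d > 0" using y by (simp add: d_def)
  have nn: "n \<bullet> n = 1" using \<open>norm n = 1\<close> by (simp flip: norm_eq_1)
  \<comment> \<open>\<open>h t\<close> solves x0 - t n = (1 - t / d) h + (t / d) y. The weight t / d
    is the one that puts h on the plane, because y lies at depth d; as t tends to 0, h tends to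
    x0.\<close>
  define h where "h t = (1 / (1 - t / d)) *\<^sub>R (x0 - t *\<^sub>R n - (t / d) *\<^sub>R y)" for t
  have "(h \<longlongrightarrow> (1 / (1 - 0 / d)) *\<^sub>R (x0 - 0 *\<^sub>R n - (0 / d) *\<^sub>R y)) (at_right 0)"
    unfolding h_def using \<open>d > 0\<close> by (intro tendsto_intros) auto
  then have "\<forall>\<^sub>F t in at_right 0. dist (h t) x0 < e"
    using \<open>0 < e\<close> by (simp add: tendstoD)
  moreover have "\<forall>\<^sub>F t in at_right 0. t < d"
    using eventually_at_right_real[OF \<open>d > 0\<close>] by eventually_elim auto
  moreover have "\<forall>\<^sub>F t in at_right (0::real). 0 < t"
    by (rule eventually_at_right_less)
  ultimately show ?thesis
  proof eventually_elim
    case (elim t)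
    have td: "0 < t / d" "t / d < 1" using elim \<open>d > 0\<close> by auto
    have eq: "n \<bullet> (x0 - t *\<^sub>R n - (t / d) *\<^sub>R y) = (1 - t / d) * c"
      using \<open>d > 0\<close> assms(3) nn by (simp add: inner_simps d_def field_simps)
    have *: "1 / r * (r * c) = c" if "r \<noteq> 0" for r using that by simp
    have "n \<bullet> h t = c"
      unfolding h_def inner_scaleR_right eq by (rule *) (use td(2) in linarith)
    then have "h t \<in> K"
      using ball elim by (auto simp: dist_commute)
    then have "(1 - t / d) *\<^sub>R h t + (t / d) *\<^sub>R y \<in> K"
      using \<open>convex K\<close> y td by (intro convexD_alt[of K "h t" y, simplified]) auto
    moreover have "(1 - t / d) *\<^sub>R h t + (t / d) *\<^sub>R y = x0 - t *\<^sub>R n"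
    proof -
      have "r *\<^sub>R (1 / r) *\<^sub>R w = w" if "r \<noteq> 0" for r and w :: 'a using that by simp
      moreover have "1 - t / d \<noteq> 0" using td(2) by linarith
      ultimately show ?thesis unfolding h_def by (metis diff_add_cancel)
    qed
    ultimately show ?case by simp
  qed
qed

text \<open>A Lipschitz boundary has no slits. From a boundary point p in the interior of the
  closure, p + t e with small t > 0 would still be in the closure, although it lies strictly above
  the graph, where a neighbourhood misses the domain.\<close>

lemma interior_closure_lipschitz_boundary:
  fixes \<Omega> :: "(real^'n) set"
  assumes "open \<Omega>" "lipschitz_boundary \<Omega>"
  shows "interior (closure \<Omega>) \<subseteq> \<Omega>"
proof
  fix p assume p: "p \<in> interior (closure \<Omega>)"
  show "p \<in> \<Omega>"
  proof (rule ccontr)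
    assume "p \<notin> \<Omega>"
    moreover have "p \<in> closure \<Omega>" using p interior_subset by auto
    ultimately have "p \<in> frontier \<Omega>"
      using \<open>open \<Omega>\<close> by (simp add: frontier_def interior_open)
    from bspec[OF assms(2)[unfolded lipschitz_boundary_def] this] obtain U e L \<zeta> where
      "open U \<and> p \<in> U \<and> norm e = 1 \<and> L-lipschitz_on {y. y \<bullet> e = 0} \<zeta> \<and>
       \<Omega> \<inter> U = {x \<in> U. x \<bullet> e < \<zeta> (x - (x \<bullet> e) *\<^sub>R e)}"
      by (elim exE)
    then have U: "open U" "p \<in> U" "norm e = 1" "L-lipschitz_on {y. y \<bullet> e = 0} \<zeta>"
      "\<Omega> \<inter> U = {x \<in> U. x \<bullet> e < \<zeta> (x - (x \<bullet> e) *\<^sub>R e)}"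
      by simp_all
    have ee: "e \<bullet> e = 1" using U by (simp flip: norm_eq_1)
    define G where "G x = x \<bullet> e - \<zeta> (x - (x \<bullet> e) *\<^sub>R e)" for x
    have "continuous_on UNIV G"
      unfolding G_def
      by (intro continuous_intros continuous_on_compose2[OF lipschitz_on_continuous_on[OF U(4)]])
        (auto simp: inner_simps ee)
    have "G p \<ge> 0"
    proof (rule ccontr)
      assume "\<not> 0 \<le> G p"
      then have "p \<in> \<Omega> \<inter> U" unfolding U(5) using U(2) by (simp add: G_def)
      then show False using \<open>p \<notin> \<Omega>\<close> by simp
    qed
    have "((\<lambda>t. p + t *\<^sub>R e) \<longlongrightarrow> p + 0 *\<^sub>R e) (at_right 0)"
      by (intro tendsto_intros)
    then have lim: "((\<lambda>t. p + t *\<^sub>R e) \<longlongrightarrow> p) (at_right 0)" by simp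
    have "\<forall>\<^sub>F t in at_right 0. p + t *\<^sub>R e \<in> U \<inter> interior (closure \<Omega>)"
      using topological_tendstoD[OF lim, of "U \<inter> interior (closure \<Omega>)"] U p by auto
    moreover have "\<forall>\<^sub>F t in at_right (0::real). 0 < t"
      by (rule eventually_at_right_less)
    ultimately have "\<forall>\<^sub>F t in at_right 0. 0 < t \<and> p + t *\<^sub>R e \<in> U \<inter> interior (closure \<Omega>)"
      by eventually_elim auto
    then obtain t :: real where t: "0 < t" "p + t *\<^sub>R e \<in> U" "p + t *\<^sub>R e \<in> closure \<Omega>"
      using eventually_happens[of _ "at_right (0::real)"] interior_subset trivial_limit_at_right_real by blast
    have "G (p + t *\<^sub>R e) = t + G p"
      by (simp add: G_def inner_simps ee algebra_simps)
    then have "G (p + t *\<^sub>R e) > 0" using \<open>G p \<ge> 0\<close> t by simp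
    have "open (U \<inter> G -` {0<..})"
      using U(1) \<open>continuous_on UNIV G\<close> by (intro open_Int open_vimage) auto
    moreover have "p + t *\<^sub>R e \<in> (U \<inter> G -` {0<..}) \<inter> closure \<Omega>"
      using t \<open>G (p + t *\<^sub>R e) > 0\<close> by simp
    ultimately obtain y where y: "y \<in> U \<inter> G -` {0<..}" "y \<in> \<Omega>"
      using open_Int_closure_eq_empty by blast
    then have "y \<in> \<Omega> \<inter> U" by simp
    then show False
      unfolding U(5) using y(1) by (simp add: G_def)
  qed
qed

section \<open>Elements of a mesh and integrals over the domain\<close>

locale mesh =
  fixes M :: "'n::finite dg_mesh"
  assumes wf: "wf_mesh M"
begin

lemma dom: "open (dom M)" "bounded (dom M)" "lipschitz_boundary (dom M)" "dom M \<in> sets borel"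
  using wf by (auto simp: wf_mesh_def polyhedral_domain_def)

lemma finite_elems: "finite (elems M)" and Union_elems: "\<Union>(elems M) = closure (dom M)"
  using wf by (auto simp: wf_mesh_def triangulation_def)

lemma elem:
  assumes "K \<in> elems M"
  shows "polytope K" "convex K" "compact K" "bounded K" "K \<in> sets borel" "K \<in> sets lebesgue"
    "aff_dim K = int CARD('n)" "interior K \<noteq> {}"
proof -
  have "int CARD('n) simplex K" using wf assms by (auto simp: wf_mesh_def)
  then show "polytope K" "aff_dim K = int CARD('n)"
    by (auto simp: simplex_imp_polytope aff_dim_simplex)
  then show "convex K" "compact K" "bounded K" "interior K \<noteq> {}"
    using polytope_imp_convex polytope_imp_compact polytope_imp_bounded full_dim_interior_nonempty by auto
  show "K \<in> sets borel" using \<open>compact K\<close> by (intro borel_closed compact_imp_closed)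
  then show "K \<in> sets lebesgue" by auto
qed

lemma elems_Int_face: "K \<in> elems M \<Longrightarrow> K' \<in> elems M \<Longrightarrow> K \<inter> K' face_of K"
  using wf by (auto simp: wf_mesh_def triangulation_def)

lemma elems_Int_aff_dim:
  assumes K: "K \<in> elems M" "K' \<in> elems M" "K \<noteq> K'"
  shows "aff_dim (K \<inter> K') < int CARD('n)"
proof (cases "K \<inter> K' = K")
  case False
  then show ?thesis
    using face_of_aff_dim_lt[OF elem(2)[OF K(1)] elems_Int_face[OF K(1,2)]] elem(7)[OF K(1)] by simp
next
  case True
  then have "K \<inter> K' \<noteq> K'" using K by auto
  then show ?thesis
    using face_of_aff_dim_lt[OF elem(2)[OF K(2)] elems_Int_face[OF K(2,1)]] elem(7)[OF K(2)]
    by (simp add: Int_commute)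
qed

lemma negligible_elems_Int:
  assumes "K \<in> elems M" "K' \<in> elems M" "K \<noteq> K'"
  shows "negligible (K \<inter> K')"
proof (rule negligible_convex_interior[THEN iffD2])
  show "convex (K \<inter> K')" using assms elem(2) by (intro convex_Int)
  show "interior (K \<inter> K') = {}"
    using elems_Int_aff_dim[OF assms] low_dim_interior[of "K \<inter> K'"] by simp
qed

lemma AE_elem_not_other:
  assumes "K \<in> elems M" "K' \<in> elems M" "K \<noteq> K'"
  shows "AE x in lebesgue_on K'. x \<notin> K"
proof -
  have "K \<inter> K' \<in> null_sets lebesgue"
    using negligible_elems_Int[OF assms] by (simp add: negligible_iff_null_sets)
  then have "AE x in lebesgue. x \<notin> K \<inter> K'" by (rule AE_not_in)
  then show ?thesis
    using elem(6)[OF assms(2)] by (subst AE_restrict_space_iff) (auto elim!: eventually_mono)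
qed

lemma interior_elem: "K \<in> elems M \<Longrightarrow> interior K \<subseteq> dom M"
  using interior_mono[of K "closure (dom M)"] Union_elems interior_closure_lipschitz_boundary[OF dom(1,3)] by blast

text \<open>Interiors of elements lie in the domain, so its frontier is covered by the frontiers of
  finitely many convex sets.\<close>

lemma negligible_frontier_dom: "negligible (frontier (dom M))"
proof (rule negligible_subset)
  show "negligible (\<Union>K\<in>elems M. frontier K)"
    using finite_elems elem(2) by (intro negligible_Union) (auto intro: negligible_convex_frontier)
  show "frontier (dom M) \<subseteq> (\<Union>K\<in>elems M. frontier K)"
  proof
    fix x assume x: "x \<in> frontier (dom M)"
    then have "x \<in> \<Union>(elems M)" "x \<notin> dom M"
      using dom(1) by (auto simp: Union_elems frontier_def interior_open)
    then obtain K where K: "K \<in> elems M" "x \<in> K" by auto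
    moreover have "x \<notin> interior K" using interior_elem[OF K(1)] \<open>x \<notin> dom M\<close> by auto
    ultimately show "x \<in> (\<Union>K\<in>elems M. frontier K)"
      using closure_subset by (auto simp: frontier_def)
  qed
qed

text \<open>The elements cover the closure of the domain and overlap in null sets. The passage from
  the domain to its closure costs only the frontier, which is null as well.\<close>

lemma integral_dom:
  fixes f :: "real^'n \<Rightarrow> real"
  assumes f: "integrable (lebesgue_on (dom M)) f"
  shows "(LINT x|lebesgue_on (dom M). f x) = (\<Sum>K\<in>elems M. LINT x|lebesgue_on K. f x)"
    and "K \<in> elems M \<Longrightarrow> integrable (lebesgue_on K) f"
proof -
  have ds: "dom M \<in> sets lebesgue" using dom(4) by simp
  have "negligible (closure (dom M) - dom M)"
    using negligible_frontier_dom dom(1) by (simp add: frontier_def interior_open)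
  then have neg: "negligible {x \<in> dom M - closure (dom M). f x \<noteq> 0}" "negligible {x \<in> closure (dom M) - dom M. f x \<noteq> 0}"
    using closure_subset[of "dom M"] by (auto intro: negligible_subset)
  have "f absolutely_integrable_on (dom M)"
    using f ds by (simp add: absolutely_integrable_on_def integrable_restrict_space set_integrable_def)
  then have cl: "f absolutely_integrable_on (closure (dom M))"
    using absolutely_integrable_spike_set[OF _ neg] by blast
  have K: "f absolutely_integrable_on K" if "K \<in> elems M" for K
    by (rule set_integrable_subset[OF cl]) (use that Union_elems elem in auto)
  have intK: "integrable (lebesgue_on K) f" if "K \<in> elems M" for K
    using K[OF that] elem(6)[OF that] by (simp add: integrable_restrict_space set_integrable_def)
  then show "K \<in> elems M \<Longrightarrow> integrable (lebesgue_on K) f" .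
  have iK: "(LINT x|lebesgue_on K. f x) = integral K f" if "K \<in> elems M" for K
    using that elem(6) intK by (intro lebesgue_integral_eq_integral) auto
  have "(f has_integral (\<Sum>K\<in>elems M. integral K f)) (\<Union>(elems M))"
    using K negligible_elems_Int
    by (intro has_integral_Union finite_elems)
      (auto simp: pairwise_def intro!: integrable_integral set_lebesgue_integral_eq_integral(1))
  then have "integral (closure (dom M)) f = (\<Sum>K\<in>elems M. integral K f)"
    by (simp add: Union_elems integral_unique)
  moreover have "integral (dom M) f = integral (closure (dom M)) f"
    using neg by (intro integral_spike_set)
  ultimately show "(LINT x|lebesgue_on (dom M). f x) = (\<Sum>K\<in>elems M. LINT x|lebesgue_on K. f x)"
    using lebesgue_integral_eq_integral[OF f ds] iK by simp
qed

section \<open>Facets and their adjacent elements\<close>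

lemma finite_facets: "finite (facets M)"
proof -
  have "facets M = (\<Union>K\<in>elems M. facets_of K)"
    by (auto simp: facets_def facets_of_def)
  then show ?thesis
    using finite_elems elem(1) finite_facets_of by auto
qed

lemma facets_ofD: "K \<in> elems M \<Longrightarrow> F \<in> facets_of K \<Longrightarrow> F \<in> facets M"
  by (auto simp: facets_def facets_of_def)

lemma facets_sub: "facets_I M \<subseteq> facets M" "facets_N M \<subseteq> facets M"
  by (auto simp: facets_I_def facets_N_def)

lemma facet_nonempty:
  assumes "F \<in> facets M" shows "rel_interior F \<noteq> {}"
proof -
  obtain K where K: "K \<in> elems M" "F facet_of K" using assms by (auto simp: facets_def)
  then have "F face_of K" "F \<noteq> {}" by (auto simp: facet_of_def)
  then show ?thesis
    using rel_interior_eq_empty[of F] face_of_imp_convex elem(2) K by auto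
qed

lemma interior_facet_elems:
  assumes "F \<in> facets_I M"
  shows "{K \<in> elems M. F \<in> facets_of K} = {Kminus M F, Kplus M F}" "Kminus M F \<noteq> Kplus M F"
  using wf assms by (auto simp: wf_mesh_def facets_of_def)

lemma boundary_facet_elems:
  assumes "F \<in> facets M" "F \<notin> facets_I M"
  shows "{K \<in> elems M. F \<in> facets_of K} = {Kminus M F}"
  using wf assms by (auto simp: wf_mesh_def facets_of_def)

lemma Kminus:
  assumes "F \<in> facets M"
  shows "Kminus M F \<in> elems M" "F \<in> facets_of (Kminus M F)"
  using interior_facet_elems[of F] boundary_facet_elems[of F] assms by blast+

lemma Kplus:
  assumes "F \<in> facets_I M"
  shows "Kplus M F \<in> elems M" "F \<in> facets_of (Kplus M F)"
  using interior_facet_elems[OF assms] by blast+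

lemma boundary_facet_outside:
  assumes "F \<in> facets M" "F \<notin> facets_I M"
  shows "rel_interior F \<inter> dom M = {}"
proof -
  have "F \<in> facets_D M \<union> facets_N M" using wf assms by (auto simp: wf_mesh_def)
  then have "rel_interior F \<subseteq> gam_D M \<union> gam_N M" by (auto simp: facets_D_def facets_N_def)
  also have "\<dots> \<subseteq> frontier (dom M)"
    using wf closure_subset[of "gam_D M"] closure_subset[of "gam_N M"] by (auto simp: wf_mesh_def)
  finally show ?thesis using dom(1) by (auto simp: frontier_def interior_open)
qed

lemma facets_I_N_disjoint: "facets_I M \<inter> facets_N M = {}"
proof -
  have False if "F \<in> facets_I M" "F \<in> facets_N M" for F
  proof -
    have "rel_interior F \<subseteq> dom M \<inter> gam_N M" using that by (auto simp: facets_I_def facets_N_def)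
    moreover have "gam_N M \<subseteq> frontier (dom M)"
      using wf closure_subset[of "gam_N M"] by (auto simp: wf_mesh_def)
    ultimately have "rel_interior F = {}" using dom(1) by (auto simp: frontier_def interior_open)
    then show False using facet_nonempty that by (auto simp: facets_I_def)
  qed
  then show ?thesis by blast
qed

lemma facet_plane:
  assumes "F \<in> facets M"
  obtains c where "flat_set F (normal M F) c"
proof -
  have "outward_unit_normal (Kminus M F) F (normal M F)" using wf assms by (auto simp: wf_mesh_def)
  then show thesis
    using outward_unit_normal_facet[of "Kminus M F" F "normal M F"] Kminus[OF assms] elem that
    by (metis facets_of_def mem_Collect_eq)
qed

text \<open>Elements meet in common faces, so the intersection of two facets is a face of each. If
  it is all of F, then F is a proper face of F', which contradicts the equal dimensions; otherwise a
  proper face avoids the relative interior. This allows test functions to be localised at a single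
  facet.\<close>

lemma facets_disjoint:
  assumes "F \<in> facets M" "F' \<in> facets M" "F \<noteq> F'"
  shows "rel_interior F \<inter> F' = {}"
proof -
  have face: "F \<inter> F' face_of F" if FF: "F \<in> facets M" "F' \<in> facets M" for F F'
  proof -
    obtain K K' where K: "K \<in> elems M" "F facet_of K" "K' \<in> elems M" "F' facet_of K'"
      using FF unfolding facets_def by blast
    let ?D = "K \<inter> K'"
    have D: "?D face_of K" "?D face_of K'"
      using elems_Int_face[of K K'] elems_Int_face[of K' K] K by (auto simp: Int_commute)
    have F: "F face_of K" "F' face_of K'" using K facet_of_imp_face_of by auto
    have "F \<inter> ?D face_of ?D"
      using face_of_Int[OF F(1) D(1)] by (rule face_of_subset) auto
    moreover have "F' \<inter> ?D face_of ?D"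
      using face_of_Int[OF F(2) D(2)] by (rule face_of_subset) auto
    ultimately have "(F \<inter> ?D) \<inter> (F' \<inter> ?D) face_of ?D" by (rule face_of_Int)
    moreover have "(F \<inter> ?D) \<inter> (F' \<inter> ?D) = F \<inter> F'"
      using F face_of_imp_subset by blast
    ultimately have "F \<inter> F' face_of K" using face_of_trans D(1) by auto
    then show ?thesis
      using F(1) face_of_imp_subset by (elim face_of_subset) auto
  qed
  have dim: "aff_dim F = int CARD('n) - 1" "convex F" if "F \<in> facets M" for F
    using that elem(2,7) by (auto simp: facets_def facet_of_def intro: face_of_imp_convex)
  show ?thesis
  proof (cases "F \<inter> F' = F")
    case True
    then have "F face_of F'" using face[of F' F] assms by (simp add: Int_commute)
    from face_of_aff_dim_lt[OF dim(2)[OF assms(2)] this assms(3)] show ?thesis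
      by (simp add: dim(1) assms)
  next
    case False
    then show ?thesis
      using face_of_disjoint_rel_interior[OF face[OF assms(1,2)]] rel_interior_subset by blast
  qed
qed

lemma outward_normal_Kminus: "F \<in> facets M \<Longrightarrow> outward_unit_normal (Kminus M F) F (normal M F)"
  using wf by (auto simp: wf_mesh_def)

text \<open>The mesh fixes the normal with respect to \<open>Kminus\<close> only. If
  \<open>Kplus\<close> had a point below the plane of F, both elements would contain points just
  below x0. Then F would be a proper face of their intersection, which would have full
  dimension.\<close>

lemma outward_normal_Kplus:
  assumes F: "F \<in> facets_I M"
  shows "outward_unit_normal (Kplus M F) F (- normal M F)"
proof -
  let ?n = "normal M F" and ?K = "Kplus M F" and ?L = "Kminus M F"
  have FM: "F \<in> facets M" using F facets_sub by auto
  note L = Kminus[OF FM] and K = Kplus[OF F]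
  obtain c where c: "flat_set F ?n c" "?L \<subseteq> {x. ?n \<bullet> x \<le> c}" "F = ?L \<inter> {x. ?n \<bullet> x = c}" "interior ?L \<subseteq> {x. ?n \<bullet> x < c}"
    using outward_unit_normal_facet[OF outward_normal_Kminus[OF FM]] L elem(1,7)[OF L(1)]
    by (metis facets_of_def mem_Collect_eq)
  interpret flat_set F ?n c by fact
  have KF: "F face_of ?K" "aff_dim F = int CARD('n) - 1" using K elem(7)[OF K(1)] by (auto simp: facets_of_def facet_of_def)
  have LF: "F face_of ?L" using L by (auto simp: facets_of_def facet_of_def)
  have F_eq: "F = ?K \<inter> {x. ?n \<bullet> x = c}"
    using face_of_imp_eq_affine_Int[OF elem(2)[OF K(1)] KF(1)] hull_F by auto
  obtain x0 where x0: "x0 \<in> rel_interior F" using facet_nonempty[OF FM] by auto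
  then obtain e where e: "e > 0" "ball x0 e \<inter> {x. ?n \<bullet> x = c} \<subseteq> F" and "x0 \<in> F"
    by (auto simp: mem_rel_interior_ball hull_F)
  have x0c: "?n \<bullet> x0 = c" using F_plane \<open>x0 \<in> F\<close> by auto
  have not_below: "c \<le> ?n \<bullet> y" if "y \<in> ?K" for y
  proof (rule ccontr)
    assume y: "\<not> c \<le> ?n \<bullet> y"
    obtain z where z: "z \<in> interior ?L" using elem(8)[OF L(1)] by auto
    have 1: "\<forall>\<^sub>F t in at_right 0. x0 - t *\<^sub>R ?n \<in> ?K"
      using y that F_eq e by (intro inward_points_in_convex[OF elem(2)[OF K(1)] norm_n x0c e(1)]) auto
    have 2: "\<forall>\<^sub>F t in at_right 0. x0 - t *\<^sub>R ?n \<in> ?L"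
      using z c interior_subset[of ?L] e by (intro inward_points_in_convex[OF elem(2)[OF L(1)] norm_n x0c e(1)]) auto
    have "\<forall>\<^sub>F t in at_right (0::real). x0 - t *\<^sub>R ?n \<in> ?K \<inter> ?L \<and> 0 < t"
      using 1 2 eventually_at_right_less[of 0] by eventually_elim auto
    then obtain t :: real where t: "x0 - t *\<^sub>R ?n \<in> ?L \<inter> ?K" "0 < t"
      using eventually_happens[of _ "at_right (0::real)"] trivial_limit_at_right_real by blast
    have "F face_of ?L \<inter> ?K"
      using LF F_eq c(3) by (elim face_of_subset) auto
    moreover have "F \<noteq> ?L \<inter> ?K"
    proof
      assume "F = ?L \<inter> ?K"
      then have "x0 - t *\<^sub>R ?n \<in> F" using t by auto
      then have "?n \<bullet> (x0 - t *\<^sub>R ?n) = c" by (rule F_plane)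
      then show False using x0c nn t by (simp add: inner_simps)
    qed
    ultimately have "aff_dim F < aff_dim (?L \<inter> ?K)"
      using elem(2) K L by (intro face_of_aff_dim_lt convex_Int) auto
    then show False
      using elems_Int_aff_dim[OF L(1) K(1) interior_facet_elems(2)[OF F]] KF(2) by simp
  qed
  show ?thesis
    unfolding outward_unit_normal_def
    using norm_n not_below F_plane by (auto simp: inner_simps)
qed

end

section \<open>Weak divergence and normal traces\<close>

context mesh
begin

text \<open>The sign that turns the fixed normal of F into the outward normal of K. The value 0 for
  other facets lets sums over the facets of K run over the whole mesh; \<open>Kplus\<close> is
  consulted on interior facets only, since it has no meaning elsewhere.\<close>

definition orient :: "(real^'n) set \<Rightarrow> (real^'n) set \<Rightarrow> real" where
  "orient K F = (if K = Kminus M F then 1 else if F \<in> facets_I M \<and> K = Kplus M F then - 1 else 0)"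

abbreviation flux_moment :: "(real^'n \<Rightarrow> real^'n) \<Rightarrow> (real^'n \<Rightarrow> real) \<Rightarrow> (real^'n) set \<Rightarrow> real" where
  "flux_moment \<rho> \<phi> F \<equiv> facet_integral M F (\<lambda>x. (\<rho> x \<bullet> normal M F) * \<phi> x)"

lemma facets_of_eq: "K \<in> elems M \<Longrightarrow> facets_of K = {F \<in> facets M. F \<in> facets_of K}"
  using facets_ofD by auto

lemma orient_cases:
  assumes "K \<in> elems M" "F \<in> facets_of K"
  shows "(K = Kminus M F \<and> orient K F = 1) \<or> (F \<in> facets_I M \<and> K = Kplus M F \<and> K \<noteq> Kminus M F \<and> orient K F = - 1)"
proof (cases "F \<in> facets_I M")
  case True
  then have "K \<in> {Kminus M F, Kplus M F}" using interior_facet_elems(1)[OF True] assms by blast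
  then show ?thesis using True by (auto simp: orient_def)
next
  case False
  then have "K \<in> {Kminus M F}" using boundary_facet_elems[OF facets_ofD[OF assms] False] assms by blast
  then show ?thesis by (auto simp: orient_def)
qed

lemma orient_eq_0:
  assumes "F \<in> facets M" "F \<notin> facets_of K"
  shows "orient K F = 0"
  using Kminus[OF assms(1)] Kplus[of F] assms(2) by (auto simp: orient_def)

lemma sum_facets_of_elems:
  "(\<Sum>K\<in>elems M. \<Sum>F\<in>facets_of K. orient K F * X K F) =
   (\<Sum>F\<in>facets M. if F \<in> facets_I M then X (Kminus M F) F - X (Kplus M F) F else X (Kminus M F) F)"
proof -
  have "(\<Sum>K\<in>elems M. \<Sum>F\<in>facets_of K. orient K F * X K F) =
     (\<Sum>K\<in>elems M. \<Sum>F\<in>{F \<in> facets M. F \<in> facets_of K}. orient K F * X K F)"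
    by (intro sum.cong refl facets_of_eq)
  also have "\<dots> = (\<Sum>F\<in>facets M. \<Sum>K\<in>{K \<in> elems M. F \<in> facets_of K}. orient K F * X K F)"
    by (rule sum.swap_restrict[OF finite_elems finite_facets])
  also have "\<dots> = (\<Sum>F\<in>facets M. if F \<in> facets_I M then X (Kminus M F) F - X (Kplus M F) F else X (Kminus M F) F)"
  proof (rule sum.cong[OF refl])
    fix F assume F: "F \<in> facets M"
    show "(\<Sum>K\<in>{K \<in> elems M. F \<in> facets_of K}. orient K F * X K F) =
      (if F \<in> facets_I M then X (Kminus M F) F - X (Kplus M F) F else X (Kminus M F) F)"
    proof (cases "F \<in> facets_I M")
      case True
      show ?thesis
        unfolding interior_facet_elems(1)[OF True] using interior_facet_elems(2)[OF True] True
        by (simp add: orient_def)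
    next
      case False
      show ?thesis
        unfolding boundary_facet_elems[OF F False] using False by (simp add: orient_def)
    qed
  qed
  finally show ?thesis .
qed

lemma facet_integrable:
  fixes f :: "real^'n \<Rightarrow> real"
  assumes "F \<in> facets M" "continuous_on UNIV f"
  shows "integrable (facet_measure (normal M F) F) f"
proof -
  obtain c where "flat_set F (normal M F) c" using facet_plane[OF assms(1)] .
  then interpret flat_set F "normal M F" c .
  show ?thesis by (rule integrable_facet_measure[OF assms(2)])
qed

lemma facet_integral_cong:
  assumes F: "F \<in> facets M" and fg: "f \<in> borel_measurable borel" "g \<in> borel_measurable borel"
    and eq: "\<And>x. x \<in> rel_interior F \<Longrightarrow> f x = g x"
  shows "facet_integral M F f = facet_integral M F g"
proof -
  obtain c where "flat_set F (normal M F) c" using facet_plane[OF F] .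
  then interpret flat_set F "normal M F" c .
  show ?thesis
    unfolding facet_integral_def
  proof (rule integral_cong_AE)
    show "AE x in facet_measure (normal M F) F. f x = g x"
      using AE_rel_interior by eventually_elim (rule eq)
  qed (use fg borel_measurable_facet_measure in auto)
qed

text \<open>The scalar theorem is applied to \<rho>_i \<phi> in coordinate direction i and summed
  over i. The outward normal of K on F is \<open>orient K F *\<^sub>R normal M F\<close>, and
  reversing a normal leaves the facet integral unchanged.\<close>

lemma elem_divergence_theorem:
  assumes K: "K \<in> elems M" and \<rho>: "\<rho> \<in> RT_elem m"
    and \<phi>: "\<And>x. (\<phi> has_derivative (\<lambda>v. g x \<bullet> v)) (at x)" and g: "continuous_on UNIV g"
  shows "(LINT x|lebesgue_on K. divergence \<rho> x * \<phi> x + \<rho> x \<bullet> g x) =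
    (\<Sum>F\<in>facets_of K. orient K F * flux_moment \<rho> \<phi> F)"
proof -
  define \<nu> where "\<nu> F = orient K F *\<^sub>R normal M F" for F
  have c\<phi>: "continuous_on UNIV \<phi>"
    using \<phi> by (meson continuous_at_imp_continuous_on has_derivative_continuous)
  have c\<rho>: "continuous_on UNIV (\<lambda>x. \<rho> x $ i)" for i
    by (rule continuous_on_Pol[OF RT_elem_component[OF \<rho>]])
  have cg: "continuous_on UNIV (grad (\<lambda>x. \<rho> x $ i))" for i
    by (rule continuous_on_PolV[OF Pol_grad(2)[OF RT_elem_component[OF \<rho>]]])
  have outward: "outward_unit_normal K F (\<nu> F)" if "F facet_of K" for F
    using orient_cases[OF K, of F] that outward_normal_Kminus[of F] outward_normal_Kplus[of F] facets_ofD[OF K, of F]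
    by (auto simp: \<nu>_def facets_of_def)
  have cont: "continuous_on UNIV (\<lambda>x. \<phi> x *\<^sub>R grad (\<lambda>x. \<rho> x $ i) x + \<rho> x $ i *\<^sub>R g x)" for i
    by (intro continuous_intros c\<phi> c\<rho> cg g)
  define h where "h i x = (\<phi> x *\<^sub>R grad (\<lambda>x. \<rho> x $ i) x + \<rho> x $ i *\<^sub>R g x) \<bullet> axis i 1" for i x
  have ch: "continuous_on UNIV (h i)" for i
    unfolding h_def by (intro continuous_intros cont)
  have "divergence \<rho> x * \<phi> x + \<rho> x \<bullet> g x = (\<Sum>i\<in>UNIV. h i x)" for x
    by (simp add: h_def divergence_def inner_vec_def[of "\<rho> x"] inner_axis sum.distrib sum_distrib_left mult.commute)
  then have "(LINT x|lebesgue_on K. divergence \<rho> x * \<phi> x + \<rho> x \<bullet> g x) = (\<Sum>i\<in>UNIV. LINT x|lebesgue_on K. h i x)"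
    using elem[OF K] ch by (simp add: Bochner_Integration.integral_sum integrable_lebesgue_on_continuous)
  also have "\<dots> = (\<Sum>i\<in>UNIV. \<Sum>F\<in>facets_of K. (\<nu> F \<bullet> axis i 1) * (LINT x|facet_measure (\<nu> F) F. \<rho> x $ i * \<phi> x))"
    unfolding h_def
    by (intro sum.cong refl polytope_divergence_theorem[OF elem(1)[OF K] elem(7)[OF K] outward] cont
        divergence_times_has_derivative[OF \<rho> \<phi>])
  also have "\<dots> = (\<Sum>F\<in>facets_of K. \<Sum>i\<in>UNIV. (\<nu> F \<bullet> axis i 1) * (LINT x|facet_measure (\<nu> F) F. \<rho> x $ i * \<phi> x))"
    by (rule sum.swap)
  also have "\<dots> = (\<Sum>F\<in>facets_of K. orient K F * flux_moment \<rho> \<phi> F)"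
  proof (rule sum.cong[OF refl])
    fix F assume F: "F \<in> facets_of K"
    have FM: "F \<in> facets M" by (rule facets_ofD[OF K F])
    obtain c where c: "flat_set F (normal M F) c" using facet_plane[OF FM] .
    have "(LINT x|facet_measure (\<nu> F) F. \<rho> x $ i * \<phi> x) = (LINT x|facet_measure (normal M F) F. \<rho> x $ i * \<phi> x)" for i
    proof -
      have "(\<lambda>x. \<rho> x $ i * \<phi> x) \<in> borel_measurable borel"
        by (intro borel_measurable_continuous_onI continuous_intros c\<phi> c\<rho>)
      from integral_facet_measure_uminus[OF c this] orient_cases[OF K F] show ?thesis
        by (auto simp: \<nu>_def)
    qed
    then have "(\<Sum>i\<in>UNIV. (\<nu> F \<bullet> axis i 1) * (LINT x|facet_measure (\<nu> F) F. \<rho> x $ i * \<phi> x)) =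
       orient K F * (\<Sum>i\<in>UNIV. LINT x|facet_measure (normal M F) F. normal M F $ i * (\<rho> x $ i * \<phi> x))"
      by (simp add: \<nu>_def inner_axis sum_distrib_left mult.assoc)
    also have "(\<Sum>i\<in>UNIV. LINT x|facet_measure (normal M F) F. normal M F $ i * (\<rho> x $ i * \<phi> x)) =
      (LINT x|facet_measure (normal M F) F. (\<Sum>i\<in>UNIV. normal M F $ i * (\<rho> x $ i * \<phi> x)))"
      by (intro Bochner_Integration.integral_sum[symmetric] facet_integrable FM continuous_intros c\<phi> c\<rho>)
    also have "\<dots> = flux_moment \<rho> \<phi> F"
    proof -
      have "(\<Sum>i\<in>UNIV. normal M F $ i * (\<rho> x $ i * \<phi> x)) = (\<rho> x \<bullet> normal M F) * \<phi> x" for x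
        unfolding inner_vec_def sum_distrib_right by (simp add: mult_ac)
      then show ?thesis by (simp only: facet_integral_def)
    qed
    finally show "(\<Sum>i\<in>UNIV. (\<nu> F \<bullet> axis i 1) * (LINT x|facet_measure (\<nu> F) F. \<rho> x $ i * \<phi> x)) =
       orient K F * flux_moment \<rho> \<phi> F" .
  qed
  finally show ?thesis .
qed

lemma integral_dom_pieces:
  fixes f :: "real^'n \<Rightarrow> real"
  assumes "integrable (lebesgue_on (dom M)) f"
    and "\<And>K. K \<in> elems M \<Longrightarrow> AE x in lebesgue_on K. f x = h K x"
    and "\<And>K. K \<in> elems M \<Longrightarrow> h K \<in> borel_measurable (lebesgue_on K)"
  shows "(LINT x|lebesgue_on (dom M). f x) = (\<Sum>K\<in>elems M. LINT x|lebesgue_on K. h K x)"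
  unfolding integral_dom(1)[OF assms(1)]
proof (intro sum.cong refl integral_cong_AE)
  show "f \<in> borel_measurable (lebesgue_on K)" if "K \<in> elems M" for K
    using integral_dom(2)[OF assms(1) that] by simp
qed (use assms in auto)

section \<open>Elementwise representatives and the elementwise divergence\<close>

lemma RT_on_elem:
  assumes "\<sigma> \<in> RT M s" "K \<in> elems M"
  shows "on_elem \<sigma> K \<in> RT_elem s" "AE x in lebesgue_on K. \<sigma> x = on_elem \<sigma> K x"
proof -
  obtain \<rho> where \<rho>: "\<rho> \<in> RT_elem s" "AE x in lebesgue_on K. \<sigma> x = \<rho> x"
    using assms by (auto simp: RT_def)
  have "on_elem \<sigma> K = \<rho>"
    using \<rho> by (intro on_elem_eq elem[OF assms(2)] polynomial_function_PolV[OF RT_elem_PolV])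
  then show "on_elem \<sigma> K \<in> RT_elem s" "AE x in lebesgue_on K. \<sigma> x = on_elem \<sigma> K x"
    using \<rho> by auto
qed

text \<open>On common faces the contributions of several elements add up, which happens on a null
  set only.\<close>

definition piecewise :: "((real^'n) set \<Rightarrow> real^'n \<Rightarrow> real) \<Rightarrow> real^'n \<Rightarrow> real" where
  "piecewise p x = (\<Sum>K\<in>elems M. indicator K x * p K x)"

lemma AE_piecewise:
  assumes "K \<in> elems M"
  shows "AE x in lebesgue_on K. piecewise p x = p K x"
proof -
  have "AE x in lebesgue_on K. \<forall>L\<in>elems M - {K}. x \<notin> L"
    using finite_elems assms by (intro AE_finite_allI AE_elem_not_other) auto
  moreover have "AE x in lebesgue_on K. x \<in> K"
    by (rule AE_I2) (simp add: space_restrict_space)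
  ultimately show ?thesis
  proof eventually_elim
    case (elim x)
    have "piecewise p x = indicator K x * p K x + (\<Sum>L\<in>elems M - {K}. indicator L x * p L x)"
      unfolding piecewise_def using finite_elems assms by (rule sum.remove)
    also have "(\<Sum>L\<in>elems M - {K}. indicator L x * p L x) = 0"
      using elim by (intro sum.neutral) auto
    finally show ?case using elim by simp
  qed
qed

lemma L2_indicator_Pol:
  assumes "p \<in> Pol m" "K \<in> elems M"
  shows "L2 (dom M) (\<lambda>x. indicator K x * p x)"
proof (rule L2_bound)
  show "L2 (dom M) p"
    by (intro L2_continuous continuous_on_Pol[OF assms(1)] dom)
  have [measurable]: "K \<in> sets borel" "p \<in> borel_measurable borel"
    using elem[OF assms(2)] borel_measurable_Pol[OF assms(1)] by auto
  show "(\<lambda>x. indicator K x * p x) \<in> borel_measurable (lebesgue_on (dom M))"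
    by (rule borel_measurable_lebesgue_on) measurable
qed (auto simp: indicator_def)

lemma piecewise_DG:
  assumes "\<And>K. K \<in> elems M \<Longrightarrow> p K \<in> Pol m"
  shows "piecewise p \<in> DG M m"
proof -
  have "L2 (dom M) (\<lambda>x. \<Sum>K\<in>I. indicator K x * p K x)" if "finite I" "I \<subseteq> elems M" for I
    using that
  proof (induction I rule: finite_induct)
    case empty
    show ?case by (simp add: L2_def)
  next
    case (insert K I)
    then have "L2 (dom M) (\<lambda>x. indicator K x * p K x + (\<Sum>K\<in>I. indicator K x * p K x))"
      using assms by (intro L2_add L2_indicator_Pol) auto
    then show ?case by (simp only: sum.insert[OF insert(1,2)])
  qed
  then have "L2 (dom M) (piecewise p)"
    unfolding piecewise_def[abs_def] using finite_elems by blast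
  then show ?thesis
    unfolding DG_def using assms AE_piecewise by blast
qed

definition elem_div :: "(real^'n \<Rightarrow> real^'n) \<Rightarrow> real^'n \<Rightarrow> real" where
  "elem_div \<sigma> = piecewise (\<lambda>K. divergence (on_elem \<sigma> K))"

lemma elem_div_DG: "\<sigma> \<in> RT M s \<Longrightarrow> elem_div \<sigma> \<in> DG M s"
  unfolding elem_div_def by (intro piecewise_DG divergence_RT_elem RT_on_elem)

definition normal_jump :: "(real^'n \<Rightarrow> real^'n) \<Rightarrow> (real^'n) set \<Rightarrow> real^'n \<Rightarrow> real" where
  "normal_jump \<sigma> F x = (on_elem \<sigma> (Kminus M F) x - on_elem \<sigma> (Kplus M F) x) \<bullet> normal M F"

lemma normal_jump_Pol:
  assumes "\<sigma> \<in> RT M s" "F \<in> facets_I M"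
  shows "normal_jump \<sigma> F \<in> Pol (s + 1)"
proof -
  have F: "F \<in> facets M" using assms(2) facets_sub by auto
  have "on_elem \<sigma> (Kminus M F) \<in> PolV (s + 1)" "on_elem \<sigma> (Kplus M F) \<in> PolV (s + 1)"
    by (intro RT_elem_PolV RT_on_elem(1)[OF assms(1)] Kminus(1)[OF F] Kplus(1)[OF assms(2)])+
  then have "(\<lambda>x. \<Sum>i\<in>UNIV. normal M F $ i * (on_elem \<sigma> (Kminus M F) x $ i + (- 1) * on_elem \<sigma> (Kplus M F) x $ i)) \<in> Pol (s + 1)"
    by (intro Pol_sum Pol_cmult Pol_add) (auto simp: PolV_def)
  then show ?thesis
    unfolding normal_jump_def[abs_def] inner_vec_def by (simp add: mult.commute)
qed

text \<open>When the divergence theorem is summed over the elements, an interior facet collects the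
  difference of its two traces. Boundary facets drop out because a test function vanishes outside
  the domain, where their relative interiors lie.\<close>

lemma integral_grad_test_function:
  assumes \<sigma>: "\<sigma> \<in> RT M s" and \<phi>: "\<phi> \<in> test_functions (dom M)"
  shows "(LINT x|lebesgue_on (dom M). \<sigma> x \<bullet> grad \<phi> x) =
    - (LINT x|lebesgue_on (dom M). elem_div \<sigma> x * \<phi> x) +
    (\<Sum>F\<in>facets_I M. facet_integral M F (\<lambda>x. normal_jump \<sigma> F x * \<phi> x))"
proof -
  note der = test_function_has_grad(1)[OF \<phi>] and cg = test_function_has_grad(2)[OF \<phi>]
    and c\<phi> = test_function_has_grad(3)[OF \<phi>]
  have L2: "L2 (dom M) \<sigma>" "L2 (dom M) (grad \<phi>)" "L2 (dom M) \<phi>" "L2 (dom M) (elem_div \<sigma>)"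
    using \<sigma> elem_div_DG[OF \<sigma>] L2_continuous[OF cg dom(2,4)] L2_continuous[OF c\<phi> dom(2,4)]
    by (auto simp: RT_def Hdiv_def DG_def)
  let ?\<rho> = "on_elem \<sigma>"
  have \<rho>: "?\<rho> K \<in> RT_elem s" if "K \<in> elems M" for K by (rule RT_on_elem[OF \<sigma> that])
  have c\<rho>: "continuous_on UNIV (?\<rho> K)" "continuous_on UNIV (divergence (?\<rho> K))" if "K \<in> elems M" for K
    using continuous_on_PolV[OF RT_elem_PolV[OF \<rho>[OF that]]] continuous_on_Pol[OF divergence_RT_elem[OF \<rho>[OF that]]]
    by auto
  have 1: "(LINT x|lebesgue_on (dom M). \<sigma> x \<bullet> grad \<phi> x) = (\<Sum>K\<in>elems M. LINT x|lebesgue_on K. ?\<rho> K x \<bullet> grad \<phi> x)"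
  proof (rule integral_dom_pieces[OF L2_inner_integrable[OF L2(1,2)]])
    show "AE x in lebesgue_on K. \<sigma> x \<bullet> grad \<phi> x = ?\<rho> K x \<bullet> grad \<phi> x" if "K \<in> elems M" for K
      using RT_on_elem(2)[OF \<sigma> that] by eventually_elim simp
    show "(\<lambda>x. ?\<rho> K x \<bullet> grad \<phi> x) \<in> borel_measurable (lebesgue_on K)" if "K \<in> elems M" for K
      by (intro borel_measurable_lebesgue_on borel_measurable_continuous_onI continuous_intros c\<rho>[OF that] cg)
  qed
  have 2: "(LINT x|lebesgue_on (dom M). elem_div \<sigma> x * \<phi> x) = (\<Sum>K\<in>elems M. LINT x|lebesgue_on K. divergence (?\<rho> K) x * \<phi> x)"
  proof (rule integral_dom_pieces)
    show "integrable (lebesgue_on (dom M)) (\<lambda>x. elem_div \<sigma> x * \<phi> x)"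
      using L2_inner_integrable[OF L2(4,3)] by simp
    show "AE x in lebesgue_on K. elem_div \<sigma> x * \<phi> x = divergence (?\<rho> K) x * \<phi> x" if "K \<in> elems M" for K
      using AE_piecewise[OF that, of "\<lambda>K. divergence (?\<rho> K)"] unfolding elem_div_def
      by eventually_elim simp
    show "(\<lambda>x. divergence (?\<rho> K) x * \<phi> x) \<in> borel_measurable (lebesgue_on K)" if "K \<in> elems M" for K
      by (intro borel_measurable_lebesgue_on borel_measurable_continuous_onI continuous_intros c\<rho>[OF that] c\<phi>)
  qed
  have "(LINT x|lebesgue_on (dom M). elem_div \<sigma> x * \<phi> x) + (LINT x|lebesgue_on (dom M). \<sigma> x \<bullet> grad \<phi> x) =
      (\<Sum>K\<in>elems M. LINT x|lebesgue_on K. divergence (?\<rho> K) x * \<phi> x + ?\<rho> K x \<bullet> grad \<phi> x)"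
    unfolding 1 2 sum.distrib[symmetric]
  proof (rule sum.cong[OF refl])
    fix K assume K: "K \<in> elems M"
    show "(LINT x|lebesgue_on K. divergence (?\<rho> K) x * \<phi> x) + (LINT x|lebesgue_on K. ?\<rho> K x \<bullet> grad \<phi> x) =
      (LINT x|lebesgue_on K. divergence (?\<rho> K) x * \<phi> x + ?\<rho> K x \<bullet> grad \<phi> x)"
      by (intro Bochner_Integration.integral_add[symmetric] integrable_lebesgue_on_continuous elem(4,5)[OF K]
          continuous_intros c\<rho>[OF K] c\<phi> cg)
  qed
  also have "\<dots> = (\<Sum>K\<in>elems M. \<Sum>F\<in>facets_of K. orient K F * flux_moment (?\<rho> K) \<phi> F)"
    by (intro sum.cong refl elem_divergence_theorem[OF _ \<rho> der cg])
  also have "\<dots> = (\<Sum>F\<in>facets M. if F \<in> facets_I M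
      then flux_moment (?\<rho> (Kminus M F)) \<phi> F - flux_moment (?\<rho> (Kplus M F)) \<phi> F
      else flux_moment (?\<rho> (Kminus M F)) \<phi> F)"
    by (rule sum_facets_of_elems)
  also have "\<dots> = (\<Sum>F\<in>facets M. if F \<in> facets_I M then facet_integral M F (\<lambda>x. normal_jump \<sigma> F x * \<phi> x) else 0)"
  proof (rule sum.cong[OF refl])
    fix F assume F: "F \<in> facets M"
    note Km = Kminus[OF F]
    have int: "integrable (facet_measure (normal M F) F) (\<lambda>x. (?\<rho> K x \<bullet> normal M F) * \<phi> x)" if "K \<in> elems M" for K
      by (intro facet_integrable F continuous_intros c\<rho>[OF that] c\<phi>)
    show "(if F \<in> facets_I M
      then flux_moment (?\<rho> (Kminus M F)) \<phi> F - flux_moment (?\<rho> (Kplus M F)) \<phi> F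
      else flux_moment (?\<rho> (Kminus M F)) \<phi> F) =
      (if F \<in> facets_I M then facet_integral M F (\<lambda>x. normal_jump \<sigma> F x * \<phi> x) else 0)"
    proof (cases "F \<in> facets_I M")
      case True
      show ?thesis
        using True Bochner_Integration.integral_diff[OF int[OF Km(1)] int[OF Kplus(1)[OF True]]]
        by (simp add: facet_integral_def normal_jump_def inner_diff_left left_diff_distrib)
    next
      case False
      have "flux_moment (?\<rho> (Kminus M F)) \<phi> F = facet_integral M F (\<lambda>x. 0)"
      proof (rule facet_integral_cong[OF F])
        show "(\<lambda>x. (?\<rho> (Kminus M F) x \<bullet> normal M F) * \<phi> x) \<in> borel_measurable borel"
          by (intro borel_measurable_continuous_onI continuous_intros c\<rho>[OF Km(1)] c\<phi>)
        show "(?\<rho> (Kminus M F) x \<bullet> normal M F) * \<phi> x = 0" if "x \<in> rel_interior F" for x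
          using boundary_facet_outside[OF F False] test_function_has_grad(4)[OF \<phi>, of x] that by auto
      qed simp
      then show ?thesis using False by (simp add: facet_integral_def)
    qed
  qed
  also have "\<dots> = (\<Sum>F\<in>facets_I M. facet_integral M F (\<lambda>x. normal_jump \<sigma> F x * \<phi> x))"
    using facets_sub(1) by (simp add: sum.If_cases[OF finite_facets] Int_absorb1)
  finally show ?thesis by simp
qed

text \<open>Test functions concentrating on \<open>F\<close> make the volume terms vanish in the limit, so the
  normal jump has to vanish on \<open>F\<close>.\<close>

lemma normal_jump_eq_0:
  assumes \<sigma>: "\<sigma> \<in> RT M s" and F: "F \<in> facets_I M" and y: "y \<in> F"
  shows "normal_jump \<sigma> F y = 0"
proof -
  have FM: "F \<in> facets M" using F facets_sub by auto
  obtain c where c: "flat_set F (normal M F) c" using facet_plane[OF FM] .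
  let ?n = "normal M F"
  interpret flat_set F ?n c by fact
  obtain q where q: "L2 (dom M) q" "has_weak_div (dom M) \<sigma> q"
    using \<sigma> by (auto simp: RT_def Hdiv_def)
  \<comment> \<open>The defect between the elementwise and the given weak divergence. Integration by
    parts equates its integral against a test function with the jump terms. Dominated convergence
    will use that r is integrable and that the test functions are uniformly bounded.\<close>
  define r where "r x = elem_div \<sigma> x - q x" for x
  have "integrable (lebesgue_on (dom M)) (elem_div \<sigma>)" "integrable (lebesgue_on (dom M)) q"
    using elem_div_DG[OF \<sigma>] q by (auto simp: DG_def intro!: L2_integrable dom)
  then have r: "integrable (lebesgue_on (dom M)) r" "integrable (lebesgue_on (dom M)) q"
    unfolding r_def by auto
  obtain x0 where x0: "x0 \<in> rel_interior F" using facet_nonempty[OF FM] by auto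
  \<comment> \<open>Removing all closed facets other than F leaves an open set around x0, so that
    test functions supported there isolate the jump on F.\<close>
  define S where "S = dom M - \<Union>(facets M - {F})"
  have "closed F'" if F': "F' \<in> facets M" for F'
  proof -
    obtain c' where "flat_set F' (normal M F') c'" using facet_plane[OF F'] .
    then show ?thesis by (auto simp: flat_set_def intro: compact_imp_closed)
  qed
  then have "open S"
    unfolding S_def using finite_facets dom(1) by (intro open_Diff closed_Union) auto
  moreover have "x0 \<in> S"
    using x0 F facets_disjoint[OF FM] by (auto simp: S_def facets_I_def)
  ultimately obtain a b where ab: "x0 \<in> box a b" "cbox a b \<subseteq> S"
    by (rule open_contains_cbox)
  define p where "p = normal_jump \<sigma> F"
  have p: "p \<in> Pol (s + 1)" unfolding p_def by (rule normal_jump_Pol[OF \<sigma> F])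
  have lin: "(\<lambda>x. ?n \<bullet> x - c) \<in> Pol 1"
  proof -
    have "(\<lambda>x. (\<Sum>i\<in>UNIV. ?n $ i * x $ i) + (- c)) \<in> Pol 1"
      by (intro Pol_add Pol_sum Pol_cmult Pol_component Pol_const) simp
    then show ?thesis by (simp add: inner_vec_def)
  qed
  \<comment> \<open>\<open>E m\<close> is 1 on the plane of F and the m-th power of a number in (0,
    1) off it. With the factor p in \<open>\<phi>\<close>, the facet term is the integral of p^2
    times the bump for every m, while the volume term tends to 0.\<close>
  define E where "E m x = exp (- real m * ((?n \<bullet> x - c) * (?n \<bullet> x - c)))" for m x
  define \<phi> where "\<phi> m x = bump a b x * (p x * E m x)" for m x
  have CE: "C_diff j (E m)" for j m
    unfolding E_def by (rule C_diff_exp_Pol[OF Pol_cmult[OF Pol_mult[OF lin lin]]])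
  have \<phi>: "\<phi> m \<in> test_functions (dom M)" for m
    unfolding \<phi>_def
    using ab(2) by (intro bump_times_test_function C_diff_mult C_diff_Pol[OF p] CE) (auto simp: S_def)
  have cb: "continuous_on UNIV (bump a b)" using C_diff_bump[of 0 a b] by simp
  have cp: "continuous_on UNIV p" by (rule continuous_on_Pol[OF p])
  have cE: "continuous_on UNIV (E m)" for m using CE[of 0 m] by simp
  have c\<phi>: "continuous_on UNIV (\<phi> m)" for m
    unfolding \<phi>_def by (intro continuous_intros cb cp cE)
  have zero: "\<phi> m x = 0" if "x \<notin> S" for m x
  proof -
    have "x \<notin> box a b" using that ab(2) box_subset_cbox[of a b] by auto
    then have "bump a b x = 0" by (simp add: bump_eq_0_iff)
    then show ?thesis by (simp add: \<phi>_def)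
  qed
  define J where "J = facet_integral M F (\<lambda>x. (p x)\<^sup>2 * bump a b x)"
  have J: "J = (LINT x|lebesgue_on (dom M). r x * \<phi> m x)" for m
  proof -
    have "facet_integral M F' (\<lambda>x. normal_jump \<sigma> F' x * \<phi> m x) = 0" if F': "F' \<in> facets_I M" "F' \<noteq> F" for F'
    proof -
      have F'M: "F' \<in> facets M" using F' facets_sub by auto
      have "facet_integral M F' (\<lambda>x. normal_jump \<sigma> F' x * \<phi> m x) = facet_integral M F' (\<lambda>x. 0)"
      proof (rule facet_integral_cong[OF F'M])
        show "(\<lambda>x. normal_jump \<sigma> F' x * \<phi> m x) \<in> borel_measurable borel"
          by (intro borel_measurable_continuous_onI continuous_intros c\<phi> continuous_on_Pol[OF normal_jump_Pol[OF \<sigma> F'(1)]])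
        show "normal_jump \<sigma> F' x * \<phi> m x = 0" if "x \<in> rel_interior F'" for x
        proof -
          have "x \<notin> S" using that F'M F'(2) rel_interior_subset[of F'] by (auto simp: S_def)
          then show ?thesis by (simp add: zero)
        qed
      qed simp
      then show ?thesis by (simp add: facet_integral_def)
    qed
    then have "(\<Sum>F\<in>facets_I M. facet_integral M F (\<lambda>x. normal_jump \<sigma> F x * \<phi> m x)) =
       facet_integral M F (\<lambda>x. p x * \<phi> m x)"
      using F finite_facets facets_sub by (subst sum.remove[of _ F]) (auto simp: p_def intro: finite_subset sum.neutral)
    also have "\<dots> = J"
      unfolding J_def
    proof (rule facet_integral_cong[OF FM])
      show "(\<lambda>x. p x * \<phi> m x) \<in> borel_measurable borel" "(\<lambda>x. (p x)\<^sup>2 * bump a b x) \<in> borel_measurable borel"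
        by (intro borel_measurable_continuous_onI continuous_intros c\<phi> cp cb)+
      show "p x * \<phi> m x = (p x)\<^sup>2 * bump a b x" if "x \<in> rel_interior F" for x
      proof -
        have "E m x = 1" using F_plane[of x] that rel_interior_subset[of F] by (auto simp: E_def)
        then show ?thesis by (simp add: \<phi>_def power2_eq_square)
      qed
    qed
    finally have "(LINT x|lebesgue_on (dom M). \<sigma> x \<bullet> grad (\<phi> m) x) = - (LINT x|lebesgue_on (dom M). elem_div \<sigma> x * \<phi> m x) + J"
      using integral_grad_test_function[OF \<sigma> \<phi>[of m]] by simp
    moreover have "(LINT x|lebesgue_on (dom M). \<sigma> x \<bullet> grad (\<phi> m) x) = - (LINT x|lebesgue_on (dom M). q x * \<phi> m x)"
      using q(2) \<phi>[of m] by (simp add: has_weak_div_def)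
    moreover have "(LINT x|lebesgue_on (dom M). r x * \<phi> m x) =
      (LINT x|lebesgue_on (dom M). elem_div \<sigma> x * \<phi> m x) - (LINT x|lebesgue_on (dom M). q x * \<phi> m x)"
    proof -
      have L: "L2 (dom M) (\<phi> m)" "L2 (dom M) (elem_div \<sigma>)"
        using elem_div_DG[OF \<sigma>] L2_continuous[OF c\<phi> dom(2,4)] by (auto simp: DG_def)
      show ?thesis
        unfolding r_def left_diff_distrib
        using L2_inner_integrable[OF L(2,1)] L2_inner_integrable[OF q(1) L(1)]
        by (intro Bochner_Integration.integral_diff) simp_all
    qed
    ultimately show ?thesis by linarith
  qed
  obtain B where B: "\<forall>x\<in>cbox a b. norm (bump a b x * p x) \<le> B"
  proof -
    have "continuous_on (cbox a b) (\<lambda>x. bump a b x * p x)"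
      by (intro continuous_intros continuous_on_subset[OF cb] continuous_on_subset[OF cp]) auto
    then have "bounded ((\<lambda>x. bump a b x * p x) ` cbox a b)"
      by (intro compact_imp_bounded compact_continuous_image compact_cbox)
    then show thesis using that unfolding bounded_iff by auto
  qed
  have \<phi>B: "\<bar>\<phi> m x\<bar> \<le> \<bar>B\<bar>" for m x
  proof (cases "x \<in> cbox a b")
    case True
    have "\<bar>E m x\<bar> \<le> 1" by (simp add: E_def)
    moreover have "\<bar>bump a b x * p x\<bar> \<le> \<bar>B\<bar>" using B True by force
    ultimately have "\<bar>bump a b x * p x\<bar> * \<bar>E m x\<bar> \<le> \<bar>B\<bar> * 1"
      by (intro mult_mono) auto
    then show ?thesis by (simp add: \<phi>_def abs_mult mult.assoc)
  next
    case False
    then have "bump a b x = 0" using box_subset_cbox[of a b] by (auto simp: bump_eq_0_iff)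
    then show ?thesis by (simp add: \<phi>_def)
  qed
  have "(\<lambda>m. LINT x|lebesgue_on (dom M). r x * \<phi> m x) \<longlonglongrightarrow> (LINT x|lebesgue_on (dom M). 0)"
  proof (rule integral_dominated_convergence[where w = "\<lambda>x. \<bar>B\<bar> * \<bar>r x\<bar>"])
    show "(\<lambda>x. r x * \<phi> m x) \<in> borel_measurable (lebesgue_on (dom M))" for m
      using r(1) borel_measurable_lebesgue_on[OF borel_measurable_continuous_onI[OF c\<phi>[of m]]]
      by (intro borel_measurable_times) auto
    show "integrable (lebesgue_on (dom M)) (\<lambda>x. \<bar>B\<bar> * \<bar>r x\<bar>)"
      using r(1) by auto
    show "AE x in lebesgue_on (dom M). norm (r x * \<phi> m x) \<le> \<bar>B\<bar> * \<bar>r x\<bar>" for m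
    proof (rule AE_I2)
      fix x
      have "\<bar>\<phi> m x\<bar> * \<bar>r x\<bar> \<le> \<bar>B\<bar> * \<bar>r x\<bar>"
        by (rule mult_right_mono[OF \<phi>B]) simp
      then show "norm (r x * \<phi> m x) \<le> \<bar>B\<bar> * \<bar>r x\<bar>"
        by (simp add: abs_mult mult.commute)
    qed
    have "?n \<noteq> 0" using norm_n by auto
    then have "AE x in lebesgue. ?n \<bullet> x \<noteq> c"
      by (intro AE_completion AE_lborel_not_hyperplane) simp
    then have "AE x in lebesgue_on (dom M). ?n \<bullet> x \<noteq> c"
      using dom(4) by (subst AE_restrict_space_iff) (auto elim: eventually_mono)
    then show "AE x in lebesgue_on (dom M). (\<lambda>m. r x * \<phi> m x) \<longlonglongrightarrow> 0"
    proof eventually_elim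
      case (elim x)
      define e where "e = exp (- ((?n \<bullet> x - c) * (?n \<bullet> x - c)))"
      have "(?n \<bullet> x - c) * (?n \<bullet> x - c) > 0" using elim by (simp add: zero_less_mult_iff) linarith
      then have "0 < e" "e < 1" by (simp_all add: e_def)
      then have "(\<lambda>m. e ^ m) \<longlonglongrightarrow> 0" by (intro LIMSEQ_realpow_zero) auto
      moreover have "E m x = e ^ m" for m
        by (simp add: E_def e_def flip: exp_of_nat_mult)
      ultimately have "(\<lambda>m. E m x) \<longlonglongrightarrow> 0" by simp
      then have "(\<lambda>m. (r x * bump a b x * p x) * E m x) \<longlonglongrightarrow> (r x * bump a b x * p x) * 0"
        by (intro tendsto_mult tendsto_const)
      then show ?case by (simp add: \<phi>_def mult.assoc)
    qed
  qed simp
  then have "J = 0"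
    using J by (simp add: LIMSEQ_const_iff)
  then have "p y = 0"
    using F_plane[OF y] ab(1) x0
    by (intro polynomial_eq_0_on_plane[OF p cb bump_nonneg _ open_box, of a b x0])
      (auto simp: J_def facet_integral_def bump_eq_0_iff)
  then show ?thesis by (simp add: p_def)
qed

theorem has_weak_div_elem_div:
  assumes "\<sigma> \<in> RT M s"
  shows "has_weak_div (dom M) \<sigma> (elem_div \<sigma>)"
  unfolding has_weak_div_def
proof
  fix \<phi> assume \<phi>: "\<phi> \<in> test_functions (dom M)"
  have "facet_integral M F (\<lambda>x. normal_jump \<sigma> F x * \<phi> x) = 0" if F: "F \<in> facets_I M" for F
  proof -
    have FM: "F \<in> facets M" using F facets_sub by auto
    have "facet_integral M F (\<lambda>x. normal_jump \<sigma> F x * \<phi> x) = facet_integral M F (\<lambda>x. 0)"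
    proof (rule facet_integral_cong[OF FM])
      show "(\<lambda>x. normal_jump \<sigma> F x * \<phi> x) \<in> borel_measurable borel"
        by (intro borel_measurable_continuous_onI continuous_intros test_function_has_grad(3)[OF \<phi>]
            continuous_on_Pol[OF normal_jump_Pol[OF assms F]])
      show "normal_jump \<sigma> F x * \<phi> x = 0" if "x \<in> rel_interior F" for x
        using normal_jump_eq_0[OF assms F, of x] that rel_interior_subset[of F] by auto
    qed simp
    then show ?thesis by (simp add: facet_integral_def)
  qed
  then show "(LINT x|lebesgue_on (dom M). \<sigma> x \<bullet> grad \<phi> x) = - (LINT x|lebesgue_on (dom M). elem_div \<sigma> x * \<phi> x)"
    using integral_grad_test_function[OF assms \<phi>] by simp
qed

end

section \<open>Local conservation\<close>

text \<open>For s = 0 this takes the place of the volume moments, which are prescribed only for s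
  \<ge> 1.\<close>

lemma Pol_0_grad:
  assumes "p \<in> Pol 0"
  shows "grad p = (\<lambda>_. 0)"
proof -
  from assms have "\<exists>c. p = (\<lambda>_. c)"
  proof (induction rule: Pol_induct)
    case (monom c \<alpha>)
    then have "\<alpha> i = 0" for i by simp
    then show ?case by (auto simp: cart_monom_def)
  qed auto
  then obtain c where p: "p = (\<lambda>_. c)" ..
  have "(p has_derivative (\<lambda>v. 0 \<bullet> v)) (at x)" for x
    unfolding p by simp
  from grad_eq[OF this] show ?thesis by auto
qed

context mesh
begin

text \<open>Unlike in \<open>flux_moment\<close>, the trace is taken from \<open>Kminus\<close>, as
  in the defining conditions of the fluxes.\<close>

abbreviation moment :: "(real^'n \<Rightarrow> real^'n) \<Rightarrow> (real^'n \<Rightarrow> real) \<Rightarrow> (real^'n) set \<Rightarrow> real" where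
  "moment \<tau> \<phi> F \<equiv> facet_integral M F (\<lambda>x. normal_trace M \<tau> F x * \<phi> x)"

lemma DG_on_elem:
  assumes "u \<in> DG M m" "K \<in> elems M"
  shows "on_elem u K \<in> Pol m" "AE x in lebesgue_on K. u x = on_elem u K x"
proof -
  obtain p where p: "p \<in> Pol m" "AE x in lebesgue_on K. u x = p x"
    using assms by (auto simp: DG_def)
  have "on_elem u K = p"
    using p real_polynomial_function_Pol[OF p(1)]
    by (intro on_elem_eq elem[OF assms(2)]) (simp_all add: real_polynomial_function_eq)
  then show "on_elem u K \<in> Pol m" "AE x in lebesgue_on K. u x = on_elem u K x"
    using p by auto
qed

lemma RT_add:
  assumes "\<sigma> \<in> RT M s" "\<tau> \<in> RT M s"
  shows "(\<lambda>x. \<sigma> x + \<tau> x) \<in> RT M s"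
    and "K \<in> elems M \<Longrightarrow> on_elem (\<lambda>x. \<sigma> x + \<tau> x) K = (\<lambda>x. on_elem \<sigma> K x + on_elem \<tau> K x)"
proof -
  have L2: "L2 (dom M) \<sigma>" "L2 (dom M) \<tau>" using assms by (auto simp: RT_def Hdiv_def)
  obtain p where p: "L2 (dom M) p" "has_weak_div (dom M) \<sigma> p" using assms(1) by (auto simp: RT_def Hdiv_def)
  obtain q where q: "L2 (dom M) q" "has_weak_div (dom M) \<tau> q" using assms(2) by (auto simp: RT_def Hdiv_def)
  have "has_weak_div (dom M) (\<lambda>x. \<sigma> x + \<tau> x) (\<lambda>x. p x + q x)"
    unfolding has_weak_div_def
  proof
    fix \<phi> assume \<phi>: "\<phi> \<in> test_functions (dom M)"
    have L2\<phi>: "L2 (dom M) \<phi>" "L2 (dom M) (grad \<phi>)"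
      by (intro L2_continuous test_function_has_grad(2,3)[OF \<phi>] dom(2,4))+
    have "(LINT x|lebesgue_on (dom M). (\<sigma> x + \<tau> x) \<bullet> grad \<phi> x) =
      (LINT x|lebesgue_on (dom M). \<sigma> x \<bullet> grad \<phi> x) + (LINT x|lebesgue_on (dom M). \<tau> x \<bullet> grad \<phi> x)"
      unfolding inner_add_left
      by (intro Bochner_Integration.integral_add L2_inner_integrable L2 L2\<phi>)
    moreover have "(LINT x|lebesgue_on (dom M). (p x + q x) * \<phi> x) =
      (LINT x|lebesgue_on (dom M). p x * \<phi> x) + (LINT x|lebesgue_on (dom M). q x * \<phi> x)"
      unfolding distrib_right
      using L2_inner_integrable[OF p(1) L2\<phi>(1)] L2_inner_integrable[OF q(1) L2\<phi>(1)]
      by (intro Bochner_Integration.integral_add) simp_all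
    ultimately show "(LINT x|lebesgue_on (dom M). (\<sigma> x + \<tau> x) \<bullet> grad \<phi> x) = - (LINT x|lebesgue_on (dom M). (p x + q x) * \<phi> x)"
      using p(2) q(2) \<phi> by (simp add: has_weak_div_def)
  qed
  then have "(\<lambda>x. \<sigma> x + \<tau> x) \<in> Hdiv (dom M)"
    unfolding Hdiv_def using L2_add[OF L2] L2_add[OF p(1) q(1)] by blast
  moreover have ae: "AE x in lebesgue_on K. \<sigma> x + \<tau> x = on_elem \<sigma> K x + on_elem \<tau> K x" if "K \<in> elems M" for K
    using RT_on_elem(2)[OF assms(1) that] RT_on_elem(2)[OF assms(2) that] by eventually_elim simp
  moreover have el: "(\<lambda>x. on_elem \<sigma> K x + on_elem \<tau> K x) \<in> RT_elem s" if "K \<in> elems M" for K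
    by (intro RT_elem_add RT_on_elem[OF assms(1) that] RT_on_elem[OF assms(2) that])
  moreover have "\<exists>\<rho>\<in>RT_elem s. AE x in lebesgue_on K. \<sigma> x + \<tau> x = \<rho> x" if "K \<in> elems M" for K
    by (rule bexI[where x = "\<lambda>x. on_elem \<sigma> K x + on_elem \<tau> K x"]) (fact ae[OF that], fact el[OF that])
  ultimately show "(\<lambda>x. \<sigma> x + \<tau> x) \<in> RT M s"
    by (simp add: RT_def)
  show "on_elem (\<lambda>x. \<sigma> x + \<tau> x) K = (\<lambda>x. on_elem \<sigma> K x + on_elem \<tau> K x)" if "K \<in> elems M"
    by (intro on_elem_eq polynomial_function_PolV[OF RT_elem_PolV[OF el[OF that]]] ae[OF that] elem[OF that])
qed

section \<open>Test functions supported on one element\<close>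

lemma on_elem_indicator:
  fixes p :: "real^'n \<Rightarrow> 'b::euclidean_space"
  assumes "polynomial_function p" "K \<in> elems M" "L \<in> elems M"
  shows "on_elem (\<lambda>x. indicator K x *\<^sub>R p x) L = (if L = K then p else (\<lambda>_. 0))"
proof (cases "L = K")
  case True
  have "AE x in lebesgue_on K. indicator K x *\<^sub>R p x = p x"
    by (rule AE_I2) (simp add: space_restrict_space)
  then show ?thesis
    using True assms by (simp add: on_elem_eq elem)
next
  case False
  have "AE x in lebesgue_on L. indicator K x *\<^sub>R p x = 0"
    using AE_elem_not_other[OF assms(2,3)] False by (auto elim: eventually_mono)
  then show ?thesis
    using False assms by (simp add: on_elem_eq elem)
qed

lemma on_elem_indicator_Pol:
  assumes "p \<in> Pol m" "K \<in> elems M" "L \<in> elems M"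
  shows "on_elem (\<lambda>x. indicator K x * p x) L = (if L = K then p else (\<lambda>_. 0))"
  using on_elem_indicator[of p K L] assms real_polynomial_function_Pol[OF assms(1)]
  by (simp add: real_polynomial_function_eq)

lemma indicator_Pol_DG:
  assumes "p \<in> Pol m" "K \<in> elems M"
  shows "(\<lambda>x. indicator K x * p x) \<in> DG M m"
proof -
  have "\<exists>q\<in>Pol m. AE x in lebesgue_on L. indicator K x * p x = q x" if "L \<in> elems M" for L
  proof (cases "L = K")
    case True
    have "AE x in lebesgue_on K. indicator K x * p x = p x"
      by (rule AE_I2) (simp add: space_restrict_space)
    then show ?thesis using True assms by blast
  next
    case False
    have "AE x in lebesgue_on L. indicator K x * p x = 0"
      using AE_elem_not_other[OF assms(2) that] False by (auto elim: eventually_mono)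
    then show ?thesis using Pol_zero by (intro bexI[of _ "\<lambda>_. 0"])
  qed
  then show ?thesis
    unfolding DG_def using L2_indicator_Pol[OF assms] by blast
qed

text \<open>The jump of an extension by zero carries the same sign as the outward normal of K. This
  is how the sums over all facets in the DG form become boundary terms of K.\<close>

lemma jump_indicator:
  assumes "p \<in> Pol m" "K \<in> elems M" "F \<in> facets M"
  shows "jump M (\<lambda>x. indicator K x * p x) F x = orient K F * p x"
proof (cases "F \<in> facets_I M")
  case True
  show ?thesis
    using True interior_facet_elems(2)[OF True]
    by (simp add: jump_def orient_def on_elem_indicator_Pol[OF assms(1,2)] Kminus[OF assms(3)] Kplus[OF True])
next
  case False
  then show ?thesis
    by (simp add: jump_def orient_def on_elem_indicator_Pol[OF assms(1,2)] Kminus[OF assms(3)])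
qed

text \<open>The first claim exhibits the average as the one in \<open>jump_flux\<close> with the
  field \<open>grad p\<close> extended by zero; the second restricts the sum over all facets to
  those of K; the third settles s = 0.\<close>

lemma flux_avg_indicator:
  assumes p: "p \<in> Pol m" and K: "K \<in> elems M" and F: "F \<in> facets M"
  shows "flux_avg M A (\<lambda>x. indicator K x * p x) F x =
      wavg M A (\<lambda>L x. (elem_const A L *v on_elem (\<lambda>y. indicator K y *\<^sub>R grad p y) L x) \<bullet> normal M F) F x"
    and "F \<notin> facets_of K \<Longrightarrow> flux_avg M A (\<lambda>x. indicator K x * p x) F x = 0"
    and "grad p = (\<lambda>_. 0) \<Longrightarrow> flux_avg M A (\<lambda>x. indicator K x * p x) F x = 0"
proof -
  have grad_0: "grad (\<lambda>_. 0) = (\<lambda>_. 0 :: real^'n)"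
    by (rule Pol_0_grad[OF Pol_zero])
  have 1: "grad (on_elem (\<lambda>x. indicator K x * p x) L) = (if L = K then grad p else (\<lambda>_. 0))" if "L \<in> elems M" for L
    using on_elem_indicator_Pol[OF p K that] grad_0 by simp
  have 2: "on_elem (\<lambda>y. indicator K y *\<^sub>R grad p y) L = (if L = K then grad p else (\<lambda>_. 0))" if "L \<in> elems M" for L
    by (rule on_elem_indicator[OF polynomial_function_PolV[OF Pol_grad(2)[OF p]] K that])
  show "flux_avg M A (\<lambda>x. indicator K x * p x) F x =
      wavg M A (\<lambda>L x. (elem_const A L *v on_elem (\<lambda>y. indicator K y *\<^sub>R grad p y) L x) \<bullet> normal M F) F x"
    using Kminus(1)[OF F] Kplus(1)[of F] by (simp add: flux_avg_def wavg_def 1 2)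
  show "flux_avg M A (\<lambda>x. indicator K x * p x) F x = 0" if "F \<notin> facets_of K"
  proof -
    have "Kminus M F \<noteq> K" "F \<in> facets_I M \<Longrightarrow> Kplus M F \<noteq> K"
      using that Kminus(2)[OF F] Kplus(2)[of F] by auto
    then show ?thesis
      using Kminus(1)[OF F] Kplus(1)[of F] by (simp add: flux_avg_def wavg_def 1)
  qed
  show "flux_avg M A (\<lambda>x. indicator K x * p x) F x = 0" if "grad p = (\<lambda>_. 0)"
    using Kminus(1)[OF F] Kplus(1)[of F] that by (simp add: flux_avg_def wavg_def 1)
qed

text \<open>The facet sum runs over the whole mesh, which costs nothing as \<open>orient K F\<close>
  vanishes off K. The non-Neumann terms come from the DG form and the Neumann terms from the load,
  and both have the same shape, so they recombine by one set difference.\<close>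

lemma dg_solution_local:
  assumes u: "dg_solution M A f g \<gamma> \<delta> k u" and f: "L2 (dom M) f" and "s \<le> k"
    and \<sigma>: "weighted_averaging_flux M A g s u \<sigma>" and \<tau>: "jump_flux M A \<gamma> \<delta> s u \<tau>"
    and K: "K \<in> elems M" and \<phi>: "\<phi> \<in> Pol s"
  shows "(LINT x|lebesgue_on K. f x * \<phi> x) =
    - (LINT x|lebesgue_on K. \<sigma> x \<bullet> grad \<phi> x) - (LINT x|lebesgue_on K. \<tau> x \<bullet> grad \<phi> x) +
    (\<Sum>F\<in>facets M. orient K F * (moment \<sigma> \<phi> F
       + moment \<tau> \<phi> F))"
proof -
  define v where "v x = indicator K x * \<phi> x" for x
  have \<phi>k: "\<phi> \<in> Pol k" using \<phi> \<open>s \<le> k\<close> by (rule Pol_mono)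
  have v: "v \<in> DG M k" unfolding v_def by (rule indicator_Pol_DG[OF \<phi>k K])
  let ?S = "moment \<sigma> \<phi>" and ?T = "moment \<tau> \<phi>"
  let ?E = "facets M - facets_N M"
  have jump: "jump M v F x = orient K F * \<phi> x" if "F \<in> facets M" for F x
    unfolding v_def by (rule jump_indicator[OF \<phi> K that])
  have on_v: "on_elem v L = (if L = K then \<phi> else (\<lambda>_. 0))" if "L \<in> elems M" for L
    unfolding v_def by (rule on_elem_indicator_Pol[OF \<phi> K that])
  have grad_0: "grad (\<lambda>_. 0) = (\<lambda>_. 0 :: real^'n)"
    by (rule Pol_0_grad[OF Pol_zero])
  have volume: "(\<Sum>L\<in>elems M. LINT x|lebesgue_on L. (elem_const A L *v grad (on_elem u L) x) \<bullet> grad (on_elem v L) x) =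
    - (LINT x|lebesgue_on K. \<sigma> x \<bullet> grad \<phi> x)"
  proof -
    have "(\<Sum>L\<in>elems M. LINT x|lebesgue_on L. (elem_const A L *v grad (on_elem u L) x) \<bullet> grad (on_elem v L) x) =
      (\<Sum>L\<in>elems M. if L = K then LINT x|lebesgue_on K. (elem_const A K *v grad (on_elem u K) x) \<bullet> grad \<phi> x else 0)"
      by (rule sum.cong) (auto simp: on_v grad_0)
    also have "\<dots> = (LINT x|lebesgue_on K. (elem_const A K *v grad (on_elem u K) x) \<bullet> grad \<phi> x)"
      using finite_elems K by simp
    also have "\<dots> = - (LINT x|lebesgue_on K. \<sigma> x \<bullet> grad \<phi> x)"
    proof (cases "s = 0")
      case True
      then have "grad \<phi> = (\<lambda>_. 0)" using Pol_0_grad \<phi> by simp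
      then show ?thesis by simp
    next
      case False
      then show ?thesis
        using \<sigma> K Pol_grad(2)[OF \<phi>] by (simp add: weighted_averaging_flux_def)
    qed
    finally show ?thesis .
  qed
  have penalty: "(\<Sum>F\<in>?E. facet_integral M F (\<lambda>x. \<gamma> * (alpha_min M A F / diameter F) * jump M u F x * jump M v F x)) =
    (\<Sum>F\<in>?E. orient K F * ?T F)"
  proof (rule sum.cong[OF refl])
    fix F assume F: "F \<in> ?E"
    have "facet_integral M F (\<lambda>x. \<gamma> * (alpha_min M A F / diameter F) * jump M u F x * jump M v F x) =
      facet_integral M F (\<lambda>x. (orient K F * (\<gamma> * (alpha_min M A F / diameter F))) * (jump M u F x * \<phi> x))"
      using F by (simp add: jump mult_ac)
    also have "\<dots> = orient K F * (\<gamma> * (alpha_min M A F / diameter F) * facet_integral M F (\<lambda>x. jump M u F x * \<phi> x))"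
      unfolding facet_integral_def integral_mult_right_zero by (simp only: mult.assoc)
    also have "\<gamma> * (alpha_min M A F / diameter F) * facet_integral M F (\<lambda>x. jump M u F x * \<phi> x) = ?T F"
      using \<tau> F \<phi> by (simp add: jump_flux_def)
    finally show "facet_integral M F (\<lambda>x. \<gamma> * (alpha_min M A F / diameter F) * jump M u F x * jump M v F x) =
      orient K F * ?T F" .
  qed
  have consistency: "(\<Sum>F\<in>?E. facet_integral M F (\<lambda>x. flux_avg M A u F x * jump M v F x)) =
    - (\<Sum>F\<in>?E. orient K F * ?S F)"
    unfolding sum_negf[symmetric]
  proof (rule sum.cong[OF refl])
    fix F assume F: "F \<in> ?E"
    have "facet_integral M F (\<lambda>x. flux_avg M A u F x * jump M v F x) =
      facet_integral M F (\<lambda>x. orient K F * (flux_avg M A u F x * \<phi> x))"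
      using F by (simp add: jump mult_ac)
    also have "\<dots> = orient K F * facet_integral M F (\<lambda>x. flux_avg M A u F x * \<phi> x)"
      unfolding facet_integral_def by (rule integral_mult_right_zero)
    also have "facet_integral M F (\<lambda>x. flux_avg M A u F x * \<phi> x) = - ?S F"
      using \<sigma> F \<phi> by (simp add: weighted_averaging_flux_def)
    finally show "facet_integral M F (\<lambda>x. flux_avg M A u F x * jump M v F x) = - (orient K F * ?S F)"
      by simp
  qed
  have symmetry: "\<delta> * (\<Sum>F\<in>?E. facet_integral M F (\<lambda>x. flux_avg M A v F x * jump M u F x)) =
    - (LINT x|lebesgue_on K. \<tau> x \<bullet> grad \<phi> x)"
  proof (cases "s = 0")
    case True
    then have g0: "grad \<phi> = (\<lambda>_. 0)" using Pol_0_grad \<phi> by simp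
    have "facet_integral M F (\<lambda>x. flux_avg M A v F x * jump M u F x) = 0" if "F \<in> ?E" for F
      using flux_avg_indicator(3)[OF \<phi> K _ g0] that by (simp add: facet_integral_def v_def[abs_def])
    then show ?thesis using g0 by simp
  next
    case False
    \<comment> \<open>\<open>jump_flux\<close> sums over the facets of K only; on the others the
      average of the extended gradient is zero. The factor - \<delta> in its definition accounts for
      the sign of the result.\<close>
    have "(\<Sum>F\<in>?E. facet_integral M F (\<lambda>x. flux_avg M A v F x * jump M u F x)) =
      (\<Sum>F\<in>facets_of K - facets_N M. facet_integral M F (\<lambda>x. flux_avg M A v F x * jump M u F x))"
    proof (intro sum.mono_neutral_right ballI)
      show "facet_integral M F (\<lambda>x. flux_avg M A v F x * jump M u F x) = 0" if "F \<in> ?E - (facets_of K - facets_N M)" for F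
      proof -
        have "F \<in> facets M" "F \<notin> facets_of K" using that by auto
        then show ?thesis
          by (simp add: v_def[abs_def] flux_avg_indicator(2)[OF \<phi> K] facet_integral_def)
      qed
    qed (use finite_facets facets_ofD[OF K] in auto)
    also have "\<dots> = (\<Sum>F\<in>facets_of K - facets_N M. facet_integral M F (\<lambda>x.
        wavg M A (\<lambda>L x. (elem_const A L *v on_elem (\<lambda>y. indicator K y *\<^sub>R grad \<phi> y) L x) \<bullet> normal M F) F x * jump M u F x))"
      using facets_ofD[OF K] by (intro sum.cong refl) (simp add: v_def[abs_def] flux_avg_indicator(1)[OF \<phi> K])
    finally show ?thesis
      using \<tau> K Pol_grad(2)[OF \<phi>] False by (simp add: jump_flux_def)
  qed
  \<comment> \<open>A Neumann facet has no plus side, so \<open>orient K F\<close> is 1 or 0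
    according to whether F belongs to K, and this is the factor between \<phi> and the trace of v.
    The moment of the jump flux is zero here and is added to give all facets the same form.\<close>
  have neumann: "(\<Sum>F\<in>facets_N M. facet_integral M F (\<lambda>x. g x * on_elem v (Kminus M F) x)) =
    (\<Sum>F\<in>facets_N M. orient K F * (?S F + ?T F))"
  proof (rule sum.cong[OF refl])
    fix F assume F: "F \<in> facets_N M"
    then have FM: "F \<in> facets M" "F \<notin> facets_I M" using facets_sub facets_I_N_disjoint by auto
    have "facet_integral M F (\<lambda>x. g x * on_elem v (Kminus M F) x) = facet_integral M F (\<lambda>x. orient K F * (g x * \<phi> x))"
      using FM(2) by (simp add: on_v[OF Kminus(1)[OF FM(1)]] orient_def)
    also have "\<dots> = orient K F * facet_integral M F (\<lambda>x. g x * \<phi> x)"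
      unfolding facet_integral_def by (rule integral_mult_right_zero)
    also have "facet_integral M F (\<lambda>x. g x * \<phi> x) = ?S F + ?T F"
      using \<sigma> \<tau> F \<phi> by (simp add: weighted_averaging_flux_def jump_flux_def)
    finally show "facet_integral M F (\<lambda>x. g x * on_elem v (Kminus M F) x) = orient K F * (?S F + ?T F)" .
  qed
  have load: "(LINT x|lebesgue_on (dom M). f x * v x) = (LINT x|lebesgue_on K. f x * \<phi> x)"
  proof -
    have "(LINT x|lebesgue_on (dom M). f x * v x) = (\<Sum>L\<in>elems M. LINT x|lebesgue_on L. (if L = K then f x * \<phi> x else 0))"
    proof (rule integral_dom_pieces)
      show "integrable (lebesgue_on (dom M)) (\<lambda>x. f x * v x)"
        using L2_inner_integrable[OF f, of v] v by (simp add: DG_def)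
      show "AE x in lebesgue_on L. f x * v x = (if L = K then f x * \<phi> x else 0)" if "L \<in> elems M" for L
        using DG_on_elem(2)[OF v that] by eventually_elim (simp add: on_v[OF that])
      show "(\<lambda>x. if L = K then f x * \<phi> x else 0) \<in> borel_measurable (lebesgue_on L)" if "L \<in> elems M" for L
        using integral_dom(2)[OF L2_integrable[OF f dom(2,4)] that]
          borel_measurable_lebesgue_on[OF borel_measurable_Pol[OF \<phi>]]
        by (cases "L = K") auto
    qed
    also have "\<dots> = (\<Sum>L\<in>elems M. if L = K then LINT x|lebesgue_on K. f x * \<phi> x else 0)"
      by (rule sum.cong) auto
    finally show ?thesis using finite_elems K by simp
  qed
  have "a_dg M A \<gamma> \<delta> u v = (LINT x|lebesgue_on (dom M). f x * v x)
        - (\<Sum>F\<in>facets_N M. facet_integral M F (\<lambda>x. g x * on_elem v (Kminus M F) x))"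
    using u v by (simp add: dg_solution_def)
  then have "(LINT x|lebesgue_on K. f x * \<phi> x) =
    - (LINT x|lebesgue_on K. \<sigma> x \<bullet> grad \<phi> x) - (LINT x|lebesgue_on K. \<tau> x \<bullet> grad \<phi> x)
    + (\<Sum>F\<in>?E. orient K F * (?S F + ?T F)) + (\<Sum>F\<in>facets_N M. orient K F * (?S F + ?T F))"
    unfolding a_dg_def volume penalty consistency symmetry neumann load
    by (simp add: distrib_left sum.distrib)
  also have "(\<Sum>F\<in>?E. orient K F * (?S F + ?T F)) =
      (\<Sum>F\<in>facets M. orient K F * (?S F + ?T F)) - (\<Sum>F\<in>facets_N M. orient K F * (?S F + ?T F))"
    by (rule sum_diff[OF finite_facets facets_sub(2)])
  finally show ?thesis by simp
qed

text \<open>The divergence theorem for the summed field and the local form of the DG equation have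
  the same volume and facet terms once all traces are taken from \<open>Kminus\<close>, so the
  remaining terms agree.\<close>

lemma elem_div_eq_load:
  assumes u: "dg_solution M A f g \<gamma> \<delta> k u" and f: "L2 (dom M) f" and "s \<le> k"
    and \<sigma>: "weighted_averaging_flux M A g s u \<sigma>" and \<tau>: "jump_flux M A \<gamma> \<delta> s u \<tau>"
    and K: "K \<in> elems M" and \<phi>: "\<phi> \<in> Pol s"
  shows "(LINT x|lebesgue_on K. divergence (on_elem (\<lambda>x. \<sigma> x + \<tau> x) K) x * \<phi> x) = (LINT x|lebesgue_on K. f x * \<phi> x)"
proof -
  have RT: "\<sigma> \<in> RT M s" "\<tau> \<in> RT M s"
    using \<sigma> \<tau> by (auto simp: weighted_averaging_flux_def jump_flux_def)
  define \<rho> where "\<rho> L = on_elem (\<lambda>x. \<sigma> x + \<tau> x) L" for L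
  have \<rho>_RT: "\<rho> L \<in> RT_elem s" if "L \<in> elems M" for L
    unfolding \<rho>_def by (rule RT_on_elem[OF RT_add(1)[OF RT] that])
  have \<rho>_add: "\<rho> L x = on_elem \<sigma> L x + on_elem \<tau> L x" if "L \<in> elems M" for L x
    unfolding \<rho>_def using RT_add(2)[OF RT that] by simp
  have cg: "continuous_on UNIV (grad \<phi>)" by (rule continuous_on_PolV[OF Pol_grad(2)[OF \<phi>]])
  have c\<phi>: "continuous_on UNIV \<phi>" by (rule continuous_on_Pol[OF \<phi>])
  have c: "continuous_on UNIV (on_elem \<sigma> L)" "continuous_on UNIV (on_elem \<tau> L)" "continuous_on UNIV (\<rho> L)"
    "continuous_on UNIV (divergence (\<rho> L))" if "L \<in> elems M" for L
    using that RT \<rho>_RT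
    by (auto intro!: continuous_on_PolV[OF RT_elem_PolV] RT_on_elem continuous_on_Pol[OF divergence_RT_elem])
  have vol: "(LINT x|lebesgue_on K. \<zeta> x \<bullet> grad \<phi> x) = (LINT x|lebesgue_on K. on_elem \<zeta> K x \<bullet> grad \<phi> x)" if "\<zeta> \<in> RT M s" for \<zeta>
  proof (rule integral_cong_AE)
    have "L2 (dom M) \<zeta>" "L2 (dom M) (grad \<phi>)"
      using that L2_continuous[OF cg dom(2,4)] by (auto simp: RT_def Hdiv_def)
    from integral_dom(2)[OF L2_inner_integrable[OF this] K]
    show "(\<lambda>x. \<zeta> x \<bullet> grad \<phi> x) \<in> borel_measurable (lebesgue_on K)" by simp
    show "(\<lambda>x. on_elem \<zeta> K x \<bullet> grad \<phi> x) \<in> borel_measurable (lebesgue_on K)"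
      by (intro borel_measurable_lebesgue_on borel_measurable_continuous_onI continuous_intros cg
          continuous_on_PolV[OF RT_elem_PolV[OF RT_on_elem(1)[OF that K]]])
    show "AE x in lebesgue_on K. \<zeta> x \<bullet> grad \<phi> x = on_elem \<zeta> K x \<bullet> grad \<phi> x"
      using RT_on_elem(2)[OF that K] by eventually_elim simp
  qed
  \<comment> \<open>Here the single normal trace enters: if K is the plus side of F, its own trace
    is replaced by the one from \<open>Kminus\<close>, for which the moments are prescribed.\<close>
  have face: "flux_moment (\<rho> K) \<phi> F =
     moment \<sigma> \<phi> F + moment \<tau> \<phi> F"
    if F: "F \<in> facets_of K" for F
  proof -
    have FM: "F \<in> facets M" by (rule facets_ofD[OF K F])
    note Km = Kminus(1)[OF FM]
    have "flux_moment (\<rho> K) \<phi> F = flux_moment (\<rho> (Kminus M F)) \<phi> F"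
    proof (rule facet_integral_cong[OF FM])
      show "(\<lambda>x. (\<rho> K x \<bullet> normal M F) * \<phi> x) \<in> borel_measurable borel" "(\<lambda>x. (\<rho> (Kminus M F) x \<bullet> normal M F) * \<phi> x) \<in> borel_measurable borel"
        by (intro borel_measurable_continuous_onI continuous_intros c[OF K] c[OF Km] c\<phi>)+
      show "(\<rho> K x \<bullet> normal M F) * \<phi> x = (\<rho> (Kminus M F) x \<bullet> normal M F) * \<phi> x" if "x \<in> rel_interior F" for x
      proof (cases "K = Kminus M F")
        case False
        then have "F \<in> facets_I M" "K = Kplus M F" using orient_cases[OF K F] by auto
        then show ?thesis
          using normal_jump_eq_0[OF RT_add(1)[OF RT], of F x] that rel_interior_subset[of F]
          by (auto simp: normal_jump_def \<rho>_def inner_diff_left)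
      qed simp
    qed
    also have "\<dots> = facet_integral M F (\<lambda>x. normal_trace M \<sigma> F x * \<phi> x + normal_trace M \<tau> F x * \<phi> x)"
      by (simp add: \<rho>_add[OF Km] normal_trace_def inner_add_left distrib_right)
    also have "\<dots> = moment \<sigma> \<phi> F + moment \<tau> \<phi> F"
      unfolding facet_integral_def normal_trace_def
      by (intro Bochner_Integration.integral_add facet_integrable FM continuous_intros c[OF Km] c\<phi>)
    finally show ?thesis .
  qed
  have "(LINT x|lebesgue_on K. divergence (\<rho> K) x * \<phi> x + \<rho> K x \<bullet> grad \<phi> x) =
     (\<Sum>F\<in>facets_of K. orient K F * flux_moment (\<rho> K) \<phi> F)"
    by (rule elem_divergence_theorem[OF K \<rho>_RT[OF K] Pol_grad(1)[OF \<phi>] cg])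
  also have "\<dots> = (\<Sum>F\<in>facets_of K. orient K F * (moment \<sigma> \<phi> F + moment \<tau> \<phi> F))"
    by (intro sum.cong refl) (simp add: face)
  also have "\<dots> = (\<Sum>F\<in>facets M. orient K F * (moment \<sigma> \<phi> F + moment \<tau> \<phi> F))"
    using facets_ofD[OF K] finite_facets orient_eq_0 by (intro sum.mono_neutral_left) auto
  also have "(LINT x|lebesgue_on K. divergence (\<rho> K) x * \<phi> x + \<rho> K x \<bullet> grad \<phi> x) =
     (LINT x|lebesgue_on K. divergence (\<rho> K) x * \<phi> x) + ((LINT x|lebesgue_on K. on_elem \<sigma> K x \<bullet> grad \<phi> x) + (LINT x|lebesgue_on K. on_elem \<tau> K x \<bullet> grad \<phi> x))"
  proof -
    have "(LINT x|lebesgue_on K. divergence (\<rho> K) x * \<phi> x + \<rho> K x \<bullet> grad \<phi> x) =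
      (LINT x|lebesgue_on K. divergence (\<rho> K) x * \<phi> x) + (LINT x|lebesgue_on K. \<rho> K x \<bullet> grad \<phi> x)"
      by (intro Bochner_Integration.integral_add integrable_lebesgue_on_continuous elem(4,5)[OF K] continuous_intros c[OF K] c\<phi> cg)
    also have "(LINT x|lebesgue_on K. \<rho> K x \<bullet> grad \<phi> x) =
      (LINT x|lebesgue_on K. on_elem \<sigma> K x \<bullet> grad \<phi> x) + (LINT x|lebesgue_on K. on_elem \<tau> K x \<bullet> grad \<phi> x)"
      unfolding \<rho>_add[OF K] inner_add_left
      by (intro Bochner_Integration.integral_add integrable_lebesgue_on_continuous elem(4,5)[OF K] continuous_intros c[OF K] c\<phi> cg)
    finally show ?thesis .
  qed
  finally show ?thesis
    using dg_solution_local[OF u f \<open>s \<le> k\<close> \<sigma> \<tau> K \<phi>] vol[OF RT(1)] vol[OF RT(2)]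
    by (simp add: \<rho>_def)
qed

text \<open>The elementwise divergence lies in \<open>DG M s\<close> and has the moments of f
  against that whole space, so it is itself the projection of f, and it is the weak divergence since
  the normal jumps vanish. On a Neumann facet the moments of the two fluxes add up to those of
  g.\<close>

theorem reconstructed_flux_locally_conservative:
  assumes u: "dg_solution M A f g \<gamma> \<delta> k u" and f: "L2 (dom M) f" and "s \<le> k"
    and \<sigma>: "weighted_averaging_flux M A g s u \<sigma>" and \<tau>: "jump_flux M A \<gamma> \<delta> s u \<tau>"
  shows "(\<lambda>x. \<sigma> x + \<tau> x) \<in> RT_f M f g s"
proof -
  let ?\<zeta> = "\<lambda>x. \<sigma> x + \<tau> x"
  have RT: "\<sigma> \<in> RT M s" "\<tau> \<in> RT M s"
    using \<sigma> \<tau> by (auto simp: weighted_averaging_flux_def jump_flux_def)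
  have \<zeta>: "?\<zeta> \<in> RT M s" by (rule RT_add(1)[OF RT])
  have "L2_projection_DG M s f (elem_div ?\<zeta>)"
    unfolding L2_projection_DG_def
  proof (intro conjI ballI)
    show "elem_div ?\<zeta> \<in> DG M s" by (rule elem_div_DG[OF \<zeta>])
    fix v assume v: "v \<in> DG M s"
    have L2: "L2 (dom M) v" "L2 (dom M) (elem_div ?\<zeta>)" using v elem_div_DG[OF \<zeta>] by (auto simp: DG_def)
    have "(LINT x|lebesgue_on (dom M). elem_div ?\<zeta> x * v x) = (\<Sum>K\<in>elems M. LINT x|lebesgue_on K. divergence (on_elem ?\<zeta> K) x * on_elem v K x)"
    proof (rule integral_dom_pieces)
      show "integrable (lebesgue_on (dom M)) (\<lambda>x. elem_div ?\<zeta> x * v x)"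
        using L2_inner_integrable[OF L2(2,1)] by simp
      show "AE x in lebesgue_on K. elem_div ?\<zeta> x * v x = divergence (on_elem ?\<zeta> K) x * on_elem v K x" if "K \<in> elems M" for K
        using AE_piecewise[OF that, of "\<lambda>K. divergence (on_elem ?\<zeta> K)"] DG_on_elem(2)[OF v that]
        unfolding elem_div_def by eventually_elim simp
      show "(\<lambda>x. divergence (on_elem ?\<zeta> K) x * on_elem v K x) \<in> borel_measurable (lebesgue_on K)" if "K \<in> elems M" for K
        by (intro borel_measurable_lebesgue_on borel_measurable_times borel_measurable_Pol[OF DG_on_elem(1)[OF v that]]
            borel_measurable_Pol[OF divergence_RT_elem[OF RT_on_elem(1)[OF \<zeta> that]]])
    qed
    also have "\<dots> = (\<Sum>K\<in>elems M. LINT x|lebesgue_on K. f x * on_elem v K x)"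
      by (intro sum.cong refl elem_div_eq_load[OF u f \<open>s \<le> k\<close> \<sigma> \<tau>] DG_on_elem(1)[OF v])
    also have "\<dots> = (LINT x|lebesgue_on (dom M). f x * v x)"
    proof (rule integral_dom_pieces[symmetric])
      show "integrable (lebesgue_on (dom M)) (\<lambda>x. f x * v x)"
        using L2_inner_integrable[OF f L2(1)] by simp
      show "AE x in lebesgue_on K. f x * v x = f x * on_elem v K x" if "K \<in> elems M" for K
        using DG_on_elem(2)[OF v that] by eventually_elim simp
      show "(\<lambda>x. f x * on_elem v K x) \<in> borel_measurable (lebesgue_on K)" if "K \<in> elems M" for K
        using integral_dom(2)[OF L2_integrable[OF f dom(2,4)] that]
          borel_measurable_lebesgue_on[OF borel_measurable_Pol[OF DG_on_elem(1)[OF v that]]]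
        by auto
    qed
    finally show "(LINT x|lebesgue_on (dom M). elem_div ?\<zeta> x * v x) = (LINT x|lebesgue_on (dom M). f x * v x)" .
  qed
  moreover have "\<exists>gm. L2_projection_facet M s F g gm \<and> (\<forall>x\<in>F. normal_trace M ?\<zeta> F x = gm x)" if F: "F \<in> facets_N M" for F
  proof -
    have FM: "F \<in> facets M" using F facets_sub by auto
    note Km = Kminus(1)[OF FM]
    obtain c where "flat_set F (normal M F) c" using facet_plane[OF FM] .
    then interpret flat_set F "normal M F" c .
    \<comment> \<open>As a polynomial on the whole space the normal component may have degree s + 1;
      it agrees with one of degree s on the plane of F, and that one is the projection of g.\<close>
    obtain gm where gm: "gm \<in> Pol s" "\<forall>x. normal M F \<bullet> x = c \<longrightarrow> on_elem ?\<zeta> (Kminus M F) x \<bullet> normal M F = gm x"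
      using RT_elem_normal_component[OF RT_on_elem(1)[OF \<zeta> Km]] by blast
    have tr: "normal_trace M ?\<zeta> F x = gm x" if "x \<in> F" for x
      using gm(2) F_plane[OF that] by (simp add: normal_trace_def)
    have "facet_integral M F (\<lambda>x. gm x * \<phi> x) = facet_integral M F (\<lambda>x. g x * \<phi> x)" if \<phi>: "\<phi> \<in> Pol s" for \<phi>
    proof -
      have c\<phi>: "continuous_on UNIV \<phi>" by (rule continuous_on_Pol[OF \<phi>])
      have c: "continuous_on UNIV (on_elem \<eta> (Kminus M F))" if "\<eta> \<in> RT M s" for \<eta>
        by (rule continuous_on_PolV[OF RT_elem_PolV[OF RT_on_elem(1)[OF that Km]]])
      have "facet_integral M F (\<lambda>x. gm x * \<phi> x) = facet_integral M F (\<lambda>x. normal_trace M ?\<zeta> F x * \<phi> x)"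
      proof (rule facet_integral_cong[OF FM])
        show "(\<lambda>x. gm x * \<phi> x) \<in> borel_measurable borel"
          by (intro borel_measurable_times borel_measurable_Pol[OF gm(1)] borel_measurable_Pol[OF \<phi>])
        show "(\<lambda>x. normal_trace M ?\<zeta> F x * \<phi> x) \<in> borel_measurable borel"
          unfolding normal_trace_def by (intro borel_measurable_continuous_onI continuous_intros c[OF \<zeta>] c\<phi>)
        show "gm x * \<phi> x = normal_trace M ?\<zeta> F x * \<phi> x" if "x \<in> rel_interior F" for x
          using tr[of x] that rel_interior_subset[of F] by auto
      qed
      also have "\<dots> = facet_integral M F (\<lambda>x. normal_trace M \<sigma> F x * \<phi> x + normal_trace M \<tau> F x * \<phi> x)"
        by (simp add: RT_add(2)[OF RT Km] normal_trace_def inner_add_left distrib_right)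
      also have "\<dots> = moment \<sigma> \<phi> F + moment \<tau> \<phi> F"
        unfolding facet_integral_def normal_trace_def
        by (intro Bochner_Integration.integral_add facet_integrable FM continuous_intros c RT c\<phi>)
      also have "\<dots> = facet_integral M F (\<lambda>x. g x * \<phi> x)"
        using \<sigma> \<tau> F \<phi> by (simp add: weighted_averaging_flux_def jump_flux_def)
      finally show ?thesis .
    qed
    then have "L2_projection_facet M s F g gm"
      using gm(1) by (simp add: L2_projection_facet_def)
    then show ?thesis using tr by blast
  qed
  ultimately show ?thesis
    unfolding RT_f_def using \<zeta> has_weak_div_elem_div[OF \<zeta>] by blast
qed

end

theorem lemma3p1:
  fixes M :: "'n::finite dg_mesh"
    and A :: "real^'n \<Rightarrow> real^'n^'n"
    and f g u :: "real^'n \<Rightarrow> real"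
    and \<sigma>t \<sigma>\<Delta> :: "real^'n \<Rightarrow> real^'n"
    and k s :: nat and \<gamma> \<delta> :: real
  assumes "CARD('n) = 2 \<or> CARD('n) = 3"
    and "wf_mesh M"
    and "coefficient M A"
    and "L2 (dom M) f"
    and "1 \<le> k" and "s \<le> k"
    and "neumann_data M (k - 1) g"
    and "0 < \<gamma>" and "\<delta> \<in> {1, 0, -1}"
    and "dg_solution M A f g \<gamma> \<delta> k u"
    and "weighted_averaging_flux M A g s u \<sigma>t"
    and "jump_flux M A \<gamma> \<delta> s u \<sigma>\<Delta>"
  shows "(\<lambda>x. \<sigma>t x + \<sigma>\<Delta> x) \<in> RT M s \<and> (\<lambda>x. \<sigma>t x + \<sigma>\<Delta> x) \<in> RT_f M f g s"
proof -
  interpret mesh M by standard (fact assms(2))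
  have "(\<lambda>x. \<sigma>t x + \<sigma>\<Delta> x) \<in> RT_f M f g s"
    by (rule reconstructed_flux_locally_conservative[OF assms(10,4,6,11,12)])
  then show ?thesis by (simp add: RT_f_def)
qed

end
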